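(* Let $k,l\ge3$ be integers and let $X=(x_{i,j})$ be a $3\times kl$ matrix. Let $R_i=\{i,k+i,\ldots,(l-1)k+i\}$ ($i\in[k]$), $C_j=\{(j-1)k+1,\ldots,(j-1)k+k\}$ ($j\in[l]$), $R=\{R_1,\ldots,R_k\}$, $C=\{C_1,\ldots,C_l\}$, $\Delta=\bigcup_{i\in[k]}\binom{R_i}{3}\cup\bigcup_{j\in[l]}\binom{C_j}{3}$, and $V_\Delta=\{Y\in\mathbb{C}^{3\times kl}:\operatorname{rank}(Y_F)<|F|\text{ for all }F\in\Delta\}$, where $Y_F$ is the submatrix with columns indexed by $F$. Then $V_\Delta$ has the irredundant irreducible decomposition $$V_\Delta=\bigcup_{\mathcal{Q}}V_{G_{k,l}(\mathcal{Q})},$$ where the union ranges over all partitions $\mathcal{Q}=\{Q_1,\ldots,Q_m\}$ of $R\cup C$ such that for each $i\in[m]$ with $|Q_i|\ge2$: (i) $|Q_i\cap R|\ge3$, $|Q_i\cap C|\ge3$ and $\max\{|Q_i\cap R|,|Q_i\cap C|\}\ge4$; (ii) if $|\mathcal{Q}|>1$, then neither $R\subseteq Q_i$ nor $C\subseteq Q_i$.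
   Context: For a partition $\mathcal{Q}=\{Q_1,\ldots,Q_m\}$ of $R\cup C$, let $H_i=\bigcup_{L\in Q_i}L\subseteq[kl]$, and let $G_{k,l}(\mathcal{Q})$ be the matroid on $[kl]$ whose circuits are: (Type 1) the 2-element subsets contained in $H_i\cap H_j$ for some $i\ne j$; (Type 2) the 3-element subsets of some $H_i$ containing no Type 1 set; (Type 3) the 4-element subsets containing no Type 1 or Type 2 set. For a matroid $N$ on $[kl]$, a realization is a $3\times kl$ complex matrix whose columns indexed by $S$ are linearly dependent iff $S$ is dependent in $N$; the matroid variety $V_N\subseteq\mathbb{C}^{3\times kl}$ is the Zariski closure of the set of realizations. Irredundant means each $V_{G_{k,l}(\mathcal{Q})}$ is irreducible and none is contained in another. *)

theory Defs
  imports Complex_Main "HOL-Library.Disjoint_Sets"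
begin

text \<open>A 3 x n complex matrix Y is a function nat => nat => complex; the entry in
  row r (r < 3) and column c (c in {1..n}) is Y r c; all other values are 0.\<close>

definition ambient :: "nat \<Rightarrow> (nat \<Rightarrow> nat \<Rightarrow> complex) set" where
  "ambient n = {Y. \<forall>r c. (3 \<le> r \<or> c \<notin> {1..n}) \<longrightarrow> Y r c = 0}"

inductive_set polyfun :: "nat \<Rightarrow> ((nat \<Rightarrow> nat \<Rightarrow> complex) \<Rightarrow> complex) set"
  for n :: nat where
  pconst: "(\<lambda>Y. a) \<in> polyfun n"
| pvar: "r < 3 \<Longrightarrow> c \<in> {1..n} \<Longrightarrow> (\<lambda>Y. Y r c) \<in> polyfun n"
| padd: "p \<in> polyfun n \<Longrightarrow> q \<in> polyfun n \<Longrightarrow> (\<lambda>Y. p Y + q Y) \<in> polyfun n"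
| pmult: "p \<in> polyfun n \<Longrightarrow> q \<in> polyfun n \<Longrightarrow> (\<lambda>Y. p Y * q Y) \<in> polyfun n"

definition zariski_closed :: "nat \<Rightarrow> (nat \<Rightarrow> nat \<Rightarrow> complex) set \<Rightarrow> bool" where
  "zariski_closed n S \<longleftrightarrow>
     (\<exists>P \<subseteq> polyfun n. S = {Y \<in> ambient n. \<forall>p\<in>P. p Y = 0})"

definition zariski_closure :: "nat \<Rightarrow> (nat \<Rightarrow> nat \<Rightarrow> complex) set \<Rightarrow> (nat \<Rightarrow> nat \<Rightarrow> complex) set" where
  "zariski_closure n S = \<Inter>{T. zariski_closed n T \<and> S \<subseteq> T}"

definition zariski_irreducible :: "nat \<Rightarrow> (nat \<Rightarrow> nat \<Rightarrow> complex) set \<Rightarrow> bool" where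
  "zariski_irreducible n V \<longleftrightarrow> zariski_closed n V \<and> V \<noteq> {} \<and>
     (\<forall>A B. zariski_closed n A \<and> zariski_closed n B \<and> V = A \<union> B \<longrightarrow> V = A \<or> V = B)"

text \<open>The columns of Y indexed by F are linearly dependent (equivalently rank(Y_F) < |F|).\<close>
definition col_dep :: "(nat \<Rightarrow> nat \<Rightarrow> complex) \<Rightarrow> nat set \<Rightarrow> bool" where
  "col_dep Y F \<longleftrightarrow> (\<exists>a :: nat \<Rightarrow> complex. (\<exists>f\<in>F. a f \<noteq> 0) \<and>
      (\<forall>r < 3. (\<Sum>f\<in>F. a f * Y r f) = 0))"

definition realization :: "nat \<Rightarrow> (nat set \<Rightarrow> bool) \<Rightarrow> (nat \<Rightarrow> nat \<Rightarrow> complex) \<Rightarrow> bool" where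
  "realization n dep Y \<longleftrightarrow> Y \<in> ambient n \<and> (\<forall>S \<subseteq> {1..n}. col_dep Y S \<longleftrightarrow> dep S)"

definition matroid_variety :: "nat \<Rightarrow> (nat set \<Rightarrow> bool) \<Rightarrow> (nat \<Rightarrow> nat \<Rightarrow> complex) set" where
  "matroid_variety n dep = zariski_closure n {Y. realization n dep Y}"

definition Rline :: "nat \<Rightarrow> nat \<Rightarrow> nat \<Rightarrow> nat set" where
  "Rline k l i = {t * k + i | t. t < l}"

definition Cline :: "nat \<Rightarrow> nat \<Rightarrow> nat set" where
  "Cline k j = {(j - 1) * k + t | t. t \<in> {1..k}}"

definition Rset :: "nat \<Rightarrow> nat \<Rightarrow> nat set set" where
  "Rset k l = Rline k l ` {1..k}"

definition Cset :: "nat \<Rightarrow> nat \<Rightarrow> nat set set" where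
  "Cset k l = Cline k ` {1..l}"

definition Delta :: "nat \<Rightarrow> nat \<Rightarrow> nat set set" where
  "Delta k l = {F. card F = 3 \<and> ((\<exists>i\<in>{1..k}. F \<subseteq> Rline k l i) \<or> (\<exists>j\<in>{1..l}. F \<subseteq> Cline k j))}"

definition V_Delta :: "nat \<Rightarrow> nat \<Rightarrow> (nat \<Rightarrow> nat \<Rightarrow> complex) set" where
  "V_Delta k l = {Y \<in> ambient (k * l). \<forall>F\<in>Delta k l. col_dep Y F}"

text \<open>The matroid G_{k,l}(Q) for a partition Q of R \<union> C (a set of blocks, each a set of lines).\<close>
definition G_type1 :: "nat set set set \<Rightarrow> nat set set" where
  "G_type1 Q = {S. card S = 2 \<and> (\<exists>B1\<in>Q. \<exists>B2\<in>Q. B1 \<noteq> B2 \<and> S \<subseteq> \<Union>B1 \<inter> \<Union>B2)}"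

definition G_type2 :: "nat set set set \<Rightarrow> nat set set" where
  "G_type2 Q = {S. card S = 3 \<and> (\<exists>B\<in>Q. S \<subseteq> \<Union>B) \<and> \<not> (\<exists>T\<in>G_type1 Q. T \<subseteq> S)}"

definition G_type3 :: "nat \<Rightarrow> nat \<Rightarrow> nat set set set \<Rightarrow> nat set set" where
  "G_type3 k l Q = {S. S \<subseteq> {1..k*l} \<and> card S = 4 \<and>
      \<not> (\<exists>T\<in>G_type1 Q \<union> G_type2 Q. T \<subseteq> S)}"

definition G_circuits :: "nat \<Rightarrow> nat \<Rightarrow> nat set set set \<Rightarrow> nat set set" where
  "G_circuits k l Q = G_type1 Q \<union> G_type2 Q \<union> G_type3 k l Q"

definition G_dep :: "nat \<Rightarrow> nat \<Rightarrow> nat set set set \<Rightarrow> nat set \<Rightarrow> bool" where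
  "G_dep k l Q S \<longleftrightarrow> S \<subseteq> {1..k*l} \<and> (\<exists>D\<in>G_circuits k l Q. D \<subseteq> S)"

definition admissible :: "nat \<Rightarrow> nat \<Rightarrow> nat set set set \<Rightarrow> bool" where
  "admissible k l Q \<longleftrightarrow> partition_on (Rset k l \<union> Cset k l) Q \<and>
     (\<forall>B\<in>Q. 2 \<le> card B \<longrightarrow>
        (3 \<le> card (B \<inter> Rset k l) \<and> 3 \<le> card (B \<inter> Cset k l) \<and>
         4 \<le> max (card (B \<inter> Rset k l)) (card (B \<inter> Cset k l))) \<and>
        (1 < card Q \<longrightarrow> \<not> Rset k l \<subseteq> B \<and> \<not> Cset k l \<subseteq> B))"

end

theory Submission
  imports Defs "HOL-Computational_Algebra.Polynomial"
begin

text \<open>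
  Choose a normal vector \<open>w\<^sub>b\<close> for every block \<open>b\<close> of a partition. A point on lines of two
  different blocks must be a multiple of \<open>w\<^sub>b \<times> w\<^sub>c\<close>, a point on two lines of the same block is
  \<open>w\<^sub>b \<times> z\<close> with \<open>z\<close> arbitrary. This parametrizes a constructible set for every partition, and
  irreducibility follows since the parameter space is affine. Grouping the lines of a configuration
  in \<open>V\<^sub>\<Delta>\<close> by parallel normals shows that these sets, over all partitions, cover \<open>V\<^sub>\<Delta>\<close>. Normals on the
  moment curve turn the points into quadratic polynomials with prescribed roots, which shows that a
  generic member realizes the matroid.

  If a block contains all rows or all columns, everything lies on one line. A block violating
  condition (i) is split into single lines by a first-order deformation \<open>w + t x\<^sub>L\<close> of the normals:
  it exists when the linear system \<open>(x\<^sub>c - x\<^sub>r) \<bullet> p\<^sub>r\<^sub>c = 0\<close> has a nondegenerate solution,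
  that is, for at most two rows or columns and for \<open>3 \<times> 3\<close> grids. For \<open>3 \<times> 4\<close> grids the same
  system generically has only the trivial solution; the resulting determinant vanishes on every
  variety whose partition separates two lines of the grid, which yields irredundancy.
\<close>

section \<open>Linear algebra in dimension three\<close>

text \<open>A dimension count explains condition (i). For a block with a rows and b columns the
  deformation system has 2(a + b) unknowns, since coordinate 0 of every x_L is fixed to 0, and a b
  equations, and it always has the 2-dimensional family of solutions in which all x_L agree. The
  expected surplus 2(a + b) - a b - 2 equals b for a = 1, 2 for a = 2 and 4 - b for a = 3: it is
  still positive on a 3 x 3 block and reaches zero on a 3 x 4 block. Genericity is never verified
  for everything at once. Finitely many polynomials in the parameters, each nonzero somewhere, are
  simultaneously nonzero somewhere, so every independent set and every nondegeneracy condition gets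
  its own witness. Since the normals are completely free parameters, such a witness may be very
  degenerate, for example with all normals equal to (1, 0, 0). The two directions of irredundancy
  differ. If only the larger variety joins two lines in one block, a dependent triple shows it. If
  only the smaller one joins them, the matroid may offer no dependency that tells the two apart, and
  the polynomial \<open>obstr\<close> is needed.\<close>

definition cross :: "(nat \<Rightarrow> complex) \<Rightarrow> (nat \<Rightarrow> complex) \<Rightarrow> nat \<Rightarrow> complex" where
  "cross u v = (\<lambda>r. if r = 0 then u 1 * v 2 - u 2 * v 1
                    else if r = 1 then u 2 * v 0 - u 0 * v 2
                    else if r = 2 then u 0 * v 1 - u 1 * v 0 else 0)"

definition dot :: "(nat \<Rightarrow> complex) \<Rightarrow> (nat \<Rightarrow> complex) \<Rightarrow> complex" where
  "dot u v = u 0 * v 0 + u 1 * v 1 + u 2 * v 2"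

definition det3 :: "(nat \<Rightarrow> complex) \<Rightarrow> (nat \<Rightarrow> complex) \<Rightarrow> (nat \<Rightarrow> complex) \<Rightarrow> complex" where
  "det3 u v w = dot u (cross v w)"

definition col :: "(nat \<Rightarrow> nat \<Rightarrow> complex) \<Rightarrow> nat \<Rightarrow> nat \<Rightarrow> complex" where
  "col Y p = (\<lambda>r. Y r p)"

text \<open>Vectors of three-space are functions on all naturals. Zeros from index 3 on make
  equality of vectors the same as equality of functions; columns of matrices in
  \<open>ambient\<close> have this form.\<close>

definition vec3 :: "(nat \<Rightarrow> complex) \<Rightarrow> bool" where
  "vec3 u \<longleftrightarrow> (\<forall>r\<ge>3. u r = 0)"

lemma cross_simps [simp]:
  "cross u v 0 = u 1 * v 2 - u 2 * v 1" "cross u v (Suc 0) = u 2 * v 0 - u 0 * v 2"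
  "cross u v 2 = u 0 * v 1 - u 1 * v 0" "3 \<le> r \<Longrightarrow> cross u v r = 0"
  by (auto simp: cross_def)

lemma less_3_cases: "(r::nat) < 3 \<longleftrightarrow> r = 0 \<or> r = Suc 0 \<or> r = 2"
  by auto

lemma vec3_eqI:
  assumes "vec3 u" "vec3 v" "u 0 = v 0" "u (Suc 0) = v (Suc 0)" "u 2 = v 2"
  shows "u = v"
proof
  fix r show "u r = v r"
    using assms by (cases "r < 3") (auto simp: vec3_def less_3_cases)
qed

lemma vec3_cross [simp]: "vec3 (cross u v)" "vec3 (\<lambda>r. a * cross u v r)"
  by (auto simp: vec3_def)

lemma vec3_col: "Y \<in> ambient n \<Longrightarrow> vec3 (col Y p)"
  by (auto simp: vec3_def col_def ambient_def)

lemma cross_eq_0_iff: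
  "cross u v = (\<lambda>_. 0) \<longleftrightarrow> cross u v 0 = 0 \<and> cross u v (Suc 0) = 0 \<and> cross u v 2 = 0"
  by (metis (no_types, lifting) vec3_cross(1) vec3_def vec3_eqI)

lemma det3_expand:
  "det3 u v w = u 0 * (v 1 * w 2 - v 2 * w 1) + u 1 * (v 2 * w 0 - v 0 * w 2)
     + u 2 * (v 0 * w 1 - v 1 * w 0)"
  by (simp add: det3_def dot_def cross_def)

text \<open>Laplace expansion of a 4 x 4 determinant with a repeated row. It supplies explicit
  dependence coefficients for four vectors of three-space.\<close>

lemma det3_cramer:
  "det3 b c d * a r - det3 a c d * b r + det3 a b d * c r - det3 a b c * d r = 0" if "r < 3"
  using that unfolding less_3_cases det3_expand by (elim disjE) (simp_all add: algebra_simps)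

text \<open>By y x (u x v) = (y.v) u - (y.u) v the two orthogonality conditions make y parallel to u
  x v; a nonzero coordinate of u x v then gives the factor.\<close>

lemma perp_both_imp_multiple_cross:
  assumes "vec3 y" "dot u y = 0" "dot v y = 0" "cross u v \<noteq> (\<lambda>_. 0)"
  shows "\<exists>c. y = (\<lambda>r. c * cross u v r)"
proof -
  have "cross u v 0 \<noteq> 0 \<or> cross u v (Suc 0) \<noteq> 0 \<or> cross u v 2 \<noteq> 0"
    using assms(4) cross_eq_0_iff by blast
  moreover have e: "y 0 * cross u v (Suc 0) = y 1 * cross u v 0" "y 0 * cross u v 2 = y 2 * cross u v 0"
     "y 1 * cross u v 2 = y 2 * cross u v 1"
    using assms(2,3) unfolding dot_def One_nat_def[symmetric] by (simp_all add: cross_def) algebra+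
  moreover have "\<exists>c. y 0 = c * cross u v 0 \<and> y (Suc 0) = c * cross u v (Suc 0) \<and> y 2 = c * cross u v 2"
    using calculation unfolding One_nat_def
    apply (elim disjE)
    subgoal by (rule exI[of _ "y 0 / cross u v 0"]) (simp add: field_simps del: cross_simps)
    subgoal by (rule exI[of _ "y 1 / cross u v (Suc 0)"]) (simp add: field_simps del: cross_simps)
    subgoal by (rule exI[of _ "y 2 / cross u v 2"]) (simp add: field_simps del: cross_simps)
    done
  then obtain c where "y 0 = c * cross u v 0" "y (Suc 0) = c * cross u v (Suc 0)" "y 2 = c * cross u v 2"
    by blast
  then have "y = (\<lambda>r. c * cross u v r)"
    by (intro vec3_eqI) (use assms in auto)
  then show ?thesis by blast
qed

text \<open>The image of v -> w x v is the whole plane orthogonal to w. Adding multiples of w to v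
  changes nothing, so v can be taken to vanish at an index where w does not; this determines the
  witnesses.\<close>

lemma perp_imp_cross:
  assumes "vec3 y" "vec3 w" "dot w y = 0" "w \<noteq> (\<lambda>_. 0)"
  shows "\<exists>v. y = cross w v"
proof -
  have "w 0 \<noteq> 0 \<or> w 1 \<noteq> 0 \<or> w 2 \<noteq> 0"
    using assms(2,4) vec3_eqI[of w "\<lambda>_. 0"] by (auto simp: vec3_def)
  moreover have "\<exists>v. y = cross w v" if "w 0 \<noteq> 0"
    by (rule exI[of _ "\<lambda>r. if r = 1 then y 2 / w 0 else if r = 2 then - y 1 / w 0 else 0"], rule vec3_eqI)
      (use assms(1,3) that in \<open>auto simp: field_simps dot_def\<close>, (algebra+)?)
  moreover have "\<exists>v. y = cross w v" if "w 1 \<noteq> 0"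
    by (rule exI[of _ "\<lambda>r. if r = 0 then - y 2 / w 1 else if r = 2 then y 0 / w 1 else 0"], rule vec3_eqI)
      (use assms(1,3) that in \<open>auto simp: field_simps dot_def\<close>, (algebra+)?)
  moreover have "\<exists>v. y = cross w v" if "w 2 \<noteq> 0"
    by (rule exI[of _ "\<lambda>r. if r = 0 then y 1 / w 2 else if r = 1 then - y 0 / w 2 else 0"], rule vec3_eqI)
      (use assms(1,3) that in \<open>auto simp: field_simps dot_def\<close>, (algebra+)?)
  ultimately show ?thesis by blast
qed

lemma cross_trans:
  assumes "vec3 v" "v \<noteq> (\<lambda>_. 0)" "cross u v = (\<lambda>_. 0)" "cross v w = (\<lambda>_. 0)"
  shows "cross u w = (\<lambda>_. 0)"
proof -
  have "v 0 \<noteq> 0 \<or> v 1 \<noteq> 0 \<or> v 2 \<noteq> 0"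
    using assms(1,2) vec3_eqI[of v "\<lambda>_. 0"] by (auto simp: vec3_def)
  then show ?thesis
    using assms(3,4) unfolding cross_eq_0_iff cross_simps One_nat_def
    apply (intro conjI)
    subgoal by (elim disjE; algebra)
    subgoal by (elim disjE; algebra)
    subgoal by (elim disjE; algebra)
    done
qed

lemma cross_sym: "cross u v = (\<lambda>_. 0) \<longleftrightarrow> cross v u = (\<lambda>_. 0)"
  unfolding cross_eq_0_iff cross_simps by (auto simp: algebra_simps)

text \<open>A division-free way to pass orthogonality from one vector to a parallel one: choose r
  with a nonzero coordinate on one side and cancel it.\<close>

lemma cross_eq_0_dot:
  assumes "cross u v = (\<lambda>_. 0)" "r < 3"
  shows "u r * dot w v = v r * dot w u"
proof -
  have "u 1 * v 2 = u 2 * v 1" "u 2 * v 0 = u 0 * v 2" "u 0 * v 1 = u 1 * v 0"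
    using assms(1) unfolding cross_eq_0_iff cross_simps by auto
  then have "u 0 * dot w v = v 0 * dot w u" "u 1 * dot w v = v 1 * dot w u" "u 2 * dot w v = v 2 * dot w u"
    unfolding dot_def by algebra+
  then show ?thesis using assms(2) unfolding less_3_cases by auto
qed

lemma cross_self [simp]: "cross u u = (\<lambda>_. 0)"
  unfolding cross_eq_0_iff cross_simps by (auto simp: algebra_simps)

lemma dot_cross_self [simp]: "dot w (cross w v) = 0" "dot w (cross v w) = 0"
  by (simp_all add: dot_def algebra_simps)

lemma det3_perp:
  assumes "vec3 w" "w \<noteq> (\<lambda>_. 0)" "dot w a = 0" "dot w b = 0" "dot w c = 0"
  shows "det3 a b c = 0"
proof -
  have "w 0 \<noteq> 0 \<or> w 1 \<noteq> 0 \<or> w 2 \<noteq> 0"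
    using assms(1,2) vec3_eqI[of w "\<lambda>_. 0"] by (auto simp: vec3_def)
  moreover have "w 0 * det3 a b c = 0" "w 1 * det3 a b c = 0" "w 2 * det3 a b c = 0"
    using assms(3-5) unfolding det3_expand dot_def by algebra+
  ultimately show ?thesis by (metis mult_eq_0_iff)
qed

section \<open>Dependence of columns by cross products and determinants\<close>

lemma col_dep_mono: "col_dep Y S \<Longrightarrow> S \<subseteq> T \<Longrightarrow> finite T \<Longrightarrow> col_dep Y T"
  unfolding col_dep_def
proof (elim exE conjE bexE)
  fix a f assume *: "S \<subseteq> T" "finite T" "f \<in> S" "a f \<noteq> 0" "\<forall>r<3. (\<Sum>f\<in>S. a f * Y r f) = 0"
  have "(\<Sum>f\<in>T. (if f \<in> S then a f else 0) * Y r f) = (\<Sum>f\<in>S. a f * Y r f)" for r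
    using * by (intro sum.mono_neutral_cong_right) auto
  then show "\<exists>a. (\<exists>f\<in>T. a f \<noteq> 0) \<and> (\<forall>r<3. (\<Sum>f\<in>T. a f * Y r f) = 0)"
    using * by (intro exI[of _ "\<lambda>f. if f \<in> S then a f else 0"]) auto
qed

lemma col_dep_det3_eq_0:
  assumes "col_dep Y {p, q, s}"
  shows "det3 (col Y p) (col Y q) (col Y s) = 0"
proof (cases "p = q \<or> p = s \<or> q = s")
  case True
  then show ?thesis by (auto simp: det3_expand algebra_simps)
next
  case False
  then obtain a where a: "a p \<noteq> 0 \<or> a q \<noteq> 0 \<or> a s \<noteq> 0"
    and e: "\<And>r. r < 3 \<Longrightarrow> a p * Y r p + a q * Y r q + a s * Y r s = 0"
    using assms unfolding col_dep_def by (auto simp: add.assoc)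
  note e3 = e[of 0, simplified] e[of 1, simplified] e[of 2, simplified]
  have "a p * det3 (col Y p) (col Y q) (col Y s) = 0" "a q * det3 (col Y p) (col Y q) (col Y s) = 0"
    "a s * det3 (col Y p) (col Y q) (col Y s) = 0"
    unfolding det3_expand col_def using e3 unfolding One_nat_def by algebra+
  with a show ?thesis by auto
qed

lemma col_dep_pair:
  assumes "p \<noteq> q" "cross (col Y p) (col Y q) = (\<lambda>_. 0)"
  shows "col_dep Y {p, q}"
proof -
  have c: "Y 1 p * Y 2 q = Y 2 p * Y 1 q" "Y 2 p * Y 0 q = Y 0 p * Y 2 q" "Y 0 p * Y 1 q = Y 1 p * Y 0 q"
    using assms(2) unfolding cross_eq_0_iff cross_simps col_def by auto
  show ?thesis
  proof (cases "Y 0 p = 0 \<and> Y 1 p = 0 \<and> Y 2 p = 0")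
    case True
    then show ?thesis using assms(1) unfolding col_dep_def
      by (intro exI[of _ "\<lambda>x. if x = p then 1 else 0"]) (auto simp: less_3_cases)
  next
    case False
    then obtain s where s: "s < 3" "Y s p \<noteq> 0" by (metis less_3_cases One_nat_def)
    have "Y s q * Y r p = Y s p * Y r q" if "r < 3" for r
      using that s(1) c unfolding less_3_cases One_nat_def by (elim disjE) (auto simp: mult.commute)
    then show ?thesis using assms(1) s unfolding col_dep_def
      by (intro exI[of _ "\<lambda>x. if x = q then - Y s p else Y s q"]) auto
  qed
qed

lemma det3_eq_0_col_dep:
  assumes "distinct [p, q, s]" "det3 (col Y p) (col Y q) (col Y s) = 0"
  shows "col_dep Y {p, q, s}"
proof (cases "cross (col Y p) (col Y q) = (\<lambda>_. 0)")
  case True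
  then show ?thesis using col_dep_mono[OF col_dep_pair[OF _ True]] assms(1) by auto
next
  case False
  \<comment> \<open>A unit vector that completes the columns p and q to a basis turns the relation
    of \<open>det3_cramer\<close> into a dependence whose coefficient at s is a nonzero coordinate
    of the cross product.\<close>
  define e where "e j r = (if r = j then 1 else 0 :: complex)" for j r :: nat
  obtain j where j: "j < 3" "cross (col Y p) (col Y q) j \<noteq> 0"
    using False unfolding cross_eq_0_iff by (metis less_3_cases)
  have dj: "det3 (col Y p) (col Y q) (e j) = cross (col Y p) (col Y q) j"
    using j(1) unfolding less_3_cases det3_expand e_def by (elim disjE) (simp_all add: algebra_simps)
  have "det3 (col Y q) (col Y s) (e j) * Y r p - det3 (col Y p) (col Y s) (e j) * Y r q
      + det3 (col Y p) (col Y q) (e j) * Y r s = 0" if "r < 3" for r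
    using det3_cramer[OF that, of "col Y q" "col Y s" "e j" "col Y p"] assms(2)
    by (simp add: col_def)
  then show ?thesis using assms(1) j dj unfolding col_dep_def
    by (intro exI[of _ "\<lambda>x. if x = p then det3 (col Y q) (col Y s) (e j)
         else if x = q then - det3 (col Y p) (col Y s) (e j) else det3 (col Y p) (col Y q) (e j)"])
       (auto simp: algebra_simps simp del: cross_simps)
qed

lemma col_dep_4:
  assumes "card S = 4"
  shows "col_dep Y S"
proof -
  obtain a b c d where S: "S = {a,b,c,d}" "distinct [a,b,c,d]"
    using assms by (auto simp: card_Suc_eq numeral_eq_Suc)
  show ?thesis
  proof (cases "det3 (col Y a) (col Y b) (col Y c) = 0")
    case True
    then have "col_dep Y {a,b,c}" using S by (intro det3_eq_0_col_dep) auto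
    then show ?thesis by (rule col_dep_mono) (auto simp: S)
  next
    case False
    have "det3 (col Y b) (col Y c) (col Y d) * Y r a - det3 (col Y a) (col Y c) (col Y d) * Y r b
      + det3 (col Y a) (col Y b) (col Y d) * Y r c - det3 (col Y a) (col Y b) (col Y c) * Y r d = 0"
      if "r < 3" for r
      using det3_cramer[OF that, of "col Y b" "col Y c" "col Y d" "col Y a"] by (simp add: col_def)
    then show ?thesis using S False unfolding col_dep_def
      by (intro exI[of _ "\<lambda>x. if x = a then det3 (col Y b) (col Y c) (col Y d)
         else if x = b then - det3 (col Y a) (col Y c) (col Y d)
         else if x = c then det3 (col Y a) (col Y b) (col Y d)
         else - det3 (col Y a) (col Y b) (col Y c)"])
       (auto simp: algebra_simps)
  qed
qed

lemma vec3_perp_exists: "\<exists>w. vec3 w \<and> w \<noteq> (\<lambda>_. 0) \<and> dot w a = 0"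
proof (cases "a 0 = 0")
  case True
  then show ?thesis
    by (intro exI[of _ "\<lambda>r. if r = 0 then 1 else 0"]) (auto simp: vec3_def dot_def fun_eq_iff)
next
  case False
  then show ?thesis
    by (intro exI[of _ "\<lambda>r. if r = 0 then a 1 else if r = 1 then - a 0 else 0"])
      (auto simp: vec3_def dot_def fun_eq_iff intro!: exI[of _ 1])
qed

text \<open>Rank at most 2 can be tested on triples. If two columns are not parallel, their cross
  product is the normal; if all are parallel, any normal of a nonzero column serves.\<close>

lemma common_normal:
  assumes "\<And>p q s. p \<in> H \<Longrightarrow> q \<in> H \<Longrightarrow> s \<in> H \<Longrightarrow> distinct [p, q, s] \<Longrightarrow> col_dep Y {p, q, s}"
  shows "\<exists>w. vec3 w \<and> w \<noteq> (\<lambda>_. 0) \<and> (\<forall>p\<in>H. dot w (col Y p) = 0)"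
proof (cases "\<exists>p\<in>H. \<exists>q\<in>H. cross (col Y p) (col Y q) \<noteq> (\<lambda>_. 0)")
  case True
  then obtain p q where pq: "p \<in> H" "q \<in> H" "cross (col Y p) (col Y q) \<noteq> (\<lambda>_. 0)" by blast
  have "dot (cross (col Y p) (col Y q)) (col Y s) = det3 (col Y p) (col Y q) (col Y s)" for s
    by (simp add: det3_expand dot_def algebra_simps)
  moreover have "det3 (col Y p) (col Y q) (col Y s) = 0" if "s \<in> H" for s
    using assms[OF pq(1,2) that] col_dep_det3_eq_0
    by (cases "distinct [p, q, s]") (auto simp: det3_expand algebra_simps)
  ultimately show ?thesis using pq by (intro exI[of _ "cross (col Y p) (col Y q)"]) auto
next
  case par: False
  show ?thesis
  proof (cases "\<exists>p\<in>H. \<exists>r<3. col Y p r \<noteq> 0")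
    case False
    then show ?thesis
      using vec3_perp_exists[of "\<lambda>_. 0"] by (auto simp: dot_def)
  next
    case True
    then obtain p j where p: "p \<in> H" "j < 3" "col Y p j \<noteq> 0" by blast
    obtain w where w: "vec3 w" "w \<noteq> (\<lambda>_. 0)" "dot w (col Y p) = 0" using vec3_perp_exists by blast
    have "dot w (col Y q) = 0" if "q \<in> H" for q
    proof -
      have "cross (col Y p) (col Y q) = (\<lambda>_. 0)" using par p(1) that by blast
      then have "col Y p j * dot w (col Y q) = col Y q j * dot w (col Y p)"
        by (rule cross_eq_0_dot) (rule p(2))
      with w p show ?thesis by simp
    qed
    with w show ?thesis by blast
  qed
qed

section \<open>Polynomial functions and Zariski closures\<close>

text \<open>Polynomial functions of the parameters, over an arbitrary index type;
  \<open>polyfun\<close> plays the same role for matrices. They are only ever examined along lines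
  of the parameter space, where they become univariate.\<close>

inductive_set pf :: "(('i \<Rightarrow> complex) \<Rightarrow> complex) set" where
  pf_const [intro]: "(\<lambda>\<theta>. a) \<in> pf"
| pf_var [intro]: "(\<lambda>\<theta>. \<theta> i) \<in> pf"
| pf_add [intro]: "p \<in> pf \<Longrightarrow> q \<in> pf \<Longrightarrow> (\<lambda>\<theta>. p \<theta> + q \<theta>) \<in> pf"
| pf_mult [intro]: "p \<in> pf \<Longrightarrow> q \<in> pf \<Longrightarrow> (\<lambda>\<theta>. p \<theta> * q \<theta>) \<in> pf"

lemma pf_diff [intro]: "p \<in> pf \<Longrightarrow> q \<in> pf \<Longrightarrow> (\<lambda>\<theta>. p \<theta> - q \<theta>) \<in> pf"
  using pf_add[OF _ pf_mult[OF pf_const[of "-1"]], of p q] by simp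

lemma pf_prod:
  assumes "\<And>x. x \<in> X \<Longrightarrow> f x \<in> pf"
  shows "(\<lambda>\<theta>. \<Prod>x\<in>X. f x \<theta>) \<in> pf"
  using assms by (induction X rule: infinite_finite_induct) auto

lemma pf_cross [intro]:
  assumes "\<And>r. (\<lambda>\<theta>. u \<theta> r) \<in> pf" "\<And>r. (\<lambda>\<theta>. v \<theta> r) \<in> pf"
  shows "(\<lambda>\<theta>. cross (u \<theta>) (v \<theta>) r) \<in> pf"
  using assms by (cases "r = 0"; cases "r = 1"; cases "r = 2") (auto simp: cross_def intro!: pf_diff pf_mult assms)

lemma range_poly_add: "f \<in> range poly \<Longrightarrow> g \<in> range poly \<Longrightarrow> (\<lambda>t. f t + g t) \<in> range poly"
  by (auto simp: fun_eq_iff simp flip: poly_add)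

lemma range_poly_mult: "f \<in> range poly \<Longrightarrow> g \<in> range poly \<Longrightarrow> (\<lambda>t. f t * g t) \<in> range poly"
  by (auto simp: fun_eq_iff simp flip: poly_mult)

lemma range_poly_const: "(\<lambda>t. a) \<in> range poly"
  by (rule range_eqI[of _ _ "[:a:]"]) auto

lemma range_poly_linear: "(\<lambda>t. a + t * b) \<in> range poly"
  by (rule range_eqI[of _ _ "[:a, b:]"]) auto

lemma pf_line: "f \<in> pf \<Longrightarrow> (\<lambda>t. f (\<lambda>i. a i + t * d i)) \<in> range poly"
  by (induction rule: pf.induct)
    (auto intro: range_poly_add range_poly_mult range_poly_const range_poly_linear simp del: image_iff)

text \<open>On the line through x and y, f is nonzero at t = 0 and g at t = 1. Both restrict to
  nonzero univariate polynomials, whose product has finitely many roots. This is the irreducibility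
  of affine space without a multivariate polynomial ring.\<close>

lemma pf_nonzero_mult:
  assumes "f \<in> pf" "g \<in> pf" "f x \<noteq> 0" "g y \<noteq> 0"
  shows "\<exists>\<theta>. f \<theta> \<noteq> 0 \<and> g \<theta> \<noteq> 0"
proof -
  obtain P where P: "\<And>t. f (\<lambda>i. x i + t * (y i - x i)) = poly P t"
    using pf_line[OF assms(1), of x "\<lambda>i. y i - x i"] by (auto simp: fun_eq_iff)
  obtain Q where Q: "\<And>t. g (\<lambda>i. x i + t * (y i - x i)) = poly Q t"
    using pf_line[OF assms(2), of x "\<lambda>i. y i - x i"] by (auto simp: fun_eq_iff)
  have "poly P 0 \<noteq> 0" "poly Q 1 \<noteq> 0"
    using P[of 0] Q[of 1] assms by simp_all
  then have "P * Q \<noteq> 0" by auto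
  then have "finite {t. poly (P * Q) t = 0}" by (rule poly_roots_finite)
  then obtain t where "poly (P * Q) t \<noteq> 0"
    using infinite_UNIV_char_0[where 'a=complex] by (metis (mono_tags, lifting) UNIV_eq_I mem_Collect_eq)
  with P[of t] Q[of t] show ?thesis by (metis mult_eq_0_iff poly_mult)
qed

lemma pf_nonzero_family:
  assumes "finite X" "\<And>x. x \<in> X \<Longrightarrow> f x \<in> pf" "\<And>x. x \<in> X \<Longrightarrow> \<exists>\<theta>. f x \<theta> \<noteq> 0"
  shows "\<exists>\<theta>. \<forall>x\<in>X. f x \<theta> \<noteq> 0"
  using assms
proof (induction X)
  case (insert x X)
  obtain y where "\<forall>z\<in>X. f z y \<noteq> 0" using insert by auto
  then have "(\<Prod>z\<in>X. f z y) \<noteq> 0" using insert(1) by auto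
  moreover obtain y' where "f x y' \<noteq> 0" using insert.prems(2) by blast
  ultimately obtain \<theta> where "f x \<theta> \<noteq> 0" "(\<Prod>z\<in>X. f z \<theta>) \<noteq> 0"
    using pf_nonzero_mult[of "f x" "\<lambda>\<theta>. \<Prod>z\<in>X. f z \<theta>" y' y] pf_prod[of X f] insert.prems(1) by auto
  then show ?case using insert(1) by (intro exI[of _ \<theta>]) auto
qed auto

text \<open>Density of a nonempty open set of parameters. Each g x needs only its own witness, and f
  need only be controlled where all of them are nonzero.\<close>

lemma pf_vanish_generic:
  assumes "f \<in> pf" "finite X" "\<And>x. x \<in> X \<Longrightarrow> g x \<in> pf" "\<And>x. x \<in> X \<Longrightarrow> \<exists>\<theta>. g x \<theta> \<noteq> 0"
    and "\<And>\<theta>. \<forall>x\<in>X. g x \<theta> \<noteq> 0 \<Longrightarrow> f \<theta> = 0"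
  shows "f \<theta> = 0"
proof (rule ccontr)
  assume a: "f \<theta> \<noteq> 0"
  obtain y where "\<forall>z\<in>X. g z y \<noteq> 0" using pf_nonzero_family[of X g] assms(2-4) by blast
  then have "(\<Prod>z\<in>X. g z y) \<noteq> 0" using assms(2) by auto
  with a obtain \<eta> where "f \<eta> \<noteq> 0" "(\<Prod>z\<in>X. g z \<eta>) \<noteq> 0"
    using pf_nonzero_mult[of f "\<lambda>\<theta>. \<Prod>z\<in>X. g z \<theta>" \<theta> y] pf_prod[of X g] assms(1,3) by auto
  then show False using assms(2,5) by auto
qed

lemma polyfun_comp_pf:
  assumes "g \<in> polyfun n" "\<And>r c. (\<lambda>\<theta>. \<Gamma> \<theta> r c) \<in> pf"
  shows "(\<lambda>\<theta>. g (\<Gamma> \<theta>)) \<in> pf"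
  using assms by induction auto

lemma polyfun_comp_poly:
  assumes "g \<in> polyfun n" "\<And>r c. (\<lambda>t. \<Gamma> t r c) \<in> range poly"
  shows "(\<lambda>t. g (\<Gamma> t)) \<in> range poly"
  using assms(1) by induction (auto intro: range_poly_add range_poly_mult range_poly_const assms(2) simp del: image_iff)

text \<open>The algebraic substitute for the limit t -> 0 along a polynomial curve.\<close>

lemma poly_vanish_punctured:
  assumes "\<And>t. t \<noteq> 0 \<Longrightarrow> poly P t = 0"
  shows "poly P (0::complex) = 0"
proof (rule ccontr)
  assume "poly P 0 \<noteq> 0"
  then have "P \<noteq> 0" by auto
  then have "finite {t. poly P t = 0}" by (rule poly_roots_finite)
  moreover have "- {0} \<subseteq> {t. poly P t = 0}" using assms by auto
  ultimately have "finite (- {0::complex})" by (rule finite_subset[rotated])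
  then have "finite (UNIV :: complex set)" using finite_compl[of "{0::complex}"] by simp
  then show False by (simp add: infinite_UNIV_char_0)
qed

section \<open>Zariski closures, irreducibility and openness of independence\<close>

lemma polyfun_diff: "p \<in> polyfun n \<Longrightarrow> q \<in> polyfun n \<Longrightarrow> (\<lambda>Y. p Y - q Y) \<in> polyfun n"
  using padd[OF _ pmult[OF pconst[of "-1"]], of p n q] by simp

lemma polyfun_det3:
  assumes "p \<in> {1..n}" "q \<in> {1..n}" "s \<in> {1..n}"
  shows "(\<lambda>Y. det3 (col Y p) (col Y q) (col Y s)) \<in> polyfun n"
  unfolding det3_expand col_def using assms by (intro padd pmult polyfun_diff pvar) auto

text \<open>The common zeros of all polynomials vanishing on S form the least closed set containing
  S. Closed sets lie in \<open>ambient n\<close>; for S outside of it the defining intersection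
  would be empty and hence be the whole type.\<close>

lemma zariski_closure_iff:
  assumes "S \<subseteq> ambient n"
  shows "Y \<in> zariski_closure n S \<longleftrightarrow>
    Y \<in> ambient n \<and> (\<forall>p\<in>polyfun n. (\<forall>Z\<in>S. p Z = 0) \<longrightarrow> p Y = 0)"
proof
  assume Y: "Y \<in> zariski_closure n S"
  have "zariski_closed n {Y \<in> ambient n. \<forall>p\<in>{p \<in> polyfun n. \<forall>Z\<in>S. p Z = 0}. p Y = 0}"
    unfolding zariski_closed_def by (intro exI[of _ "{p \<in> polyfun n. \<forall>Z\<in>S. p Z = 0}"]) auto
  then have "Y \<in> {Y \<in> ambient n. \<forall>p\<in>{p \<in> polyfun n. \<forall>Z\<in>S. p Z = 0}. p Y = 0}"
    using Y assms unfolding zariski_closure_def by blast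
  then show "Y \<in> ambient n \<and> (\<forall>p\<in>polyfun n. (\<forall>Z\<in>S. p Z = 0) \<longrightarrow> p Y = 0)" by blast
next
  assume Y: "Y \<in> ambient n \<and> (\<forall>p\<in>polyfun n. (\<forall>Z\<in>S. p Z = 0) \<longrightarrow> p Y = 0)"
  show "Y \<in> zariski_closure n S"
    unfolding zariski_closure_def
  proof (safe)
    fix T assume T: "zariski_closed n T" "S \<subseteq> T"
    then obtain P where P: "P \<subseteq> polyfun n" "T = {Y \<in> ambient n. \<forall>p\<in>P. p Y = 0}"
      unfolding zariski_closed_def by blast
    with T Y show "Y \<in> T" by blast
  qed
qed

lemma zariski_closed_closure:
  assumes "S \<subseteq> ambient n"
  shows "zariski_closed n (zariski_closure n S)"
  unfolding zariski_closed_def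
  using zariski_closure_iff[OF assms]
  by (intro exI[of _ "{p \<in> polyfun n. \<forall>Z\<in>S. p Z = 0}"]) auto

lemma zariski_closure_subset: "S \<subseteq> zariski_closure n S"
  unfolding zariski_closure_def by blast

lemma zariski_closure_minimal: "zariski_closed n T \<Longrightarrow> S \<subseteq> T \<Longrightarrow> zariski_closure n S \<subseteq> T"
  unfolding zariski_closure_def by blast

lemma zariski_closure_mono: "S \<subseteq> T \<Longrightarrow> zariski_closure n S \<subseteq> zariski_closure n T"
  unfolding zariski_closure_def by blast

text \<open>If neither closed piece contains the image, each has a defining polynomial with a
  nonzero pullback; a parameter where both pullbacks are nonzero is mapped outside both
  pieces.\<close>

lemma zariski_irreducible_range:
  assumes "range \<Phi> \<subseteq> ambient n" "\<And>r c. (\<lambda>\<theta>. \<Phi> \<theta> r c) \<in> pf"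
  shows "zariski_irreducible n (zariski_closure n (range \<Phi>))"
  unfolding zariski_irreducible_def
proof (intro conjI allI impI)
  let ?V = "zariski_closure n (range \<Phi>)"
  show "zariski_closed n ?V" by (rule zariski_closed_closure[OF assms(1)])
  show "?V \<noteq> {}" using zariski_closure_subset[of "range \<Phi>" n] by blast
  fix A B assume AB: "zariski_closed n A \<and> zariski_closed n B \<and> ?V = A \<union> B"
  obtain P where P: "P \<subseteq> polyfun n" "A = {Y \<in> ambient n. \<forall>p\<in>P. p Y = 0}"
    using AB unfolding zariski_closed_def by blast
  obtain Q where Q: "Q \<subseteq> polyfun n" "B = {Y \<in> ambient n. \<forall>p\<in>Q. p Y = 0}"
    using AB unfolding zariski_closed_def by blast
  show "?V = A \<or> ?V = B"
  proof (cases "range \<Phi> \<subseteq> A \<or> range \<Phi> \<subseteq> B")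
    case True
    then show ?thesis using AB zariski_closure_minimal by blast
  next
    case False
    then obtain x y where "\<Phi> x \<notin> A" "\<Phi> y \<notin> B" by auto
    then obtain p q where pq: "p \<in> P" "p (\<Phi> x) \<noteq> 0" "q \<in> Q" "q (\<Phi> y) \<noteq> 0"
      using P Q assms(1) by blast
    have "(\<lambda>\<theta>. p (\<Phi> \<theta>)) \<in> pf" "(\<lambda>\<theta>. q (\<Phi> \<theta>)) \<in> pf"
      by (rule polyfun_comp_pf[OF subsetD[OF P(1) pq(1)] assms(2)],
          rule polyfun_comp_pf[OF subsetD[OF Q(1) pq(3)] assms(2)])
    then have "\<exists>\<theta>. p (\<Phi> \<theta>) \<noteq> 0 \<and> q (\<Phi> \<theta>) \<noteq> 0"
      by (rule pf_nonzero_mult[where x = x and y = y]) (rule pq)+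
    then obtain \<theta> where "p (\<Phi> \<theta>) \<noteq> 0" "q (\<Phi> \<theta>) \<noteq> 0" by (elim exE conjE)
    then have "\<Phi> \<theta> \<notin> A" "\<Phi> \<theta> \<notin> B" using P(2) Q(2) pq(1,3) by auto
    then show ?thesis using AB zariski_closure_subset[of "range \<Phi>" n] by blast
  qed
qed

lemma col_dep_pair_cross:
  assumes "p \<noteq> q" "col_dep Y {p, q}"
  shows "cross (col Y p) (col Y q) = (\<lambda>_. 0)"
proof -
  obtain a where a: "a p \<noteq> 0 \<or> a q \<noteq> 0" and e: "\<And>r. r < 3 \<Longrightarrow> a p * Y r p + a q * Y r q = 0"
    using assms unfolding col_dep_def by auto
  note e3 = e[of 0, simplified] e[of 1, simplified] e[of 2, simplified]
  have "a p * cross (col Y p) (col Y q) 0 = 0" "a q * cross (col Y p) (col Y q) 0 = 0"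
    "a p * cross (col Y p) (col Y q) (Suc 0) = 0" "a q * cross (col Y p) (col Y q) (Suc 0) = 0"
    "a p * cross (col Y p) (col Y q) 2 = 0" "a q * cross (col Y p) (col Y q) 2 = 0"
    unfolding cross_simps col_def One_nat_def using e3 unfolding One_nat_def by algebra+
  with a show ?thesis unfolding cross_eq_0_iff by (metis mult_eq_0_iff)
qed

text \<open>The certificate d is a minor of maximal size that is nonzero at Y: a coordinate, a
  coordinate of a cross product, or a determinant. Its choice depends on Y, but its nonvanishing
  proves independence everywhere.\<close>

lemma open_col_indep:
  assumes "S \<subseteq> {1..n}" "card S \<le> 3" "\<not> col_dep Y S"
  shows "\<exists>d\<in>polyfun n. d Y \<noteq> 0 \<and> (\<forall>Y'. d Y' \<noteq> 0 \<longrightarrow> \<not> col_dep Y' S)"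
proof -
  have fin: "finite S" using assms(1) finite_subset by blast
  consider "card S = 0" | "card S = 1" | "card S = 2" | "card S = 3" using assms(2) by linarith
  then show ?thesis
  proof cases
    case 1
    then show ?thesis using fin by (intro bexI[of _ "\<lambda>Y. 1"] pconst) (auto simp: col_dep_def)
  next
    case 2
    then obtain p where S: "S = {p}" by (auto simp: card_1_singleton_iff)
    have iff: "col_dep Y' {p} \<longleftrightarrow> (\<forall>r<3. Y' r p = 0)" for Y'
      by (auto simp: col_dep_def intro: exI[of _ "\<lambda>_. 1"])
    then obtain r where "r < 3" "Y r p \<noteq> 0" using assms(3) S by blast
    then show ?thesis using S assms(1) iff
      by (intro bexI[of _ "\<lambda>Y. Y r p"] pvar) auto
  next
    case 3
    then obtain p q where S: "S = {p, q}" "p \<noteq> q" by (auto simp: card_2_iff)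
    have "cross (col Y p) (col Y q) \<noteq> (\<lambda>_. 0)" using col_dep_pair assms(3) S by blast
    then obtain r where r: "r < 3" "cross (col Y p) (col Y q) r \<noteq> 0"
      unfolding cross_eq_0_iff less_3_cases by blast
    have "(\<lambda>Y. cross (col Y p) (col Y q) r) \<in> polyfun n"
      using r(1) S assms(1) unfolding less_3_cases
      by (elim disjE) (auto simp: cross_def col_def intro!: polyfun_diff pmult pvar)
    then show ?thesis using r S col_dep_pair_cross[of p q]
      by (intro bexI[of _ "\<lambda>Y. cross (col Y p) (col Y q) r"]) (auto simp: fun_eq_iff)
  next
    case 4
    then obtain p q s where S: "S = {p, q, s}" "distinct [p, q, s]"
      by (auto simp: card_Suc_eq numeral_eq_Suc)
    then have "det3 (col Y p) (col Y q) (col Y s) \<noteq> 0" using det3_eq_0_col_dep assms(3) by blast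
    then show ?thesis
      using col_dep_det3_eq_0 polyfun_det3[of p n q s] S assms(1)
      by (intro bexI[of _ "\<lambda>Y. det3 (col Y p) (col Y q) (col Y s)"]) auto
  qed
qed

section \<open>The grid and the parametrization\<close>

locale grid =
  fixes k l :: nat
  assumes k3: "3 \<le> k" and l3: "3 \<le> l"
begin

section \<open>Rows, columns and points of the grid\<close>

definition "P = {1..k * l}"
definition "R = Rset k l"
definition "C = Cset k l"
definition "lines = R \<union> C"
text \<open>The point (j - 1) * k + i lies in row i and column j. The shifts by one occur because
  points, rows and columns are numbered from 1.\<close>

definition "ri p = (p - 1) mod k + 1"
definition "ci p = (p - 1) div k + 1"
definition "rl p = Rline k l (ri p)"
definition "cl p = Cline k (ci p)"

lemma mem_Rline:
  assumes "i \<in> {1..k}"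
  shows "p \<in> Rline k l i \<longleftrightarrow> p \<in> P \<and> ri p = i"
proof
  assume "p \<in> Rline k l i"
  then obtain t where t: "t < l" "p = t * k + i" by (auto simp: Rline_def)
  have "p - 1 = (i - 1) + t * k" "i - 1 < k" using t assms by auto
  then have "(p - 1) mod k = i - 1" by (simp only: mod_mult_self1 mod_less)
  then have "ri p = i" unfolding ri_def using assms by simp
  moreover have "t * k + i \<le> (l - 1) * k + k" using t assms
    by (intro add_mono mult_right_mono) auto
  moreover have "(l - 1) * k + k = k * l" using l3 by (cases l) auto
  ultimately show "p \<in> P \<and> ri p = i" using t assms by (auto simp: P_def)
next
  assume p: "p \<in> P \<and> ri p = i"
  have "p - 1 < l * k" using p by (auto simp: P_def mult.commute)
  then have "(p - 1) div k < l" by (simp add: less_mult_imp_div_less)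
  moreover have "p = (p - 1) div k * k + i"
    using p div_mult_mod_eq[of "p - 1" k] unfolding ri_def P_def by auto
  ultimately show "p \<in> Rline k l i" unfolding Rline_def by blast
qed

lemma mem_Cline:
  assumes "j \<in> {1..l}"
  shows "p \<in> Cline k j \<longleftrightarrow> p \<in> P \<and> ci p = j"
proof
  assume "p \<in> Cline k j"
  then obtain t where t: "t \<in> {1..k}" "p = (j - 1) * k + t" by (auto simp: Cline_def)
  have "p - 1 = (j - 1) * k + (t - 1)" "t - 1 < k" using t assms by auto
  then have "ci p = j" unfolding ci_def using assms by simp
  moreover have "(j - 1) * k + t \<le> (l - 1) * k + k" using t assms
    by (intro add_mono mult_right_mono) auto
  moreover have "(l - 1) * k + k = k * l" using l3 by (cases l) auto
  ultimately show "p \<in> P \<and> ci p = j" using t assms by (auto simp: P_def)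
next
  assume p: "p \<in> P \<and> ci p = j"
  have "p = (j - 1) * k + ri p"
    using p div_mult_mod_eq[of "p - 1" k] unfolding ri_def ci_def P_def by auto
  moreover have "ri p \<in> {1..k}" using k3 by (auto simp: ri_def Suc_le_eq)
  ultimately show "p \<in> Cline k j" unfolding Cline_def by blast
qed

lemma ri_range: "ri p \<in> {1..k}"
  using k3 by (auto simp: ri_def Suc_le_eq)

lemma ci_range: "p \<in> P \<Longrightarrow> ci p \<in> {1..l}"
proof -
  assume "p \<in> P"
  then have "p - 1 < l * k" by (auto simp: P_def mult.commute)
  then have "(p - 1) div k < l" by (simp add: less_mult_imp_div_less)
  then show ?thesis by (auto simp: ci_def)
qed

lemma point_exists:
  assumes "i \<in> {1..k}" "j \<in> {1..l}"
  shows "\<exists>p\<in>P. ri p = i \<and> ci p = j"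
proof -
  have "(j - 1) * k + i \<in> Cline k j" unfolding Cline_def using assms by blast
  moreover have "(j - 1) * k + i \<in> Rline k l i" unfolding Rline_def using assms by force
  ultimately show ?thesis using mem_Cline mem_Rline assms by blast
qed

lemma point_unique:
  assumes "p \<in> P" "q \<in> P" "ri p = ri q" "ci p = ci q"
  shows "p = q"
proof -
  have "p - 1 = q - 1" using assms(3,4) unfolding ri_def ci_def by (metis add_right_cancel div_mult_mod_eq)
  then show ?thesis using assms(1,2) by (auto simp: P_def)
qed

lemma inj_Rline: "inj_on (Rline k l) {1..k}"
proof
  fix i i' assume *: "i \<in> {1..k}" "i' \<in> {1..k}" "Rline k l i = Rline k l i'"
  obtain p where "p \<in> P" "ri p = i" using point_exists[of i 1] * l3 by auto
  then show "i = i'" using * mem_Rline by blast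
qed

lemma inj_Cline: "inj_on (Cline k) {1..l}"
proof
  fix i i' assume *: "i \<in> {1..l}" "i' \<in> {1..l}" "Cline k i = Cline k i'"
  obtain p where "p \<in> P" "ci p = i" using point_exists[of 1 i] * k3 by auto
  then show "i = i'" using * mem_Cline by blast
qed

lemma finite_P [simp]: "finite P" by (simp add: P_def)

lemma finite_R [simp]: "finite R" and card_R: "card R = k"
  using card_image[OF inj_Rline] by (simp_all add: R_def Rset_def)

lemma finite_C [simp]: "finite C" and card_C: "card C = l"
  using card_image[OF inj_Cline] by (simp_all add: C_def Cset_def)

lemma finite_lines [simp]: "finite lines" by (simp add: lines_def)

lemma rl_in [simp]: "rl p \<in> R"
  using ri_range by (auto simp: rl_def R_def Rset_def)

lemma cl_in [simp]: "p \<in> P \<Longrightarrow> cl p \<in> C"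
  using ci_range by (auto simp: cl_def C_def Cset_def)

lemma R_lines [simp]: "L \<in> R \<Longrightarrow> L \<in> lines" and C_lines [simp]: "L \<in> C \<Longrightarrow> L \<in> lines"
  by (auto simp: lines_def)

lemma mem_R:
  assumes "L \<in> R"
  shows "p \<in> L \<longleftrightarrow> p \<in> P \<and> rl p = L"
proof -
  obtain i where i: "i \<in> {1..k}" "L = Rline k l i" using assms by (auto simp: R_def Rset_def)
  have "rl p = L \<longleftrightarrow> ri p = i"
    unfolding i(2) rl_def by (rule inj_on_eq_iff[OF inj_Rline ri_range i(1)])
  then show ?thesis using mem_Rline[OF i(1)] i(2) by simp
qed

lemma mem_C:
  assumes "L \<in> C"
  shows "p \<in> L \<longleftrightarrow> p \<in> P \<and> cl p = L"
proof -
  obtain j where j: "j \<in> {1..l}" "L = Cline k j" using assms by (auto simp: C_def Cset_def)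
  have "cl p = L \<longleftrightarrow> ci p = j" if "p \<in> P"
    unfolding j(2) cl_def by (rule inj_on_eq_iff[OF inj_Cline ci_range[OF that] j(1)])
  then show ?thesis using mem_Cline[OF j(1)] j(2) by auto
qed

lemma pt_exists: "i \<in> R \<Longrightarrow> j \<in> C \<Longrightarrow> \<exists>p\<in>P. rl p = i \<and> cl p = j"
  using point_exists unfolding R_def C_def Rset_def Cset_def rl_def cl_def by force

lemma pt_unique: "p \<in> P \<Longrightarrow> q \<in> P \<Longrightarrow> rl p = rl q \<Longrightarrow> cl p = cl q \<Longrightarrow> p = q"
  using point_unique ri_range ci_range inj_Rline inj_Cline
  unfolding rl_def cl_def inj_on_def by metis

text \<open>As a row, a common member would contain a point of every other column, whereas distinct
  columns share no point.\<close>

lemma R_C_disjoint: "R \<inter> C = {}"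
proof (rule ccontr)
  assume "R \<inter> C \<noteq> {}"
  then obtain L where L: "L \<in> R" "L \<in> C" by blast
  have "\<not> card C \<le> Suc 0" using card_C l3 by simp
  then obtain M where M: "M \<in> C" "M \<noteq> L" using L(2) card_le_Suc0_iff_eq[of C] by auto
  obtain p where "p \<in> P" "rl p = L" "cl p = M" using pt_exists L(1) M(1) by blast
  then show False using L M mem_R mem_C by blast
qed

lemma rl_neq_cl: "p \<in> P \<Longrightarrow> rl p \<noteq> cl p"
  using R_C_disjoint rl_in cl_in by (metis disjoint_iff)

lemma mem_line: "L \<in> lines \<Longrightarrow> p \<in> L \<longleftrightarrow> p \<in> P \<and> (L = rl p \<or> L = cl p)"
  unfolding lines_def using mem_R mem_C R_C_disjoint cl_in rl_in by (metis UnE disjoint_iff)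

lemma line_subset_P: "L \<in> lines \<Longrightarrow> L \<subseteq> P"
  using mem_line by blast

lemma line_triple_Delta:
  assumes "L \<in> lines" "p \<in> L" "q \<in> L" "s \<in> L" "distinct [p, q, s]"
  shows "{p, q, s} \<in> Delta k l"
proof -
  have "(\<exists>i\<in>{1..k}. L = Rline k l i) \<or> (\<exists>j\<in>{1..l}. L = Cline k j)"
    using assms(1) by (auto simp: lines_def R_def C_def Rset_def Cset_def)
  moreover have "card {p, q, s} = 3" using assms(5) by auto
  moreover have "{p, q, s} \<subseteq> L" using assms by auto
  ultimately show ?thesis unfolding Delta_def by blast
qed

lemma Delta_line: "F \<in> Delta k l \<Longrightarrow> \<exists>L\<in>lines. F \<subseteq> L"
  by (auto simp: Delta_def lines_def R_def C_def Rset_def Cset_def)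

text \<open>Coordinates of a parameter \<open>\<theta>\<close>: \<open>Inl (b, r)\<close> for the normal of block \<open>b\<close>, \<open>Inr (p, r)\<close> with \<open>r < 3\<close> for
  the free vector of the point \<open>p\<close>, and \<open>Inr (p, 3)\<close> for its scalar factor.\<close>

definition W :: "((nat set set \<times> nat) + (nat \<times> nat) \<Rightarrow> complex) \<Rightarrow> nat set set \<Rightarrow> nat \<Rightarrow> complex" where
  "W \<theta> b = (\<lambda>r. if r < 3 then \<theta> (Inl (b, r)) else 0)"

definition Z :: "((nat set set \<times> nat) + (nat \<times> nat) \<Rightarrow> complex) \<Rightarrow> nat \<Rightarrow> nat \<Rightarrow> complex" where
  "Z \<theta> p = (\<lambda>r. \<theta> (Inr (p, r)))"

definition phi :: "(nat set \<Rightarrow> nat set set) \<Rightarrow> ((nat set set \<times> nat) + (nat \<times> nat) \<Rightarrow> complex) \<Rightarrow> nat \<Rightarrow> nat \<Rightarrow> complex" where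
  "phi lab \<theta> = (\<lambda>r p. if p \<in> P then \<theta> (Inr (p, 3)) *
      cross (W \<theta> (lab (rl p))) (if lab (rl p) = lab (cl p) then Z \<theta> p else W \<theta> (lab (cl p))) r else 0)"

text \<open>Partitions are encoded by the map sending each line to its block.\<close>

definition canon :: "(nat set \<Rightarrow> nat set set) \<Rightarrow> bool" where
  "canon lab \<longleftrightarrow> (\<forall>L\<in>lines. lab L = {M \<in> lines. lab M = lab L})"

lemma pf_W: "(\<lambda>\<theta>. W \<theta> b r) \<in> pf"
  unfolding W_def by (cases "r < 3") auto

lemma pf_Z: "(\<lambda>\<theta>. Z \<theta> p r) \<in> pf"
  unfolding Z_def by auto

lemma phi_pf: "(\<lambda>\<theta>. phi lab \<theta> r p) \<in> pf"
  unfolding phi_def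
  by (cases "p \<in> P"; cases "lab (rl p) = lab (cl p)") (auto intro!: pf_mult pf_cross pf_W pf_Z)

lemma phi_ambient: "phi lab \<theta> \<in> ambient (k * l)"
  by (auto simp: phi_def ambient_def P_def)

lemma range_phi_ambient: "range (phi lab) \<subseteq> ambient (k * l)"
  using phi_ambient by blast

lemma col_phi:
  "p \<in> P \<Longrightarrow> col (phi lab \<theta>) p = (\<lambda>r. \<theta> (Inr (p, 3)) *
      cross (W \<theta> (lab (rl p))) (if lab (rl p) = lab (cl p) then Z \<theta> p else W \<theta> (lab (cl p))) r)"
  by (auto simp: phi_def col_def)

lemma phi_perp:
  assumes "p \<in> P" "lab L = lab (rl p) \<or> lab L = lab (cl p)"
  shows "dot (W \<theta> (lab L)) (col (phi lab \<theta>) p) = 0"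
proof -
  have "dot w (\<lambda>r. c * cross w v r) = 0" "dot w (\<lambda>r. c * cross v w r) = 0" for w v c
    by (simp_all add: dot_def algebra_simps)
  then show ?thesis using assms by (auto simp: col_phi)
qed

text \<open>The criterion by which matrices are recognised as parametrized. Normals are given per
  line and only have to agree within blocks, so a construction may start from lines and forget about
  parameters.\<close>

lemma range_phiI:
  assumes Y: "Y \<in> ambient (k * l)"
    and w: "\<And>L M. L \<in> lines \<Longrightarrow> M \<in> lines \<Longrightarrow> lab L = lab M \<Longrightarrow> w L = w M"
    and eq: "\<And>p. p \<in> P \<Longrightarrow> lab (rl p) = lab (cl p) \<Longrightarrow> \<exists>v. col Y p = cross (w (rl p)) v"
    and neq: "\<And>p. p \<in> P \<Longrightarrow> lab (rl p) \<noteq> lab (cl p) \<Longrightarrow>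
      \<exists>c. col Y p = (\<lambda>r. c * cross (w (rl p)) (w (cl p)) r)"
  shows "Y \<in> range (phi lab)"
proof -
  obtain v where v: "\<And>p. p \<in> P \<Longrightarrow> lab (rl p) = lab (cl p) \<Longrightarrow> col Y p = cross (w (rl p)) (v p)"
    using eq by metis
  obtain c where c: "\<And>p. p \<in> P \<Longrightarrow> lab (rl p) \<noteq> lab (cl p) \<Longrightarrow>
      col Y p = (\<lambda>r. c p * cross (w (rl p)) (w (cl p)) r)"
    using neq by metis
  \<comment> \<open>A block receives the normal of an arbitrarily chosen line in it. The scalar
    factor is 1 at points inside one block, where the free vector already describes the
    column.\<close>
  define \<theta> where "\<theta> x = (case x of Inl (b, r) \<Rightarrow> w (SOME L. L \<in> lines \<and> lab L = b) r
      | Inr (p, r) \<Rightarrow> if r = 3 then (if lab (rl p) = lab (cl p) then 1 else c p) else v p r)" for x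
  have W: "W \<theta> (lab L) r = w L r" if "L \<in> lines" "r < 3" for L r
  proof -
    have "(SOME M. M \<in> lines \<and> lab M = lab L) \<in> lines \<and> lab (SOME M. M \<in> lines \<and> lab M = lab L) = lab L"
      using that by (intro someI_ex[of "\<lambda>M. M \<in> lines \<and> lab M = lab L"]) auto
    then show ?thesis using w[of "SOME M. M \<in> lines \<and> lab M = lab L" L] that
      by (auto simp: W_def \<theta>_def)
  qed
  have "phi lab \<theta> r p = Y r p" for r p
  proof (cases "p \<in> P")
    case True
    have lp: "rl p \<in> lines" "cl p \<in> lines" using True by auto
    show ?thesis
    proof (cases "lab (rl p) = lab (cl p)")
      case eq: True
      have "phi lab \<theta> r p = cross (w (rl p)) (v p) r"
        using True W[OF lp(1)] eq by (auto simp: phi_def \<theta>_def Z_def cross_def)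
      then show ?thesis using v[OF True eq] by (metis col_def)
    next
      case neq: False
      have "phi lab \<theta> r p = c p * cross (w (rl p)) (w (cl p)) r"
        using True W[OF lp(1)] W[OF lp(2)] neq by (auto simp: phi_def \<theta>_def cross_def)
      then show ?thesis using c[OF True neq] by (metis col_def)
    qed
  next
    case False
    then show ?thesis using Y by (auto simp: phi_def ambient_def P_def)
  qed
  then have "phi lab \<theta> = Y" by (auto simp: fun_eq_iff)
  then show ?thesis by auto
qed

section \<open>Covering \<open>V_Delta\<close> by parametrized sets\<close>

lemma V_Delta_line_dep:
  assumes "Y \<in> V_Delta k l" "L \<in> lines" "p \<in> L" "q \<in> L" "s \<in> L" "distinct [p, q, s]"
  shows "col_dep Y {p, q, s}"
  using assms(1) line_triple_Delta[OF assms(2-)] by (auto simp: V_Delta_def)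

lemma V_Delta_cover:
  assumes Y: "Y \<in> V_Delta k l"
  shows "\<exists>lab. canon lab \<and> Y \<in> range (phi lab)"
proof -
  have amb: "Y \<in> ambient (k * l)" using Y by (simp add: V_Delta_def)
  have "\<forall>L\<in>lines. \<exists>w. vec3 w \<and> w \<noteq> (\<lambda>_. 0) \<and> (\<forall>p\<in>L. dot w (col Y p) = 0)"
    using common_normal V_Delta_line_dep[OF Y] by blast
  then obtain w where w: "\<And>L. L \<in> lines \<Longrightarrow> vec3 (w L)" "\<And>L. L \<in> lines \<Longrightarrow> w L \<noteq> (\<lambda>_. 0)"
    "\<And>L p. L \<in> lines \<Longrightarrow> p \<in> L \<Longrightarrow> dot (w L) (col Y p) = 0"
    by metis
  define lab where "lab L = {M \<in> lines. cross (w L) (w M) = (\<lambda>_. 0)}" for L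
  have lab_iff: "lab L = lab M \<longleftrightarrow> cross (w L) (w M) = (\<lambda>_. 0)" if "L \<in> lines" "M \<in> lines" for L M
  proof
    assume "lab L = lab M"
    moreover have "M \<in> lab M" using that by (simp add: lab_def)
    ultimately have "M \<in> lab L" by simp
    then show "cross (w L) (w M) = (\<lambda>_. 0)" unfolding lab_def by simp
  next
    assume LM: "cross (w L) (w M) = (\<lambda>_. 0)"
    then have LM': "cross (w M) (w L) = (\<lambda>_. 0)" by (subst cross_sym)
    have "cross (w L) (w N) = (\<lambda>_. 0) \<longleftrightarrow> cross (w M) (w N) = (\<lambda>_. 0)" for N
      using cross_trans[OF w(1,2)[OF that(1)] LM'] cross_trans[OF w(1,2)[OF that(2)] LM] by blast
    then show "lab L = lab M" by (simp add: lab_def)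
  qed
  have "lab L = {M \<in> lines. lab M = lab L}" if "L \<in> lines" for L
  proof -
    have "lab L = {M \<in> lines. lab L = lab M}"
      unfolding lab_def[of L] using lab_iff[OF that] unfolding lab_def[of L] by blast
    then show ?thesis by (simp only: eq_commute)
  qed
  then have "canon lab" unfolding canon_def by blast
  \<comment> \<open>Parallel normals of one class may differ by a factor, so the normal of a chosen
    representative is used on the whole class.\<close>
  define rep where "rep L = (SOME M. M \<in> lines \<and> lab M = lab L)" for L
  have rep: "rep L \<in> lines \<and> lab (rep L) = lab L" if "L \<in> lines" for L
    unfolding rep_def using that by (intro someI_ex[of "\<lambda>M. M \<in> lines \<and> lab M = lab L"]) auto
  have rep_eq: "rep L = rep M" if "lab L = lab M" for L M using that by (simp add: rep_def)
  have perp: "dot (w (rep L)) (col Y p) = 0" if L: "L \<in> lines" "p \<in> L" for L p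
  proof -
    have par: "cross (w (rep L)) (w L) = (\<lambda>_. 0)" using lab_iff[OF conjunct1[OF rep[OF L(1)]] L(1)] rep[OF L(1)] by simp
    obtain r where r: "r < 3" "w L r \<noteq> 0"
      using w(1)[OF L(1)] w(2)[OF L(1)] vec3_eqI[of "w L" "\<lambda>_. 0"] by (auto simp: vec3_def less_3_cases)
    have dc: "dot a b = dot b a" for a b by (simp add: dot_def mult.commute)
    have "w L r * dot (w (rep L)) (col Y p) = w (rep L) r * dot (w L) (col Y p)"
      using cross_eq_0_dot[OF par r(1), of "col Y p"] dc by simp
    with r(2) w(3)[OF L] show ?thesis by simp
  qed
  have "Y \<in> range (phi lab)"
  proof (rule range_phiI[where w = "\<lambda>L. w (rep L)"])
    show "Y \<in> ambient (k * l)" by (rule amb)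
    show "w (rep L) = w (rep M)" if "lab L = lab M" for L M using rep_eq[OF that] by simp
    fix p assume p: "p \<in> P"
    have lp: "rl p \<in> lines" "cl p \<in> lines" "p \<in> rl p" "p \<in> cl p" using p mem_line by auto
    show "\<exists>v. col Y p = cross (w (rep (rl p))) v"
      using perp_imp_cross[OF vec3_col[OF amb] _ perp[OF lp(1,3)]] w(1,2) rep[OF lp(1)] by auto
    assume "lab (rl p) \<noteq> lab (cl p)"
    then have "cross (w (rep (rl p))) (w (rep (cl p))) \<noteq> (\<lambda>_. 0)" using rep lp lab_iff by metis
    then show "\<exists>c. col Y p = (\<lambda>r. c * cross (w (rep (rl p))) (w (rep (cl p))) r)"
      by (rule perp_both_imp_multiple_cross[OF vec3_col[OF amb] perp[OF lp(1,3)] perp[OF lp(2,4)]])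
  qed
  with \<open>canon lab\<close> show ?thesis by blast
qed

end

section \<open>Generic realizations\<close>

definition mom :: "complex \<Rightarrow> nat \<Rightarrow> complex" where
  "mom t = (\<lambda>r. t ^ r)"

text \<open>The coefficients of (X - a)(X - b), constant term at index 0.\<close>

definition quad :: "complex \<Rightarrow> complex \<Rightarrow> nat \<Rightarrow> complex" where
  "quad a b = (\<lambda>r. if r = 0 then a * b else if r = 1 then - (a + b) else 1)"

lemma cross_mom: "r < 3 \<Longrightarrow> cross (mom a) (mom b) r = (b - a) * quad a b r"
  unfolding less_3_cases mom_def quad_def by (elim disjE) (simp_all add: power2_eq_square algebra_simps)

lemma quad_sym: "quad a b = quad b a"
  by (auto simp: quad_def fun_eq_iff)

text \<open>For distinct a and b, the quadratics (X - v)(X - a) and (X - v)(X - b) span all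
  quadratics vanishing at v. The third one is independent of them exactly when v is not among its
  roots.\<close>

lemma det3_quad_shared:
  "det3 (quad v a) (quad v b) (quad c d) = (b - a) * (v - c) * (v - d)"
  by (simp add: det3_expand quad_def algebra_simps)

lemma det3_swap: "det3 v u w = - det3 u v w" "det3 u w v = - det3 u v w" "det3 w v u = - det3 u v w"
  by (simp_all add: det3_expand algebra_simps)

lemma det3_scale:
  assumes "\<And>r. r < 3 \<Longrightarrow> u' r = a * u r" "\<And>r. r < 3 \<Longrightarrow> v' r = b * v r" "\<And>r. r < 3 \<Longrightarrow> w' r = c * w r"
  shows "det3 u' v' w' = a * b * c * det3 u v w"
  unfolding det3_expand by (simp add: assms algebra_simps)

lemma cross_scale:
  assumes "\<And>r. r < 3 \<Longrightarrow> u' r = a * u r" "\<And>r. r < 3 \<Longrightarrow> v' r = b * v r"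
  shows "cross u' v' = (\<lambda>r. a * b * cross u v r)"
  by (rule vec3_eqI[OF vec3_cross(1) vec3_cross(2)]) (simp_all add: assms algebra_simps)

lemma det3_cross_mom:
  "det3 (cross (mom a1) (mom b1)) (cross (mom a2) (mom b2)) (cross (mom a3) (mom b3)) =
    (b1 - a1) * (b2 - a2) * (b3 - a3) * det3 (quad a1 b1) (quad a2 b2) (quad a3 b3)"
  by (intro det3_scale cross_mom)

lemma det3_quad_neq_0:
  assumes "v \<in> {a1, b1}" "v \<in> {a2, b2}" "v \<notin> {a3, b3}" "{a1, b1} \<noteq> {a2, b2}"
  shows "det3 (quad a1 b1) (quad a2 b2) (quad a3 b3) \<noteq> 0"
proof -
  obtain a where a: "quad a1 b1 = quad v a" "{a1, b1} = {v, a}" using assms(1) quad_sym by blast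
  obtain b where b: "quad a2 b2 = quad v b" "{a2, b2} = {v, b}" using assms(2) quad_sym by blast
  have "a \<noteq> b" using a b assms(4) by auto
  then show ?thesis unfolding a(1) b(1) det3_quad_shared using assms(3) by simp
qed

lemma inj_into_complex:
  assumes "finite A"
  shows "\<exists>h :: 'a \<Rightarrow> complex. inj_on h A"
proof -
  obtain f :: "'a \<Rightarrow> nat" where f: "inj_on f A"
    using finite_imp_inj_to_nat_seg[OF assms] by blast
  show ?thesis by (rule exI[of _ "of_nat \<circ> f"]) (use f in \<open>auto simp: inj_on_def\<close>)
qed

text \<open>Points of the moment curve turn the generic configuration into quadratic polynomials with
  prescribed roots; three of them are independent as soon as two have exactly one common root
  which the third does not have.\<close>

lemma generic_roots:
  assumes ends: "a1 \<noteq> b1" "a2 \<noteq> b2" "a3 \<noteq> b3"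
    and "{a1, b1} \<noteq> {a2, b2}" "{a1, b1} \<noteq> {a3, b3}" "{a2, b2} \<noteq> {a3, b3}"
    and "{a1, b1} \<inter> {a2, b2} \<inter> {a3, b3} = {}"
  shows "\<exists>h :: 'a \<Rightarrow> complex. det3 (cross (mom (h a1)) (mom (h b1)))
    (cross (mom (h a2)) (mom (h b2))) (cross (mom (h a3)) (mom (h b3))) \<noteq> 0"
proof (cases "{a1, b1} \<inter> {a2, b2} = {} \<and> {a1, b1} \<inter> {a3, b3} = {} \<and> {a2, b2} \<inter> {a3, b3} = {}")
  case True
  \<comment> \<open>Here the three pairs are disjoint. Giving \<open>b1\<close> and
    \<open>a2\<close> the same value 1 creates a shared root of the first two quadratics that the
    third one lacks.\<close>
  let ?h = "\<lambda>x. if x = a1 then 0 else if x = b1 \<or> x = a2 then 1 else if x = b2 then 2 else if x = a3 then 3 else 4 :: complex"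
  have "?h a1 = 0" "?h b1 = 1" "?h a2 = 1" "?h b2 = 2" "?h a3 = 3" "?h b3 = 4"
    using True ends by auto
  moreover have "det3 (quad 0 1) (quad 1 2) (quad 3 4) \<noteq> 0"
    by (rule det3_quad_neq_0[where v = 1]) (auto simp: doubleton_eq_iff)
  ultimately show ?thesis unfolding det3_cross_mom by (intro exI[of _ ?h]) simp
next
  case False
  obtain h :: "'a \<Rightarrow> complex" where h: "inj_on h {a1, b1, a2, b2, a3, b3}"
    using inj_into_complex[of "{a1, b1, a2, b2, a3, b3}"] by auto
  have im: "h x \<in> {h c, h d} \<longleftrightarrow> x \<in> {c, d}"
    if "{x, c, d} \<subseteq> {a1, b1, a2, b2, a3, b3}" for x c d
    using inj_on_eq_iff[OF h] that by auto
  have ds: "{h a, h b} = {h c, h d} \<longleftrightarrow> {a, b} = {c, d}"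
    if "{a, b, c, d} \<subseteq> {a1, b1, a2, b2, a3, b3}" for a b c d
    using inj_on_eq_iff[OF h] that by (auto simp: doubleton_eq_iff)
  have key: "det3 (quad (h a) (h b)) (quad (h c) (h d)) (quad (h e) (h f)) \<noteq> 0"
    if "x \<in> {a, b}" "x \<in> {c, d}" "x \<notin> {e, f}" "{a, b} \<noteq> {c, d}"
      "{a, b, c, d, e, f} \<subseteq> {a1, b1, a2, b2, a3, b3}" for x a b c d e f
    by (rule det3_quad_neq_0[where v = "h x"]; (subst im | subst ds); use that in blast)
  have "det3 (quad (h a1) (h b1)) (quad (h a2) (h b2)) (quad (h a3) (h b3)) \<noteq> 0"
  proof -
    consider x where "x \<in> {a1, b1}" "x \<in> {a2, b2}" | x where "x \<in> {a1, b1}" "x \<in> {a3, b3}"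
      | x where "x \<in> {a2, b2}" "x \<in> {a3, b3}" using False by blast
    then show ?thesis
    proof cases
      case 1
      then show ?thesis using key[of x a1 b1 a2 b2 a3 b3] assms(4-7) by blast
    next
      case 2
      then have "det3 (quad (h a1) (h b1)) (quad (h a3) (h b3)) (quad (h a2) (h b2)) \<noteq> 0"
        using key[of x a1 b1 a3 b3 a2 b2] assms(4-7) by blast
      then show ?thesis
        using det3_swap(2)[of "quad (h a1) (h b1)" "quad (h a3) (h b3)" "quad (h a2) (h b2)"] by simp
    next
      case 3
      then have "det3 (quad (h a3) (h b3)) (quad (h a2) (h b2)) (quad (h a1) (h b1)) \<noteq> 0"
        using key[of x a3 b3 a2 b2 a1 b1] assms(4-7) by blast
      then show ?thesis
        using det3_swap(3)[of "quad (h a1) (h b1)" "quad (h a2) (h b2)" "quad (h a3) (h b3)"] by simp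
    qed
  qed
  moreover have "h a1 \<noteq> h b1" "h a2 \<noteq> h b2" "h a3 \<noteq> h b3"
    using ends inj_on_eq_iff[OF h] by auto
  ultimately show ?thesis unfolding det3_cross_mom by (intro exI[of _ h]) auto
qed

lemma det3_multiples_of_cross: "det3 (\<lambda>r. a * cross w u r) (\<lambda>r. b * cross w v r) (\<lambda>r. c * cross w x r) = 0"
  by (simp add: det3_expand algebra_simps)

context grid
begin

text \<open>Points become edges of a multigraph whose vertices are the blocks. A point with both
  lines in one block is a loop, a singleton set.\<close>

definition edge :: "(nat set \<Rightarrow> nat set set) \<Rightarrow> nat \<Rightarrow> nat set set set" where
  "edge lab p = {lab (rl p), lab (cl p)}"

text \<open>These are the pairs of type 1, parallel for all parameters.\<close>

definition par :: "(nat set \<Rightarrow> nat set set) \<Rightarrow> nat \<Rightarrow> nat \<Rightarrow> bool" where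
  "par lab p q \<longleftrightarrow> p \<noteq> q \<and> edge lab p = edge lab q \<and> lab (rl p) \<noteq> lab (cl p)"

text \<open>The expected independent triples: no two points are parallel and no block contains all
  three, that is, the edges have no common vertex.\<close>

definition indep3 :: "(nat set \<Rightarrow> nat set set) \<Rightarrow> nat \<Rightarrow> nat \<Rightarrow> nat \<Rightarrow> bool" where
  "indep3 lab p q s \<longleftrightarrow> distinct [p, q, s] \<and> \<not> par lab p q \<and> \<not> par lab p s \<and> \<not> par lab q s \<and>
     edge lab p \<inter> edge lab q \<inter> edge lab s = {}"

text \<open>The two roots attached to a point. A point with both lines in one block gets a private second
  root \<open>Inr p\<close>, so that every point has two distinct roots.\<close>

definition tail :: "(nat set \<Rightarrow> nat set set) \<Rightarrow> nat \<Rightarrow> nat set set + nat" where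
  "tail lab p = Inl (lab (rl p))"

definition head :: "(nat set \<Rightarrow> nat set set) \<Rightarrow> nat \<Rightarrow> nat set set + nat" where
  "head lab p = (if lab (rl p) = lab (cl p) then Inr p else Inl (lab (cl p)))"

definition mom_param :: "(nat set set + nat \<Rightarrow> complex) \<Rightarrow> (nat set set \<times> nat) + (nat \<times> nat) \<Rightarrow> complex" where
  "mom_param h x = (case x of Inl (b, r) \<Rightarrow> mom (h (Inl b)) r
     | Inr (p, r) \<Rightarrow> if r = 3 then 1 else mom (h (Inr p)) r)"

lemma col_phi_mom:
  assumes "p \<in> P"
  shows "col (phi lab (mom_param h)) p = cross (mom (h (tail lab p))) (mom (h (head lab p)))"
  by (rule vec3_eqI[OF vec3_col[OF phi_ambient]])
    (use assms in \<open>auto simp: col_phi tail_def head_def mom_param_def W_def Z_def\<close>)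

lemma tail_neq_head: "tail lab p \<noteq> head lab p"
  by (auto simp: tail_def head_def)

lemma Inl_ends: "Inl b \<in> {tail lab p, head lab p} \<longleftrightarrow> b \<in> edge lab p"
  by (cases "lab (rl p) = lab (cl p)") (simp_all add: tail_def head_def edge_def)

lemma Inr_ends: "Inr q \<in> {tail lab p, head lab p} \<longleftrightarrow> lab (rl p) = lab (cl p) \<and> q = p"
  by (simp add: tail_def head_def)

text \<open>Equal root pairs give equal edges, which leaves only loops when the points are not
  parallel; two loops at the same block are told apart by their private roots.\<close>

lemma ends_neq:
  assumes "p \<noteq> q" "\<not> par lab p q"
  shows "{tail lab p, head lab p} \<noteq> {tail lab q, head lab q}"
proof
  assume eq: "{tail lab p, head lab p} = {tail lab q, head lab q}"
  have "b \<in> edge lab p \<longleftrightarrow> b \<in> edge lab q" for b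
    unfolding Inl_ends[symmetric] eq ..
  then have "edge lab p = edge lab q" by blast
  then have "lab (rl p) = lab (cl p)" using assms by (simp add: par_def)
  then have "Inr p \<in> {tail lab p, head lab p}" by (simp only: Inr_ends simp_thms)
  then show False unfolding eq Inr_ends using assms(1) by blast
qed

lemma indep3_generic:
  assumes "indep3 lab p q s" "p \<in> P" "q \<in> P" "s \<in> P"
  shows "\<exists>\<theta>. det3 (col (phi lab \<theta>) p) (col (phi lab \<theta>) q) (col (phi lab \<theta>) s) \<noteq> 0"
proof -
  have d: "p \<noteq> q" "p \<noteq> s" "q \<noteq> s" "\<not> par lab p q" "\<not> par lab p s" "\<not> par lab q s"
    "edge lab p \<inter> edge lab q \<inter> edge lab s = {}"
    using assms(1) by (simp_all add: indep3_def)
  have "x \<notin> {tail lab p, head lab p} \<inter> {tail lab q, head lab q} \<inter> {tail lab s, head lab s}" for x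
  proof (cases x)
    case (Inl b)
    show ?thesis unfolding Inl Int_iff Inl_ends using d(7) by blast
  next
    case (Inr r)
    show ?thesis unfolding Inr Int_iff Inr_ends using d(1) by blast
  qed
  then have "{tail lab p, head lab p} \<inter> {tail lab q, head lab q} \<inter> {tail lab s, head lab s} = {}"
    by blast
  then obtain h where "det3 (cross (mom (h (tail lab p))) (mom (h (head lab p))))
      (cross (mom (h (tail lab q))) (mom (h (head lab q))))
      (cross (mom (h (tail lab s))) (mom (h (head lab s)))) \<noteq> 0"
    using generic_roots[OF tail_neq_head tail_neq_head tail_neq_head
      ends_neq[OF d(1,4)] ends_neq[OF d(2,5)] ends_neq[OF d(3,6)]] by blast
  then show ?thesis using col_phi_mom assms(2-) by (intro exI[of _ "mom_param h"]) simp
qed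

lemma pair_generic:
  assumes "p \<noteq> q" "\<not> par lab p q" "p \<in> P" "q \<in> P"
  shows "\<exists>\<theta>. \<not> col_dep (phi lab \<theta>) {p, q}"
proof -
  obtain h :: "nat set set + nat \<Rightarrow> complex" where
    h: "inj_on h {tail lab p, head lab p, tail lab q, head lab q}"
    using inj_into_complex[of "{tail lab p, head lab p, tail lab q, head lab q}"] by auto
  let ?a = "h (tail lab p)" and ?b = "h (head lab p)" and ?c = "h (tail lab q)" and ?d = "h (head lab q)"
  have "cross (quad ?a ?b) (quad ?c ?d) \<noteq> (\<lambda>_. 0)"
  proof
    assume "cross (quad ?a ?b) (quad ?c ?d) = (\<lambda>_. 0)"
    \<comment> \<open>Both quadratics are monic, so being parallel means having equal coefficients,
      and then they have the same roots.\<close>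
    then have "- (?a + ?b) = - (?c + ?d)" "?a * ?b = ?c * ?d"
      unfolding cross_eq_0_iff cross_simps quad_def by auto
    then have e: "?a + ?b = ?c + ?d" "?a * ?b = ?c * ?d" by (simp_all only: neg_equal_iff_equal)
    then have "(?a - ?c) * (?a - ?d) = 0" by algebra
    then have "(?a = ?c \<and> ?b = ?d) \<or> (?a = ?d \<and> ?b = ?c)" using e(1) by auto
    then have "(tail lab p = tail lab q \<and> head lab p = head lab q) \<or>
        (tail lab p = head lab q \<and> head lab p = tail lab q)"
      by (simp add: inj_on_eq_iff[OF h])
    then show False using ends_neq[OF assms(1,2)] unfolding doubleton_eq_iff by blast
  qed
  moreover have "cross (col (phi lab (mom_param h)) p) (col (phi lab (mom_param h)) q) =
      (\<lambda>r. (?b - ?a) * (?d - ?c) * cross (quad ?a ?b) (quad ?c ?d) r)"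
    unfolding col_phi_mom[OF assms(3)] col_phi_mom[OF assms(4)]
    by (intro cross_scale cross_mom)
  moreover have "?b - ?a \<noteq> 0" "?d - ?c \<noteq> 0"
    using inj_on_eq_iff[OF h] tail_neq_head[of lab p] tail_neq_head[of lab q] by auto
  ultimately have "cross (col (phi lab (mom_param h)) p) (col (phi lab (mom_param h)) q) \<noteq> (\<lambda>_. 0)"
    by (auto simp: fun_eq_iff)
  then show ?thesis using col_dep_pair_cross[OF assms(1)] by blast
qed

lemma point_generic:
  assumes "p \<in> P"
  shows "\<exists>\<theta>. \<not> col_dep (phi lab \<theta>) {p}"
proof -
  obtain q where q: "q \<in> P" "rl q \<noteq> rl p" "cl q \<noteq> cl p"
  proof -
    have "\<not> card R \<le> Suc 0" "\<not> card C \<le> Suc 0" using card_R card_C k3 l3 by auto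
    then obtain i j where "i \<in> R" "i \<noteq> rl p" "j \<in> C" "j \<noteq> cl p"
      using card_le_Suc0_iff_eq[of R] card_le_Suc0_iff_eq[of C] by (metis finite_R finite_C)
    then show ?thesis using that pt_exists by metis
  qed
  obtain h :: "nat set set + nat \<Rightarrow> complex" where h: "inj_on h {tail lab p, head lab p}"
    using inj_into_complex[of "{tail lab p, head lab p}"] by auto
  \<comment> \<open>\<open>quad\<close> is monic, so this coordinate is the difference of the two
    roots of p.\<close>
  have "col (phi lab (mom_param h)) p 2 \<noteq> 0"
    unfolding col_phi_mom[OF assms] using cross_mom[of 2] inj_on_eq_iff[OF h] tail_neq_head[of lab p]
    by (auto simp: quad_def simp del: cross_simps)
  then show ?thesis
    by (intro exI[of _ "mom_param h"]) (auto simp: col_dep_def col_def intro!: exI[of _ 2])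
qed

lemma mem_block:
  assumes "canon lab" "L \<in> lines"
  shows "p \<in> \<Union>(lab L) \<longleftrightarrow> p \<in> P \<and> lab L \<in> edge lab p"
proof -
  have "lab L = {M \<in> lines. lab M = lab L}" using assms unfolding canon_def by blast
  then have "p \<in> \<Union>(lab L) \<longleftrightarrow> (\<exists>M\<in>lines. lab M = lab L \<and> p \<in> M)" by blast
  also have "\<dots> \<longleftrightarrow> p \<in> P \<and> lab L \<in> edge lab p"
    unfolding edge_def using mem_line cl_in rl_in C_lines R_lines
    by (metis insert_iff singletonD)
  finally show ?thesis .
qed

section \<open>Dependent and independent sets under the parametrization\<close>

abbreviation "gdep lab \<equiv> G_dep k l (lab ` lines)"

lemma type1_iff:
  assumes "canon lab" "p \<noteq> q"
  shows "{p, q} \<in> G_type1 (lab ` lines) \<longleftrightarrow> p \<in> P \<and> q \<in> P \<and> par lab p q"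
proof
  assume "{p, q} \<in> G_type1 (lab ` lines)"
  then obtain L M where LM: "L \<in> lines" "M \<in> lines" "lab L \<noteq> lab M"
    "{p, q} \<subseteq> \<Union>(lab L)" "{p, q} \<subseteq> \<Union>(lab M)"
    by (auto simp: G_type1_def)
  then have m: "p \<in> P" "q \<in> P" "lab L \<in> edge lab p" "lab M \<in> edge lab p"
    "lab L \<in> edge lab q" "lab M \<in> edge lab q"
    using mem_block[OF assms(1) LM(1)] mem_block[OF assms(1) LM(2)] by blast+
  \<comment> \<open>An edge has at most two ends, so two distinct ends determine it and exclude a
    loop.\<close>
  have two: "edge lab r = {lab L, lab M} \<and> lab (rl r) \<noteq> lab (cl r)"
    if "lab L \<in> edge lab r" "lab M \<in> edge lab r" for r
    using that LM(3) unfolding edge_def by (elim insertE emptyE) (simp_all add: insert_commute)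
  show "p \<in> P \<and> q \<in> P \<and> par lab p q"
    using m(1,2) assms(2) two[OF m(3,4)] two[OF m(5,6)] by (simp add: par_def)
next
  assume pq: "p \<in> P \<and> q \<in> P \<and> par lab p q"
  have lp: "rl p \<in> lines" "cl p \<in> lines" using pq by simp_all
  have ep: "lab (rl p) \<in> edge lab p" "lab (cl p) \<in> edge lab p" by (simp_all add: edge_def)
  then have eq: "lab (rl p) \<in> edge lab q" "lab (cl p) \<in> edge lab q" using pq by (simp_all add: par_def)
  have "{p, q} \<subseteq> \<Union>(lab (rl p)) \<inter> \<Union>(lab (cl p))"
    using mem_block[OF assms(1) lp(1)] mem_block[OF assms(1) lp(2)] ep eq pq by simp
  moreover have "card {p, q} = 2" using assms(2) by simp
  moreover have "lab (rl p) \<noteq> lab (cl p)" using pq by (simp add: par_def)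
  ultimately show "{p, q} \<in> G_type1 (lab ` lines)"
    using lp unfolding G_type1_def by blast
qed

lemma type1_pairE:
  assumes "canon lab" "T \<in> G_type1 (lab ` lines)"
  obtains p q where "T = {p, q}" "p \<in> P" "q \<in> P" "par lab p q" "p \<noteq> q"
proof -
  obtain p q where "T = {p, q}" "p \<noteq> q" using assms(2) by (auto simp: G_type1_def card_2_iff)
  then show ?thesis using type1_iff[OF assms(1)] assms(2) that by blast
qed

lemma col_phi_multiple:
  assumes pL: "p \<in> P" "lab L = lab (rl p) \<or> lab L = lab (cl p)"
  shows "\<exists>a v. col (phi lab \<theta>) p = (\<lambda>r. a * cross (W \<theta> (lab L)) v r)"
proof -
  have flip: "(\<lambda>r. c * cross u w r) = (\<lambda>r. (- c) * cross w u r)" for c u w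
    by (rule vec3_eqI[OF vec3_cross(2) vec3_cross(2)]) (simp_all add: algebra_simps)
  from pL(2) show ?thesis
  proof
    assume "lab L = lab (rl p)"
    then show ?thesis unfolding col_phi[OF pL(1)] by (intro exI) simp
  next
    assume cl: "lab L = lab (cl p)"
    show ?thesis
    proof (cases "lab (rl p) = lab (cl p)")
      case True
      then show ?thesis unfolding col_phi[OF pL(1)] cl by (intro exI) simp
    next
      case False
      then have "col (phi lab \<theta>) p = (\<lambda>r. \<theta> (Inr (p, 3)) * cross (W \<theta> (lab (rl p))) (W \<theta> (lab L)) r)"
        unfolding col_phi[OF pL(1)] cl by simp
      also note flip
      finally show ?thesis by blast
    qed
  qed
qed

text \<open>True for every parameter, not only for generic ones: Type 1 pairs are multiples of the
  same cross product, Type 2 triples are orthogonal to one normal, and four vectors of three-space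
  are always dependent.\<close>

lemma phi_gdep:
  assumes "canon lab" "gdep lab S"
  shows "col_dep (phi lab \<theta>) S"
proof -
  let ?Y = "phi lab \<theta>"
  obtain D where D: "D \<in> G_circuits k l (lab ` lines)" "D \<subseteq> S" "S \<subseteq> P"
    using assms(2) by (auto simp: G_dep_def P_def)
  have "col_dep ?Y D"
  proof -
    consider "D \<in> G_type1 (lab ` lines)" | "D \<in> G_type2 (lab ` lines)" | "D \<in> G_type3 k l (lab ` lines)"
      using D(1) by (auto simp: G_circuits_def)
    then show ?thesis
    proof cases
      case 1
      then obtain p q where pq: "D = {p, q}" "p \<in> P" "q \<in> P" "par lab p q" "p \<noteq> q"
        using type1_pairE[OF assms(1)] by metis
      then have "(lab (rl q) = lab (rl p) \<and> lab (cl q) = lab (cl p)) \<or>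
          (lab (rl q) = lab (cl p) \<and> lab (cl q) = lab (rl p))" "lab (rl q) \<noteq> lab (cl q)"
        by (auto simp: par_def edge_def doubleton_eq_iff)
      then have "cross (col ?Y p) (col ?Y q) = (\<lambda>_. 0)"
        using pq unfolding par_def cross_eq_0_iff
        by (auto simp: col_phi algebra_simps)
      then show ?thesis using col_dep_pair pq by blast
    next
      case 2
      then obtain L where L: "L \<in> lines" "D \<subseteq> \<Union>(lab L)" "card D = 3" by (auto simp: G_type2_def)
      have mult: "\<exists>a v. col ?Y p = (\<lambda>r. a * cross (W \<theta> (lab L)) v r)" if "p \<in> D" for p
      proof -
        have "p \<in> P" "lab L = lab (rl p) \<or> lab L = lab (cl p)"
          using L that mem_block[OF assms(1)] by (auto simp: edge_def)
        then show ?thesis by (rule col_phi_multiple)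
      qed
      obtain p q s where pqs: "D = {p, q, s}" "distinct [p, q, s]"
        using L(3) by (auto simp: card_Suc_eq numeral_eq_Suc)
      then have "det3 (col ?Y p) (col ?Y q) (col ?Y s) = 0"
        using mult[of p] mult[of q] mult[of s] by (auto simp: det3_multiples_of_cross)
      then show ?thesis using det3_eq_0_col_dep[OF pqs(2)] pqs(1) by simp
    next
      case 3
      then show ?thesis using col_dep_4 by (auto simp: G_type3_def)
    qed
  qed
  then show ?thesis using D(2,3) col_dep_mono finite_subset[OF _ finite_P] by blast
qed

lemma gdepI:
  assumes "D \<in> G_type1 Q \<union> G_type2 Q" "D \<subseteq> S" "S \<subseteq> P"
  shows "G_dep k l Q S"
  unfolding G_dep_def G_circuits_def P_def[symmetric] using assms by blast

lemma gdep_card: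
  assumes "S \<subseteq> P" "4 \<le> card S"
  shows "G_dep k l Q S"
proof -
  obtain T where T: "T \<subseteq> S" "card T = 4" using assms(2) by (metis obtain_subset_with_card_n)
  show ?thesis
  proof (cases "\<exists>U\<in>G_type1 Q \<union> G_type2 Q. U \<subseteq> T")
    case True
    then show ?thesis using T assms(1) by (auto simp: G_dep_def G_circuits_def P_def)
  next
    case False
    then have "T \<in> G_type3 k l Q" using T assms(1) by (auto simp: G_type3_def P_def)
    then show ?thesis using T assms(1) by (auto simp: G_dep_def G_circuits_def P_def)
  qed
qed

lemma not_gdep_not_par:
  assumes "canon lab" "S \<subseteq> P" "\<not> gdep lab S" "p \<in> S" "q \<in> S"
  shows "\<not> par lab p q"
proof
  assume a: "par lab p q"
  then have "{p, q} \<in> G_type1 (lab ` lines)"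
    using type1_iff[OF assms(1), of p q] assms(2,4,5) by (auto simp: par_def)
  then show False using gdepI[of "{p, q}" "lab ` lines" S] assms(2-) by simp
qed

lemma not_gdep_generic:
  assumes "canon lab" "S \<subseteq> P" "\<not> gdep lab S"
  shows "\<exists>\<theta>. \<not> col_dep (phi lab \<theta>) S"
proof -
  have fin: "finite S" using assms(2) finite_subset finite_P by blast
  have "card S < 4" using gdep_card[OF assms(2)] assms(3) by (meson not_less)
  then consider "card S = 0" | "card S = 1" | "card S = 2" | "card S = 3" by linarith
  then show ?thesis
  proof cases
    case 1
    then show ?thesis using fin by (auto simp: col_dep_def)
  next
    case 2
    then show ?thesis using point_generic assms(2) by (auto simp: card_1_singleton_iff)
  next
    case 3
    then obtain p q where "S = {p, q}" "p \<noteq> q" by (auto simp: card_2_iff)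
    then show ?thesis using pair_generic not_gdep_not_par[OF assms] assms(2) by auto
  next
    case 4
    then obtain p q s where pqs: "S = {p, q, s}" "distinct [p, q, s]"
      by (auto simp: card_Suc_eq numeral_eq_Suc)
    have "edge lab p \<inter> edge lab q \<inter> edge lab s = {}"
    proof (rule ccontr)
      assume "edge lab p \<inter> edge lab q \<inter> edge lab s \<noteq> {}"
      then obtain b where b: "b \<in> edge lab p" "b \<in> edge lab q" "b \<in> edge lab s" by blast
      have "p \<in> P" using assms(2) pqs(1) by simp
      then have "rl p \<in> lines" "cl p \<in> lines" by simp_all
      then obtain L where L: "L \<in> lines" "b = lab L"
        using b(1) unfolding edge_def by blast
      then have "S \<subseteq> \<Union>(lab L)" using b mem_block[OF assms(1) L(1)] pqs(1) assms(2) by auto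
      moreover have "\<not> (\<exists>T\<in>G_type1 (lab ` lines). T \<subseteq> S)"
        using gdepI[of _ "lab ` lines" S] assms(2,3) by blast
      ultimately have "S \<in> G_type2 (lab ` lines)" using 4 L(1) by (auto simp: G_type2_def)
      then show False using gdepI[of S "lab ` lines" S] assms(2,3) by blast
    qed
    then have "indep3 lab p q s"
      using pqs not_gdep_not_par[OF assms] by (auto simp: indep3_def)
    then obtain \<theta> where "det3 (col (phi lab \<theta>) p) (col (phi lab \<theta>) q) (col (phi lab \<theta>) s) \<noteq> 0"
      using indep3_generic[of lab p q s] assms(2) pqs(1) by blast
    then show ?thesis using col_dep_det3_eq_0 pqs(1) by blast
  qed
qed

lemma indep3_not_gdep:
  assumes "canon lab" "indep3 lab p q s" "p \<in> P" "q \<in> P" "s \<in> P"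
  shows "\<not> gdep lab {p, q, s}"
proof -
  obtain \<theta> where "det3 (col (phi lab \<theta>) p) (col (phi lab \<theta>) q) (col (phi lab \<theta>) s) \<noteq> 0"
    using indep3_generic[OF assms(2-)] by blast
  then show ?thesis using phi_gdep[OF assms(1)] col_dep_det3_eq_0 by blast
qed

text \<open>Each independent set S contributes one certificate from \<open>open_col_indep\<close>,
  nonzero for some parameter. Where all certificates are nonzero, \<open>phi_gdep\<close> completes
  a realization, so a polynomial vanishing on realizations vanishes on a dense set of parameters. No
  admissibility is assumed.\<close>

lemma range_phi_closure_realizations:
  assumes "canon lab"
  shows "range (phi lab) \<subseteq> matroid_variety (k * l) (gdep lab)"
proof -
  let ?X = "{S. S \<subseteq> P \<and> \<not> gdep lab S}"
  have "\<exists>d\<in>polyfun (k * l). (\<exists>\<theta>. d (phi lab \<theta>) \<noteq> 0) \<and> (\<forall>Y. d Y \<noteq> 0 \<longrightarrow> \<not> col_dep Y S)"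
    if S: "S \<subseteq> P" "\<not> gdep lab S" for S
  proof -
    obtain \<theta> where t: "\<not> col_dep (phi lab \<theta>) S" using not_gdep_generic[OF assms S] by blast
    have "card S < 4" using gdep_card[OF S(1)] S(2) by (meson not_less)
    then have c: "card S \<le> 3" by simp
    show ?thesis using open_col_indep[OF S(1)[unfolded P_def] c t] by blast
  qed
  then have "\<forall>S\<in>?X. \<exists>d. d \<in> polyfun (k * l) \<and> (\<exists>\<theta>. d (phi lab \<theta>) \<noteq> 0) \<and>
      (\<forall>Y. d Y \<noteq> 0 \<longrightarrow> \<not> col_dep Y S)" by blast
  from bchoice[OF this] obtain d where d: "\<And>S. S \<in> ?X \<Longrightarrow> d S \<in> polyfun (k * l)"
    "\<And>S. S \<in> ?X \<Longrightarrow> \<exists>\<theta>. d S (phi lab \<theta>) \<noteq> 0"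
    "\<And>S Y. S \<in> ?X \<Longrightarrow> d S Y \<noteq> 0 \<Longrightarrow> \<not> col_dep Y S"
    by blast
  have "g (phi lab \<theta>) = 0"
    if g: "g \<in> polyfun (k * l)" "\<forall>Y\<in>{Y. realization (k * l) (gdep lab) Y}. g Y = 0" for g \<theta>
  proof (rule pf_vanish_generic[where f = "\<lambda>\<theta>. g (phi lab \<theta>)" and X = ?X
        and g = "\<lambda>S \<theta>. d S (phi lab \<theta>)"])
    show "(\<lambda>\<theta>. g (phi lab \<theta>)) \<in> pf" by (rule polyfun_comp_pf[OF g(1) phi_pf])
    show "finite ?X" by (rule finite_subset[of _ "Pow P"]) auto
    show "(\<lambda>\<theta>. d S (phi lab \<theta>)) \<in> pf" if "S \<in> ?X" for S
      by (rule polyfun_comp_pf[OF d(1)[OF that] phi_pf])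
    show "\<exists>\<theta>. d S (phi lab \<theta>) \<noteq> 0" if "S \<in> ?X" for S using d(2)[OF that] .
    fix \<theta> assume "\<forall>S\<in>?X. d S (phi lab \<theta>) \<noteq> 0"
    then have "realization (k * l) (gdep lab) (phi lab \<theta>)"
      using d(3) phi_gdep[OF assms] phi_ambient unfolding realization_def P_def by blast
    then show "g (phi lab \<theta>) = 0" using g(2) by blast
  qed
  moreover have "{Y. realization (k * l) (gdep lab) Y} \<subseteq> ambient (k * l)"
    by (auto simp: realization_def)
  ultimately show ?thesis
    unfolding matroid_variety_def using zariski_closure_iff range_phi_ambient by blast
qed

end

section \<open>Matroid varieties of admissible partitions\<close>

context grid
begin

lemma canonD: "canon lab \<Longrightarrow> L \<in> lines \<Longrightarrow> M \<in> lab L \<longleftrightarrow> M \<in> lines \<and> lab M = lab L"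
  unfolding canon_def by blast

lemma canon_partition:
  assumes "canon lab"
  shows "partition_on (Rset k l \<union> Cset k l) (lab ` lines)"
proof (rule partition_onI)
  have un: "Rset k l \<union> Cset k l = lines" by (simp add: lines_def R_def C_def)
  show "\<Union>(lab ` lines) = Rset k l \<union> Cset k l" unfolding un using canonD[OF assms] by blast
  show "disjnt b c" if "b \<in> lab ` lines" "c \<in> lab ` lines" "b \<noteq> c" for b c
    using that canonD[OF assms] unfolding disjnt_def by blast
  show "{} \<notin> lab ` lines"
    using canonD[OF assms] by blast
qed

lemma partition_canon:
  assumes "partition_on (Rset k l \<union> Cset k l) Q"
  shows "\<exists>lab. canon lab \<and> Q = lab ` lines"
proof -
  have un: "Rset k l \<union> Cset k l = lines" by (simp add: lines_def R_def C_def)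
  have ex: "\<exists>B\<in>Q. L \<in> B" if "L \<in> lines" for L
    using assms that unfolding un partition_on_def by blast
  have uniq: "B = B'" if "B \<in> Q" "B' \<in> Q" "L \<in> B" "L \<in> B'" for B B' L
    using assms that unfolding partition_on_def disjoint_def by blast
  have sub: "B \<subseteq> lines" "B \<noteq> {}" if "B \<in> Q" for B
    using assms that unfolding un partition_on_def by blast+
  obtain lab where lab: "\<And>L. L \<in> lines \<Longrightarrow> lab L \<in> Q" "\<And>L. L \<in> lines \<Longrightarrow> L \<in> lab L"
    using ex by metis
  have lab_eq: "lab M = B" if "B \<in> Q" "M \<in> B" for M B
    using uniq[OF lab(1) that(1) lab(2) that(2)] sub(1)[OF that(1)] that(2) by blast
  have "lab L = {M \<in> lines. lab M = lab L}" if "L \<in> lines" for L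
  proof (intro subset_antisym subsetI)
    fix M assume "M \<in> lab L"
    then show "M \<in> {M \<in> lines. lab M = lab L}"
      using lab_eq[OF lab(1)[OF that]] sub(1)[OF lab(1)[OF that]] by blast
  next
    fix M assume "M \<in> {M \<in> lines. lab M = lab L}"
    then show "M \<in> lab L" using lab(2) by force
  qed
  then have "canon lab" unfolding canon_def by blast
  moreover have "Q = lab ` lines"
  proof (intro subset_antisym subsetI)
    fix B assume B: "B \<in> Q"
    then obtain M where "M \<in> B" using sub(2) by blast
    then show "B \<in> lab ` lines" using lab_eq[OF B] sub(1)[OF B] by blast
  next
    fix B assume "B \<in> lab ` lines"
    then show "B \<in> Q" using lab(1) by blast
  qed
  ultimately show ?thesis by blast
qed

lemma admissible_big:
  assumes "admissible k l (lab ` lines)" "L \<in> lines" "2 \<le> card (lab L)"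
  shows "3 \<le> card (lab L \<inter> R)" "3 \<le> card (lab L \<inter> C)" "4 \<le> max (card (lab L \<inter> R)) (card (lab L \<inter> C))"
  using assms unfolding admissible_def R_def C_def by blast+

lemma admissible_not_all:
  assumes "canon lab" "admissible k l (lab ` lines)" "L \<in> lines" "M \<in> lines" "lab L \<noteq> lab M"
    and X: "X = R \<or> X = C" and N: "N \<in> lines"
  shows "\<exists>J\<in>X. lab J \<noteq> lab N"
proof (rule ccontr)
  assume "\<not> (\<exists>J\<in>X. lab J \<noteq> lab N)"
  then have sub: "X \<subseteq> lab N" using canonD[OF assms(1) N] X R_lines C_lines by blast
  have fin: "finite (lab N)" using canonD[OF assms(1) N] by (intro finite_subset[OF _ finite_lines]) blast
  have "3 \<le> card X" using X card_R card_C k3 l3 by auto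
  also have "\<dots> \<le> card (lab N)" by (rule card_mono[OF fin sub])
  finally have "2 \<le> card (lab N)" by simp
  moreover have "1 < card (lab ` lines)"
    using card_mono[of "lab ` lines" "{lab L, lab M}"] assms(3-5) by auto
  moreover have "lab N \<in> lab ` lines" using N by blast
  ultimately have "\<not> R \<subseteq> lab N \<and> \<not> C \<subseteq> lab N"
    using assms(2) unfolding admissible_def R_def C_def by blast
  then show False using sub X by blast
qed

lemma edge_loop_iff: "edge lab p = {a, b} \<Longrightarrow> lab (rl p) = lab (cl p) \<longleftrightarrow> a = b"
  unfolding edge_def doubleton_eq_iff by metis

text \<open>Treats rows and columns alike: the points of L are indexed by the lines X of the other
  direction, as edges leaving the block of L.\<close>

lemma transversal_points:
  assumes "L \<in> lines"
  shows "\<exists>X f. (X = R \<or> X = C) \<and> inj_on f X \<and>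
     (\<forall>J\<in>X. f J \<in> P \<and> f J \<in> L \<and> edge lab (f J) = {lab L, lab J})"
proof (cases "L \<in> R")
  case True
  obtain f where f: "\<And>J. J \<in> C \<Longrightarrow> f J \<in> P \<and> rl (f J) = L \<and> cl (f J) = J"
    using pt_exists[OF True] by metis
  then have "inj_on f C" by (metis inj_onI)
  moreover have "f J \<in> P \<and> f J \<in> L \<and> edge lab (f J) = {lab L, lab J}" if "J \<in> C" for J
    using f[OF that] mem_R[OF True] by (simp add: edge_def)
  ultimately show ?thesis by (intro exI[of _ C] exI[of _ f]) simp
next
  case False
  then have L: "L \<in> C" using assms by (simp add: lines_def)
  obtain f where f: "\<And>J. J \<in> R \<Longrightarrow> f J \<in> P \<and> rl (f J) = J \<and> cl (f J) = L"
    using pt_exists[OF _ L] by metis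
  then have "inj_on f R" by (metis inj_onI)
  moreover have "f J \<in> P \<and> f J \<in> L \<and> edge lab (f J) = {lab L, lab J}" if "J \<in> R" for J
    using f[OF that] mem_C[OF L] by (simp add: edge_def insert_commute)
  ultimately show ?thesis by (intro exI[of _ R] exI[of _ f]) simp
qed

text \<open>Two lines in different blocks span the whole space in a generic realization.\<close>

lemma different_blocks_indep3:
  assumes "canon lab" "admissible k l (lab ` lines)" "L \<in> lines" "M \<in> lines" "lab L \<noteq> lab M"
  shows "\<exists>p q s. p \<in> L \<and> q \<in> L \<and> s \<in> M \<and> indep3 lab p q s"
proof -
  note not_all = admissible_not_all[OF assms]
  obtain X f where X: "X = R \<or> X = C" "inj_on f X"
    and f: "\<And>J. J \<in> X \<Longrightarrow> f J \<in> P \<and> f J \<in> L \<and> edge lab (f J) = {lab L, lab J}"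
    using transversal_points[OF assms(3)] by metis
  have Xl: "J \<in> lines" if "J \<in> X" for J using X(1) that by auto
  \<comment> \<open>Two non-parallel points on L. If some transversal shares the block of L, its
    point is a loop and hence parallel to nothing; otherwise two transversals in different blocks
    give different edges.\<close>
  have "\<exists>J\<in>X. \<exists>J'\<in>X. f J \<noteq> f J' \<and> \<not> par lab (f J) (f J')"
  proof (cases "\<exists>J\<in>X. lab J = lab L")
    case True
    then obtain J where J: "J \<in> X" "lab J = lab L" by blast
    obtain J' where J': "J' \<in> X" "lab J' \<noteq> lab L" using not_all[OF X(1) assms(3)] by blast
    have "\<not> par lab (f J) (f J')"
      using f[OF J(1)] J(2) edge_loop_iff[of lab "f J" "lab L" "lab J"] by (simp add: par_def)
    moreover have "J \<noteq> J'" using J(2) J'(2) by auto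
    then have "f J \<noteq> f J'" using inj_on_eq_iff[OF X(2) J(1) J'(1)] by simp
    ultimately show ?thesis using J(1) J'(1) by blast
  next
    case False
    have "X \<noteq> {}" using X(1) card_R card_C k3 l3 by auto
    then obtain J where J: "J \<in> X" by blast
    obtain J' where J': "J' \<in> X" "lab J' \<noteq> lab J" using not_all[OF X(1) Xl[OF J]] by blast
    have "edge lab (f J) \<noteq> edge lab (f J')"
      using f[OF J] f[OF J'(1)] J'(2) False J' J by (simp add: doubleton_eq_iff)
    then show ?thesis using J J'(1) unfolding par_def by metis
  qed
  then obtain p q where pq: "p \<in> P" "q \<in> P" "p \<in> L" "q \<in> L" "p \<noteq> q" "\<not> par lab p q"
    "lab L \<in> edge lab p" "lab L \<in> edge lab q" using f by (metis insertI1)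
  obtain Y g where Y: "Y = R \<or> Y = C"
    and g: "\<And>J. J \<in> Y \<Longrightarrow> g J \<in> P \<and> g J \<in> M \<and> edge lab (g J) = {lab M, lab J}"
    using transversal_points[OF assms(4)] by metis
  obtain J where J: "J \<in> Y" "lab J \<noteq> lab L" using not_all[OF Y assms(3)] by blast
  have s: "lab L \<notin> edge lab (g J)" using g[OF J(1)] J(2) assms(5) by auto
  \<comment> \<open>A common vertex x of all three edges is not \<open>lab L\<close>, so both p and
    q would be the edge joining \<open>lab L\<close> and x, and they would be parallel.\<close>
  have "x \<notin> edge lab (g J)" if x: "x \<in> edge lab p" "x \<in> edge lab q" for x
  proof
    assume "x \<in> edge lab (g J)"
    then have "x \<noteq> lab L" using s by blast
    then have e: "edge lab p = {lab L, x}" "edge lab q = {lab L, x}"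
      using x pq(7,8) unfolding edge_def by (elim insertE emptyE; simp add: insert_commute)+
    then have "lab (rl p) \<noteq> lab (cl p)" using \<open>x \<noteq> lab L\<close> edge_loop_iff by metis
    then show False using e pq(5,6) by (simp add: par_def)
  qed
  moreover have "p \<noteq> g J" "q \<noteq> g J" "edge lab p \<noteq> edge lab (g J)" "edge lab q \<noteq> edge lab (g J)"
    using pq(7,8) s by auto
  ultimately have "indep3 lab p q (g J)"
    using pq(5,6) unfolding indep3_def par_def by auto
  then show ?thesis using pq g[OF J(1)] by blast
qed

lemma block_triple_gdep:
  assumes "canon lab" "L \<in> lines" "p \<in> \<Union>(lab L)" "q \<in> \<Union>(lab L)" "s \<in> \<Union>(lab L)" "distinct [p, q, s]"
  shows "gdep lab {p, q, s}"
proof -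
  have sub: "{p, q, s} \<subseteq> P" "{p, q, s} \<subseteq> \<Union>(lab L)"
    using mem_block[OF assms(1,2)] assms(3-5) by simp_all
  show ?thesis
  proof (cases "\<exists>T\<in>G_type1 (lab ` lines). T \<subseteq> {p, q, s}")
    case True
    then show ?thesis using gdepI[OF _ _ sub(1)] by blast
  next
    case False
    have "card {p, q, s} = 3" using assms(6) by simp
    then have "{p, q, s} \<in> G_type2 (lab ` lines)"
      using False sub(2) assms(2) unfolding G_type2_def by blast
    then show ?thesis using gdepI[OF _ _ sub(1)] by blast
  qed
qed

text \<open>Every block has a common normal because its triples are dependent. The point is that
  normals of different blocks are not parallel: otherwise the independent triple from
  \<open>different_blocks_indep3\<close> would lie in one plane. A point on two such blocks is then
  forced to be a multiple of the cross product.\<close>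

lemma realization_in_range_phi:
  assumes "canon lab" "admissible k l (lab ` lines)" and Y: "realization (k * l) (gdep lab) Y"
  shows "Y \<in> range (phi lab)"
proof -
  have amb: "Y \<in> ambient (k * l)" using Y by (simp add: realization_def)
  have dep: "col_dep Y S \<longleftrightarrow> gdep lab S" if "S \<subseteq> P" for S
    using Y that by (simp add: realization_def P_def)
  have "\<exists>w. vec3 w \<and> w \<noteq> (\<lambda>_. 0) \<and> (\<forall>p\<in>\<Union>b. dot w (col Y p) = 0)" if b: "b \<in> lab ` lines" for b
  proof -
    obtain L where L: "L \<in> lines" "b = lab L" using b by blast
    have "col_dep Y {p, q, s}" if "p \<in> \<Union>b" "q \<in> \<Union>b" "s \<in> \<Union>b" "distinct [p, q, s]" for p q s
      using block_triple_gdep[OF assms(1) L(1)] that dep[of "{p, q, s}"] mem_block[OF assms(1) L(1)]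
      unfolding L(2) by simp
    then show ?thesis by (rule common_normal)
  qed
  then have "\<forall>b\<in>lab ` lines. \<exists>w. vec3 w \<and> w \<noteq> (\<lambda>_. 0) \<and> (\<forall>p\<in>\<Union>b. dot w (col Y p) = 0)" by blast
  from bchoice[OF this] obtain w where w: "\<And>L. L \<in> lines \<Longrightarrow> vec3 (w (lab L))"
      "\<And>L. L \<in> lines \<Longrightarrow> w (lab L) \<noteq> (\<lambda>_. 0)"
      "\<And>L p. L \<in> lines \<Longrightarrow> p \<in> \<Union>(lab L) \<Longrightarrow> dot (w (lab L)) (col Y p) = 0"
    by (metis (no_types, lifting) imageI)
  have self: "p \<in> \<Union>(lab L)" if "L \<in> lines" "p \<in> L" for L p
    using canonD[OF assms(1) that(1)] that by blast
  show ?thesis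
  proof (rule range_phiI[where w = "\<lambda>L. w (lab L)", OF amb])
    show "w (lab L) = w (lab M)" if "lab L = lab M" for L M using that by simp
  next
    fix p assume p: "p \<in> P"
    have lp: "rl p \<in> lines" "cl p \<in> lines" "p \<in> rl p" "p \<in> cl p" using p mem_line by auto
    show "\<exists>v. col Y p = cross (w (lab (rl p))) v"
      using perp_imp_cross[OF vec3_col[OF amb] w(1)[OF lp(1)] w(3)[OF lp(1) self[OF lp(1,3)]] w(2)[OF lp(1)]] .
    assume "lab (rl p) \<noteq> lab (cl p)"
    then obtain a b c where abc: "a \<in> rl p" "b \<in> rl p" "c \<in> cl p" "indep3 lab a b c"
      using different_blocks_indep3[OF assms(1,2) lp(1,2)] by blast
    have abcP: "a \<in> P" "b \<in> P" "c \<in> P" using abc lp(1,2) line_subset_P by blast+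
    have ndep: "\<not> col_dep Y {a, b, c}"
      using indep3_not_gdep[OF assms(1) abc(4) abcP] dep[of "{a, b, c}"] abcP by simp
    have "cross (w (lab (rl p))) (w (lab (cl p))) \<noteq> (\<lambda>_. 0)"
    proof
      assume z: "cross (w (lab (rl p))) (w (lab (cl p))) = (\<lambda>_. 0)"
      obtain r where r: "r < 3" "w (lab (cl p)) r \<noteq> 0"
        using w(1)[OF lp(2)] w(2)[OF lp(2)] vec3_eqI[of "w (lab (cl p))" "\<lambda>_. 0"]
        by (auto simp: vec3_def less_3_cases)
      have dc: "dot a b = dot b a" for a b by (simp add: dot_def mult.commute)
      have "w (lab (cl p)) r * dot (w (lab (rl p))) (col Y c) = w (lab (rl p)) r * dot (w (lab (cl p))) (col Y c)"
        using cross_eq_0_dot[OF z r(1), of "col Y c"] dc by simp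
      then have "dot (w (lab (rl p))) (col Y c) = 0"
        using r(2) w(3)[OF lp(2) self[OF lp(2) abc(3)]] by simp
      then have "det3 (col Y a) (col Y b) (col Y c) = 0"
        using det3_perp[OF w(1)[OF lp(1)] w(2)[OF lp(1)] w(3)[OF lp(1) self[OF lp(1) abc(1)]]
          w(3)[OF lp(1) self[OF lp(1) abc(2)]]] by blast
      then show False using ndep det3_eq_0_col_dep abc(4) unfolding indep3_def by blast
    qed
    then show "\<exists>c. col Y p = (\<lambda>r. c * cross (w (lab (rl p))) (w (lab (cl p))) r)"
      using perp_both_imp_multiple_cross[OF vec3_col[OF amb] w(3)[OF lp(1) self[OF lp(1,3)]]
         w(3)[OF lp(2) self[OF lp(2,4)]]] by blast
  qed
qed

lemma matroid_variety_eq: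
  assumes "canon lab" "admissible k l (lab ` lines)"
  shows "matroid_variety (k * l) (gdep lab) = zariski_closure (k * l) (range (phi lab))"
proof
  have "{Y. realization (k * l) (gdep lab) Y} \<subseteq> range (phi lab)"
    using realization_in_range_phi[OF assms] by blast
  then show "matroid_variety (k * l) (gdep lab) \<subseteq> zariski_closure (k * l) (range (phi lab))"
    unfolding matroid_variety_def by (rule zariski_closure_mono)
  have "{Y. realization (k * l) (gdep lab) Y} \<subseteq> ambient (k * l)" by (auto simp: realization_def)
  then show "zariski_closure (k * l) (range (phi lab)) \<subseteq> matroid_variety (k * l) (gdep lab)"
    using zariski_closure_minimal[OF _ range_phi_closure_realizations[OF assms(1)]]
      zariski_closed_closure unfolding matroid_variety_def by blast
qed

lemma irreducible_matroid_variety: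
  assumes "canon lab" "admissible k l (lab ` lines)"
  shows "zariski_irreducible (k * l) (matroid_variety (k * l) (gdep lab))"
  unfolding matroid_variety_eq[OF assms]
  by (rule zariski_irreducible_range[OF range_phi_ambient phi_pf])

section \<open>Matroid varieties lie in \<open>V_Delta\<close>\<close>

lemma V_Delta_closed: "zariski_closed (k * l) (V_Delta k l)"
proof -
  let ?D = "{d. \<exists>p q s. d = (\<lambda>Y. det3 (col Y p) (col Y q) (col Y s)) \<and> distinct [p, q, s] \<and> {p, q, s} \<in> Delta k l}"
  have "F \<subseteq> P" if "F \<in> Delta k l" for F using Delta_line[OF that] line_subset_P by blast
  then have "?D \<subseteq> polyfun (k * l)"
    using polyfun_det3[of _ "k * l"] unfolding P_def by fastforce
  moreover have "V_Delta k l = {Y \<in> ambient (k * l). \<forall>d\<in>?D. d Y = 0}"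
  proof -
    have "(\<forall>F\<in>Delta k l. col_dep Y F) \<longleftrightarrow> (\<forall>d\<in>?D. d Y = 0)" for Y
    proof
      assume "\<forall>F\<in>Delta k l. col_dep Y F"
      then show "\<forall>d\<in>?D. d Y = 0" using col_dep_det3_eq_0 by blast
    next
      assume d: "\<forall>d\<in>?D. d Y = 0"
      show "\<forall>F\<in>Delta k l. col_dep Y F"
      proof
        fix F assume F: "F \<in> Delta k l"
        then obtain p q s where pqs: "F = {p, q, s}" "distinct [p, q, s]"
          by (auto simp: Delta_def card_Suc_eq numeral_eq_Suc)
        then have "(\<lambda>Y. det3 (col Y p) (col Y q) (col Y s)) \<in> ?D"
          using F by (intro CollectI exI[of _ p] exI[of _ q] exI[of _ s]) simp
        from bspec[OF d this] have "det3 (col Y p) (col Y q) (col Y s) = 0" .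
        then show "col_dep Y F" using det3_eq_0_col_dep[OF pqs(2)] pqs(1) by simp
      qed
    qed
    then show ?thesis unfolding V_Delta_def by (simp only:)
  qed
  ultimately show ?thesis unfolding zariski_closed_def by (intro exI[of _ ?D] conjI)
qed

lemma matroid_variety_subset_V_Delta:
  assumes "canon lab"
  shows "matroid_variety (k * l) (gdep lab) \<subseteq> V_Delta k l"
  unfolding matroid_variety_def
proof (rule zariski_closure_minimal[OF V_Delta_closed], safe)
  fix Y assume Y: "realization (k * l) (gdep lab) Y"
  have "col_dep Y F" if F: "F \<in> Delta k l" for F
  proof -
    obtain L where L: "L \<in> lines" "F \<subseteq> L" using Delta_line[OF F] by blast
    obtain p q s where pqs: "F = {p, q, s}" "distinct [p, q, s]"
      using F by (auto simp: Delta_def card_Suc_eq numeral_eq_Suc)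
    have "F \<subseteq> \<Union>(lab L)" using canonD[OF assms L(1)] L by blast
    then have "gdep lab F" unfolding pqs(1) using block_triple_gdep[OF assms L(1) _ _ _ pqs(2)] by simp
    moreover have "F \<subseteq> {1..k * l}" using line_subset_P L unfolding P_def by blast
    ultimately show ?thesis using Y by (simp add: realization_def)
  qed
  then show "Y \<in> V_Delta k l" using Y by (simp add: V_Delta_def realization_def)
qed

end

section \<open>The obstruction of a three by four grid\<close>

text \<open>Once a normal is scaled to have coordinate 0 equal to 1, only coordinates 1 and 2 vary.
  \<open>br\<close> and \<open>dot2\<close> are the determinant and the product in these two
  coordinates.\<close>

definition br :: "(nat \<Rightarrow> complex) \<Rightarrow> (nat \<Rightarrow> complex) \<Rightarrow> complex" where
  "br u v = u 1 * v 2 - u 2 * v 1"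

definition dot2 :: "(nat \<Rightarrow> complex) \<Rightarrow> (nat \<Rightarrow> complex) \<Rightarrow> complex" where
  "dot2 u v = u 1 * v 1 + u 2 * v 2"

definition dot4 :: "(nat \<Rightarrow> complex) \<Rightarrow> (nat \<Rightarrow> complex) \<Rightarrow> complex" where
  "dot4 u v = u 0 * v 0 + u 1 * v 1 + u 2 * v 2 + u 3 * v 3"

definition minor :: "(nat \<Rightarrow> complex) \<Rightarrow> (nat \<Rightarrow> complex) \<Rightarrow> (nat \<Rightarrow> complex) \<Rightarrow> nat \<Rightarrow> nat \<Rightarrow> nat \<Rightarrow> complex" where
  "minor b c d i j k = b i * (c j * d k - c k * d j) - b j * (c i * d k - c k * d i)
     + b k * (c i * d j - c j * d i)"

text \<open>The signed maximal minors of the 3 x 4 matrix with rows b, c, d, a cross product in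
  four-space; \<open>dot4 a (cof b c d)\<close> is the determinant with rows a, b, c, d.\<close>

definition cof :: "(nat \<Rightarrow> complex) \<Rightarrow> (nat \<Rightarrow> complex) \<Rightarrow> (nat \<Rightarrow> complex) \<Rightarrow> nat \<Rightarrow> complex" where
  "cof b c d r = (if r = 0 then minor b c d 1 2 3 else if r = 1 then - minor b c d 0 2 3
     else if r = 2 then minor b c d 0 1 3 else - minor b c d 0 1 2)"

lemma dot4_cof: "dot4 b (cof b c d) = 0" "dot4 c (cof b c d) = 0" "dot4 d (cof b c d) = 0"
  by (simp_all add: dot4_def cof_def minor_def algebra_simps)

lemma less_4_cases: "(j::nat) < 4 \<longleftrightarrow> j = 0 \<or> j = 1 \<or> j = 2 \<or> j = 3"
  by auto

text \<open>The 2 x 2 minors in the indices s and t combine the three equations so that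
  \<open>u s\<close> and \<open>u t\<close> cancel.\<close>

lemma minor_relation:
  assumes "b i * u i + b j * u j + b s * u s + b t * u t = (0::complex)"
    "c i * u i + c j * u j + c s * u s + c t * u t = 0"
    "d i * u i + d j * u j + d s * u s + d t * u t = 0"
  shows "u i * minor b c d i s t + u j * minor b c d j s t = 0"
proof -
  have "u i * minor b c d i s t + u j * minor b c d j s t =
      (b i * u i + b j * u j + b s * u s + b t * u t) * (c s * d t - c t * d s)
    - (c i * u i + c j * u j + c s * u s + c t * u t) * (b s * d t - b t * d s)
    + (d i * u i + d j * u j + d s * u s + d t * u t) * (b s * c t - b t * c s)"
    by (simp add: minor_def algebra_simps)
  then show ?thesis using assms by simp
qed

text \<open>Orthogonality to b, c, d makes u parallel to m = \<open>cof b c d\<close>. Hence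
  \<open>u r * dot4 a m = m r * dot4 a u = 0\<close>, with a nonzero factor.\<close>

lemma dot4_eq_0_imp_zero:
  assumes "dot4 a u = 0" "dot4 b u = 0" "dot4 c u = 0" "dot4 d u = 0" "dot4 a (cof b c d) \<noteq> 0" "r < 4"
  shows "u r = 0"
proof -
  note e = assms(2-4)[unfolded dot4_def]
  have m: "u 0 * minor b c d 0 2 3 + u 1 * minor b c d 1 2 3 = 0"
    "u 0 * minor b c d 0 1 3 + u 2 * minor b c d 2 1 3 = 0"
    "u 0 * minor b c d 0 1 2 + u 3 * minor b c d 3 1 2 = 0"
    "u 1 * minor b c d 1 0 3 + u 2 * minor b c d 2 0 3 = 0"
    "u 1 * minor b c d 1 0 2 + u 3 * minor b c d 3 0 2 = 0"
    "u 2 * minor b c d 2 0 1 + u 3 * minor b c d 3 0 1 = 0"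
    by (rule minor_relation; use e in \<open>simp add: algebra_simps\<close>)+
  have s: "minor b c d 2 1 3 = - minor b c d 1 2 3" "minor b c d 3 1 2 = minor b c d 1 2 3"
    "minor b c d 1 0 3 = - minor b c d 0 1 3" "minor b c d 2 0 3 = - minor b c d 0 2 3"
    "minor b c d 1 0 2 = - minor b c d 0 1 2" "minor b c d 3 0 2 = minor b c d 0 2 3"
    "minor b c d 2 0 1 = minor b c d 0 1 2" "minor b c d 3 0 1 = minor b c d 0 1 3"
    by (simp_all add: minor_def algebra_simps)
  let ?m = "cof b c d"
  have c: "?m 0 = minor b c d 1 2 3" "?m 1 = - minor b c d 0 2 3" "?m 2 = minor b c d 0 1 3"
    "?m 3 = - minor b c d 0 1 2"
    by (simp_all add: cof_def)
  have p: "u 0 * ?m 1 = u 1 * ?m 0" "u 0 * ?m 2 = u 2 * ?m 0" "u 0 * ?m 3 = u 3 * ?m 0"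
    "u 1 * ?m 2 = u 2 * ?m 1" "u 1 * ?m 3 = u 3 * ?m 1" "u 2 * ?m 3 = u 3 * ?m 2"
    unfolding c using m[unfolded s] by algebra+
  have "u 0 * dot4 a ?m = ?m 0 * dot4 a u" "u 1 * dot4 a ?m = ?m 1 * dot4 a u"
    "u 2 * dot4 a ?m = ?m 2 * dot4 a u" "u 3 * dot4 a ?m = ?m 3 * dot4 a u"
    unfolding dot4_def using p by algebra+
  then have "u 0 = 0" "u 1 = 0" "u 2 = 0" "u 3 = 0" using assms(1,5) by simp_all
  then show ?thesis using assms(6) less_4_cases[of r] by metis
qed

text \<open>The linear condition on \<open>(x\<^sub>2 - x\<^sub>1, x\<^sub>3 - x\<^sub>1)\<close> left over after eliminating \<open>y\<close> from
  \<open>(x\<^sub>i - y) \<bullet> q\<^sub>i = 0\<close>.\<close>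

definition row4 :: "(nat \<Rightarrow> complex) \<Rightarrow> (nat \<Rightarrow> complex) \<Rightarrow> (nat \<Rightarrow> complex) \<Rightarrow> nat \<Rightarrow> complex" where
  "row4 q1 q2 q3 r = (if r = 0 then br q1 q3 * q2 1 else if r = 1 then br q1 q3 * q2 2
     else if r = 2 then - (br q1 q2 * q3 1) else - (br q1 q2 * q3 2))"

lemma dot4_row4: "dot4 (row4 q1 q2 q3) u =
   br q1 q3 * (u 0 * q2 1 + u 1 * q2 2) - br q1 q2 * (u 2 * q3 1 + u 3 * q3 2)"
  by (simp add: dot4_def row4_def algebra_simps)

text \<open>Three vectors of the plane satisfy \<open>br q2 q3\<close> q1 - \<open>br q1 q3\<close>
  q2 + \<open>br q1 q2\<close> q3 = 0. Pairing this with y - x1 leaves only the differences x2 - x1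
  and x3 - x1.\<close>

lemma row4_elimination:
  assumes "dot2 x1 q1 = dot2 y q1" "dot2 x2 q2 = dot2 y q2" "dot2 x3 q3 = dot2 y q3"
  shows "dot4 (row4 q1 q2 q3) (\<lambda>r. if r = 0 then x2 1 - x1 1 else if r = 1 then x2 2 - x1 2
     else if r = 2 then x3 1 - x1 1 else x3 2 - x1 2) = 0"
  using assms unfolding dot4_row4 dot2_def br_def by simp algebra

text \<open>The 4 x 4 determinant of the conditions coming from the four columns of the grid. The
  bracket factors make the first two points of each column independent, so that \<open>y j\<close>
  is determined as well.\<close>

definition obstr :: "(nat \<Rightarrow> nat \<Rightarrow> nat \<Rightarrow> complex) \<Rightarrow> complex" where
  "obstr q = dot4 (row4 (q 0 3) (q 1 3) (q 2 3)) (cof (row4 (q 0 0) (q 1 0) (q 2 0))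
      (row4 (q 0 1) (q 1 1) (q 2 1)) (row4 (q 0 2) (q 1 2) (q 2 2))) *
    (br (q 0 0) (q 1 0) * br (q 0 1) (q 1 1) * br (q 0 2) (q 1 2) * br (q 0 3) (q 1 3))"

text \<open>Four independent conditions kill the four unknown differences of the x. Then y j - x 0
  is orthogonal to two independent plane vectors.\<close>

lemma obstr_rigid:
  assumes rel: "\<forall>i<3. \<forall>j<4. dot2 (x i) (q i j) = dot2 (y j) (q i j)" and nz: "obstr q \<noteq> 0"
  shows "i < 3 \<Longrightarrow> x i 1 = x 0 1 \<and> x i 2 = x 0 2" "j < 4 \<Longrightarrow> y j 1 = x 0 1 \<and> y j 2 = x 0 2"
proof -
  let ?u = "\<lambda>r::nat. if r = 0 then x 1 1 - x 0 1 else if r = 1 then x 1 2 - x 0 2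
     else if r = 2 then x 2 1 - x 0 1 else x 2 2 - x 0 2"
  have row: "dot4 (row4 (q 0 j) (q 1 j) (q 2 j)) ?u = 0" if "j < 4" for j
    by (rule row4_elimination) (use rel that in auto)
  have "?u r = 0" if "r < 4" for r
    by (rule dot4_eq_0_imp_zero[OF row[of 3] row[of 0] row[of 1] row[of 2] _ that])
      (use nz in \<open>auto simp: obstr_def\<close>)
  from this[of 0] this[of 1] this[of 2] this[of 3]
  have x: "x 1 1 = x 0 1" "x 1 2 = x 0 2" "x 2 1 = x 0 1" "x 2 2 = x 0 2" by simp_all
  show "i < 3 \<Longrightarrow> x i 1 = x 0 1 \<and> x i 2 = x 0 2" using x unfolding less_3_cases by auto
  assume j: "j < 4"
  have b: "br (q 0 j) (q 1 j) \<noteq> 0" using nz j unfolding less_4_cases obstr_def by auto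
  have e: "dot2 (x 0) (q 0 j) = dot2 (y j) (q 0 j)" "dot2 (x 0) (q 1 j) = dot2 (y j) (q 1 j)"
    using rel[rule_format, of 0 j] rel[rule_format, of 1 j] j x by (auto simp: dot2_def)
  then have "(y j 1 - x 0 1) * br (q 0 j) (q 1 j) = 0" "(y j 2 - x 0 2) * br (q 0 j) (q 1 j) = 0"
    unfolding dot2_def br_def by algebra+
  then show "y j 1 = x 0 1 \<and> y j 2 = x 0 2" using b by simp
qed

text \<open>A numerical \<open>3 \<times> 4\<close> configuration, found by computer search, on which the obstruction does not
  vanish and whose first three columns are generic enough for the splitting of a \<open>3 \<times> 3\<close> block.\<close>

definition sample :: "nat \<Rightarrow> nat \<Rightarrow> complex" where
  "sample i j = [[0, 1, 0, 0], [1, 0, -1, -1], [-1, 2, 1, -1]] ! i ! j"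

definition sample_vec :: "nat \<Rightarrow> nat \<Rightarrow> nat \<Rightarrow> complex" where
  "sample_vec i j r = (if r = 1 then 1 else if r = 2 then sample i j else 0)"

lemma sample_row4:
  "row4 (sample_vec 0 0) (sample_vec 1 0) (sample_vec 2 0) = (\<lambda>r. if r < 3 then -1 else 1)"
  "row4 (sample_vec 0 1) (sample_vec 1 1) (sample_vec 2 1) = (\<lambda>r. if r = 0 then 1 else if r = 1 then 0 else if r = 2 then 1 else 2)"
  "row4 (sample_vec 0 2) (sample_vec 1 2) (sample_vec 2 2) = (\<lambda>r. if r = 1 then -1 else 1)"
  "row4 (sample_vec 0 3) (sample_vec 1 3) (sample_vec 2 3) = (\<lambda>r. if r = 1 \<or> r = 2 then 1 else -1)"
  by (auto simp: fun_eq_iff row4_def sample_vec_def sample_def br_def less_3_cases)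

lemma sample_cof:
  "cof (row4 (sample_vec 0 0) (sample_vec 1 0) (sample_vec 2 0))
      (row4 (sample_vec 0 1) (sample_vec 1 1) (sample_vec 2 1)) (row4 (sample_vec 0 2) (sample_vec 1 2) (sample_vec 2 2)) =
    (\<lambda>r. if r = 0 then 4 else if r = 2 then -4 else 0)"
  unfolding sample_row4 by (auto simp: fun_eq_iff cof_def minor_def)

text \<open>The 4 x 4 determinant is -8 and the brackets have product -1.\<close>

lemma obstr_sample: "obstr sample_vec \<noteq> 0"
  unfolding obstr_def sample_cof unfolding sample_row4
  by (simp add: dot4_def br_def sample_vec_def sample_def)

lemma polyfun_col: "r < 3 \<Longrightarrow> p \<in> {1..n} \<Longrightarrow> (\<lambda>Y. col Y p r) \<in> polyfun n"
  unfolding col_def by (rule pvar)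

lemma polyfun_uminus: "p \<in> polyfun n \<Longrightarrow> (\<lambda>Y. - p Y) \<in> polyfun n"
  using pmult[OF pconst[of "-1"]] by simp

lemma polyfun_br:
  assumes "p \<in> {1..n}" "q \<in> {1..n}"
  shows "(\<lambda>Y. br (col Y p) (col Y q)) \<in> polyfun n"
  unfolding br_def by (intro polyfun_diff pmult polyfun_col assms) simp_all

lemma polyfun_row4:
  assumes "p \<in> {1..n}" "q \<in> {1..n}" "s \<in> {1..n}"
  shows "(\<lambda>Y. row4 (col Y p) (col Y q) (col Y s) r) \<in> polyfun n"
  unfolding row4_def by (cases "r = 0"; cases "r = 1"; cases "r = 2")
    (use assms in \<open>simp_all add: pmult polyfun_uminus polyfun_br polyfun_col\<close>)

lemma polyfun_cof:
  assumes "\<And>r. (\<lambda>Y. b Y r) \<in> polyfun n" "\<And>r. (\<lambda>Y. c Y r) \<in> polyfun n" "\<And>r. (\<lambda>Y. d Y r) \<in> polyfun n"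
  shows "(\<lambda>Y. cof (b Y) (c Y) (d Y) r) \<in> polyfun n"
proof -
  have m: "(\<lambda>Y. minor (b Y) (c Y) (d Y) i j k) \<in> polyfun n" for i j k
    unfolding minor_def by (intro padd polyfun_diff pmult assms)
  show ?thesis
    unfolding cof_def by (cases "r = 0"; cases "r = 1"; cases "r = 2") (simp_all add: m polyfun_uminus)
qed

lemma polyfun_obstr:
  assumes "\<And>i j. i < 3 \<Longrightarrow> j < 4 \<Longrightarrow> f i j \<in> {1..n}"
  shows "(\<lambda>Y. obstr (\<lambda>i j. col Y (f i j))) \<in> polyfun n"
  unfolding obstr_def dot4_def
  by (intro pmult padd polyfun_row4 polyfun_cof polyfun_br assms) simp_all

section \<open>Irredundancy\<close>

lemma obstr_cong:
  assumes "\<And>i j. i < 3 \<Longrightarrow> j < 4 \<Longrightarrow> q i j = q' i j"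
  shows "obstr q = obstr q'"
  by (simp add: obstr_def assms)

context grid
begin

text \<open>Lets an argument about the two directions be written once, with either of them in the
  distinguished role.\<close>

definition opp :: "nat set set \<Rightarrow> nat set set \<Rightarrow> bool" where
  "opp S T \<longleftrightarrow> (S = R \<and> T = C) \<or> (S = C \<and> T = R)"

lemma opp_meet:
  assumes "opp S T"
  shows "\<exists>f. (\<forall>X\<in>S. \<forall>J\<in>T. f X J \<in> P \<and> {rl (f X J), cl (f X J)} = {X, J}) \<and>
    inj_on (\<lambda>(X, J). f X J) (S \<times> T) \<and> (\<forall>p\<in>P. \<exists>X\<in>S. \<exists>J\<in>T. p = f X J)"
proof -
  have dis: "S \<inter> T = {}" using assms R_C_disjoint unfolding opp_def by blast
  have "\<forall>X\<in>S. \<forall>J\<in>T. \<exists>p. p \<in> P \<and> {rl p, cl p} = {X, J}"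
  proof (intro ballI)
    fix X J assume XJ: "X \<in> S" "J \<in> T"
    show "\<exists>p. p \<in> P \<and> {rl p, cl p} = {X, J}"
    proof (cases "S = R \<and> T = C")
      case True
      then obtain p where "p \<in> P" "rl p = X" "cl p = J" using pt_exists XJ by blast
      then show ?thesis by blast
    next
      case False
      then obtain p where "p \<in> P" "rl p = J" "cl p = X" using pt_exists XJ assms unfolding opp_def by blast
      then show ?thesis by (intro exI[of _ p]) (simp add: insert_commute)
    qed
  qed
  then obtain f where f: "\<And>X J. X \<in> S \<Longrightarrow> J \<in> T \<Longrightarrow> f X J \<in> P \<and> {rl (f X J), cl (f X J)} = {X, J}"
    by metis
  have "inj_on (\<lambda>(X, J). f X J) (S \<times> T)"
  proof (rule inj_onI)
    fix a b assume a: "a \<in> S \<times> T" "b \<in> S \<times> T" "(\<lambda>(X, J). f X J) a = (\<lambda>(X, J). f X J) b"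
    obtain X J X' J' where ab: "a = (X, J)" "b = (X', J')" by (metis surj_pair)
    then have S: "X \<in> S" "J \<in> T" "X' \<in> S" "J' \<in> T" and e: "f X J = f X' J'" using a by simp_all
    have "{X, J} = {X', J'}" using f[OF S(1,2)] f[OF S(3,4)] e by simp
    then show "a = b" using dis S unfolding doubleton_eq_iff ab by blast
  qed
  moreover have "\<exists>X\<in>S. \<exists>J\<in>T. p = f X J" if p: "p \<in> P" for p
  proof -
    obtain X J where XJ: "X \<in> S" "J \<in> T" "{rl p, cl p} = {X, J}"
      using assms rl_in[of p] cl_in[OF p] unfolding opp_def by (metis insert_commute)
    have "{rl (f X J), cl (f X J)} = {rl p, cl p}" using f[OF XJ(1,2)] XJ(3) by simp
    then have "rl (f X J) = rl p" "cl (f X J) = cl p"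
      using R_C_disjoint rl_in[of p] rl_in[of "f X J"] cl_in[OF p] unfolding doubleton_eq_iff by (metis disjoint_iff)+
    then have "p = f X J" using pt_unique[OF p] f[OF XJ(1,2)] by simp
    then show ?thesis using XJ(1,2) by blast
  qed
  ultimately show ?thesis using f by (intro exI[of _ f]) simp
qed

lemma phi_perp_line:
  assumes "{rl p, cl p} = {X, J}" "p \<in> P"
  shows "dot (W \<theta> (lab X)) (col (phi lab \<theta>) p) = 0" "dot (W \<theta> (lab J)) (col (phi lab \<theta>) p) = 0"
  using phi_perp[OF assms(2)] assms(1) unfolding doubleton_eq_iff by metis+

text \<open>The normalised normals w / w_0 of the two lines through a point q both satisfy
  \<open>dot2\<close> x q = - q_0, so they solve the system of \<open>obstr_rigid\<close>. A nonzero
  obstruction would force all of them to agree in coordinate 1, while two different blocks have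
  independent normals; \<open>?d\<close> expresses that U and V differ there. Density covers the
  remaining parameters.\<close>

lemma obstr_vanishes:
  fixes xs js :: "nat \<Rightarrow> nat set" and f :: "nat \<Rightarrow> nat \<Rightarrow> nat"
  assumes f: "\<And>i j. i < 3 \<Longrightarrow> j < 4 \<Longrightarrow> f i j \<in> P \<and> {rl (f i j), cl (f i j)} = {xs i, js j}"
    and UV: "U \<in> xs ` {..<3} \<union> js ` {..<4}" "V \<in> xs ` {..<3} \<union> js ` {..<4}" "lab U \<noteq> lab V"
  shows "obstr (\<lambda>i j. col (phi lab \<theta>) (f i j)) = 0"
proof -
  let ?E = "xs ` {..<3} \<union> js ` {..<4}"
  let ?g = "\<lambda>X (\<theta> :: (nat set set \<times> nat) + (nat \<times> nat) \<Rightarrow> complex). W \<theta> (lab X) 0"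
  let ?d = "\<lambda>\<theta>. W \<theta> (lab U) 1 * W \<theta> (lab V) 0 - W \<theta> (lab V) 1 * W \<theta> (lab U) 0"
  let ?X = "insert ?d (?g ` ?E)"
  show ?thesis
  proof (rule pf_vanish_generic[where f = "\<lambda>\<theta>. obstr (\<lambda>i j. col (phi lab \<theta>) (f i j))" and X = ?X and g = "\<lambda>x. x"])
    show "(\<lambda>\<theta>. obstr (\<lambda>i j. col (phi lab \<theta>) (f i j))) \<in> pf"
      by (rule polyfun_comp_pf[OF polyfun_obstr[of f "k * l"] phi_pf]) (use f in \<open>simp add: P_def\<close>)
    show "finite ?X" by simp
    show "x \<in> pf" if "x \<in> ?X" for x
      using that by (elim insertE imageE; simp only:) (intro pf_diff pf_mult pf_W)+
    show "\<exists>\<theta>. x \<theta> \<noteq> 0" if x: "x \<in> ?X" for x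
    proof -
      \<comment> \<open>The normal (1, 1, 1) for the block of U and (1, 0, 0) for all others serve
        every condition at once.\<close>
      define \<theta> :: "(nat set set \<times> nat) + (nat \<times> nat) \<Rightarrow> complex" where
        "\<theta> y = (case y of Inl (b, r) \<Rightarrow> if r = 0 \<or> b = lab U then 1 else 0 | Inr _ \<Rightarrow> 0)" for y
      have "W \<theta> b 0 = 1" "W \<theta> (lab U) 1 = 1" "W \<theta> (lab V) 1 = 0" for b
        using UV(3) by (auto simp: W_def \<theta>_def)
      then have "x \<theta> \<noteq> 0" using x by auto
      then show ?thesis by blast
    qed
    fix \<theta> assume nz: "\<forall>x\<in>?X. x \<theta> \<noteq> 0"
    have w0: "W \<theta> (lab X) 0 \<noteq> 0" if "X \<in> ?E" for X using nz that by auto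
    show "obstr (\<lambda>i j. col (phi lab \<theta>) (f i j)) = 0"
    proof (rule ccontr)
      assume ob: "obstr (\<lambda>i j. col (phi lab \<theta>) (f i j)) \<noteq> 0"
      define x where "x X = (\<lambda>r. W \<theta> (lab X) r / W \<theta> (lab X) 0)" for X
      define q where "q i j = col (phi lab \<theta>) (f i j)" for i j
      have d2: "dot2 (x X) q = - q 0" if "X \<in> ?E" "dot (W \<theta> (lab X)) q = 0" for X q
      proof -
        have "W \<theta> (lab X) 1 * q 1 + W \<theta> (lab X) 2 * q 2 = - (W \<theta> (lab X) 0 * q 0)"
          using that(2) unfolding dot_def by algebra
        then show ?thesis using w0[OF that(1)] unfolding dot2_def x_def by (simp add: field_simps)
      qed
      have rel: "dot2 (x (xs i)) (q i j) = dot2 (x (js j)) (q i j)"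
        if "i < 3" "j < 4" for i j
      proof -
        have e: "xs i \<in> ?E" "js j \<in> ?E" and fp: "f i j \<in> P" "{rl (f i j), cl (f i j)} = {xs i, js j}"
          using that f[OF that] by simp_all
        have "dot (W \<theta> (lab (xs i))) (col (phi lab \<theta>) (f i j)) = 0"
          "dot (W \<theta> (lab (js j))) (col (phi lab \<theta>) (f i j)) = 0"
          by (rule phi_perp_line[OF fp(2,1)])+
        from d2[OF e(1) this(1)] d2[OF e(2) this(2)] show ?thesis by (simp add: q_def)
      qed
      have "obstr q \<noteq> 0" using ob by (simp add: q_def[abs_def])
      moreover have "\<forall>i<3. \<forall>j<4. dot2 (x (xs i)) (q i j) = dot2 (x (js j)) (q i j)" using rel by blast
      ultimately have "\<forall>i<3. x (xs i) 1 = x (xs 0) 1" "\<forall>j<4. x (js j) 1 = x (xs 0) 1"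
        using obstr_rigid[where x = "\<lambda>i. x (xs i)" and q = q and y = "\<lambda>j. x (js j)"] by blast+
      then have "x X 1 = x (xs 0) 1" if "X \<in> ?E" for X
        using that by blast
      from this[OF UV(1)] this[OF UV(2)] have "x U 1 = x V 1" by simp
      then have "?d \<theta> = 0" using w0[OF UV(1)] w0[OF UV(2)] unfolding x_def by (simp add: field_simps)
      then show False using bspec[OF nz insertI1] by simp
    qed
  qed
qed

text \<open>For the normal w = (1, 0, 0) one has w x v = (0, -v_2, v_1), so the free vectors of
  loops produce any columns (0, 1, s p). This one family yields the witnesses for all conditions on
  points inside blocks.\<close>

lemma prescribed_loops:
  "\<exists>\<theta>. (\<forall>b. W \<theta> b 0 = 1) \<and> (\<forall>p\<in>P. lab (rl p) = lab (cl p) \<longrightarrow>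
     col (phi lab \<theta>) p = (\<lambda>r. if r = 1 then 1 else if r = 2 then s p else 0))"
proof -
  define \<theta> :: "(nat set set \<times> nat) + (nat \<times> nat) \<Rightarrow> complex" where
    "\<theta> y = (case y of Inl (b, r) \<Rightarrow> if r = 0 then 1 else 0
       | Inr (p, r) \<Rightarrow> if r = 1 then s p else if r = 2 then -1 else 1)" for y
  have "col (phi lab \<theta>) p = (\<lambda>r. if r = 1 then 1 else if r = 2 then s p else 0)"
    if "p \<in> P" "lab (rl p) = lab (cl p)" for p
    by (rule vec3_eqI[OF vec3_col[OF phi_ambient]])
      (use that in \<open>simp_all add: vec3_def col_phi W_def Z_def \<theta>_def\<close>)
  then show ?thesis by (intro exI[of _ \<theta>]) (simp add: W_def \<theta>_def)
qed

lemma inj_on_extend: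
  assumes "inj_on (\<lambda>(i, j). f i j) (I \<times> J)"
  shows "\<exists>s. \<forall>i\<in>I. \<forall>j\<in>J. s (f i j) = g i j"
proof -
  have "(\<lambda>(i, j). g i j) (inv_into (I \<times> J) (\<lambda>(i, j). f i j) (f i j)) = g i j" if "i \<in> I" "j \<in> J" for i j
    using inv_into_f_f[OF assms, of "(i, j)"] that by simp
  then show ?thesis by (intro exI[of _ "\<lambda>p. (\<lambda>(i, j). g i j) (inv_into (I \<times> J) (\<lambda>(i, j). f i j) p)"]) blast
qed

lemma obstr_attained:
  fixes f :: "nat \<Rightarrow> nat \<Rightarrow> nat"
  assumes f: "\<And>i j. i < 3 \<Longrightarrow> j < 4 \<Longrightarrow> f i j \<in> P \<and> lab (rl (f i j)) = lab (cl (f i j))"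
    and inj: "inj_on (\<lambda>(i, j). f i j) ({..<3} \<times> {..<4})"
  shows "\<exists>\<theta>. obstr (\<lambda>i j. col (phi lab \<theta>) (f i j)) \<noteq> 0"
proof -
  obtain s where s: "\<And>i j. i < 3 \<Longrightarrow> j < 4 \<Longrightarrow> s (f i j) = sample i j"
    using inj_on_extend[OF inj, of sample] by auto
  obtain \<theta> where "\<And>p. p \<in> P \<Longrightarrow> lab (rl p) = lab (cl p) \<Longrightarrow>
     col (phi lab \<theta>) p = (\<lambda>r. if r = 1 then 1 else if r = 2 then s p else 0)"
    using prescribed_loops[of lab s] by blast
  then have "col (phi lab \<theta>) (f i j) = sample_vec i j" if "i < 3" "j < 4" for i j
    using f[OF that] s[OF that] by (simp add: sample_vec_def fun_eq_iff)
  then have "obstr (\<lambda>i j. col (phi lab \<theta>) (f i j)) = obstr sample_vec" by (rule obstr_cong)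
  then show ?thesis using obstr_sample by (intro exI[of _ \<theta>]) simp
qed

text \<open>Condition (i) gives sides of size 3 and 4, and the at most two prescribed lines fit into
  them whether they have the same direction or not.\<close>

lemma big_block_subgrid:
  assumes c: "canon lab" and adm: "admissible k l (lab ` lines)" and LM: "L \<in> lines" "M \<in> lines" "L \<noteq> M" "lab L = lab M"
  shows "\<exists>S T A B. opp S T \<and> A \<subseteq> lab L \<inter> S \<and> B \<subseteq> lab L \<inter> T \<and> card A = 3 \<and> card B = 4 \<and> {L, M} \<subseteq> A \<union> B"
proof -
  have sub: "{L, M} \<subseteq> lab L" using canonD[OF c LM(1)] LM by blast
  have fin: "finite (lab L)" using canonD[OF c LM(1)] by (intro finite_subset[OF _ finite_lines]) blast
  have "2 \<le> card (lab L)" using card_mono[OF fin sub] LM(3) by simp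
  note big = admissible_big[OF adm LM(1) this]
  obtain S T where ST: "opp S T" "3 \<le> card (lab L \<inter> S)" "4 \<le> card (lab L \<inter> T)"
  proof (cases "4 \<le> card (lab L \<inter> C)")
    case True
    then show ?thesis using that[of R C] big(1) by (simp add: opp_def)
  next
    case False
    then show ?thesis using that[of C R] big(2,3) by (auto simp: opp_def max_def split: if_splits)
  qed
  have ex: "\<exists>A. {L, M} \<inter> U \<subseteq> A \<and> A \<subseteq> lab L \<inter> U \<and> card A = n" if "n \<le> card (lab L \<inter> U)" "2 \<le> n" for U n
  proof -
    have "card ({L, M} \<inter> U) \<le> card {L, M}" by (intro card_mono) auto
    also have "\<dots> \<le> n" using that(2) LM(3) by simp
    finally have "card ({L, M} \<inter> U) \<le> n" .
    then show ?thesis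
      using exists_subset_between[of "{L, M} \<inter> U" n "lab L \<inter> U"] that(1) sub fin by blast
  qed
  obtain A where A: "{L, M} \<inter> S \<subseteq> A" "A \<subseteq> lab L \<inter> S" "card A = 3" using ex[OF ST(2)] by auto
  obtain B where B: "{L, M} \<inter> T \<subseteq> B" "B \<subseteq> lab L \<inter> T" "card B = 4" using ex[OF ST(3)] by auto
  have "{L, M} \<subseteq> S \<union> T" using LM(1,2) ST(1) unfolding opp_def lines_def by blast
  then have "{L, M} \<subseteq> A \<union> B" using A(1) B(1) by blast
  then show ?thesis using ST(1) A(2,3) B(2,3) by blast
qed

section \<open>Inclusion of varieties forces equal partitions\<close>

lemma matroid_variety_polyfun_vanish:
  assumes "\<And>Y. realization (k * l) (gdep lab) Y \<Longrightarrow> g Y = 0" "g \<in> polyfun (k * l)"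
    and "Y \<in> matroid_variety (k * l) (gdep lab)"
  shows "g Y = 0"
proof -
  have "{Y. realization (k * l) (gdep lab) Y} \<subseteq> ambient (k * l)" by (auto simp: realization_def)
  from zariski_closure_iff[OF this] show ?thesis
    using assms unfolding matroid_variety_def by blast
qed

text \<open>Lines joined only in the larger variety would make all their triples dependent there,
  but a generic member of the smaller one has an independent triple on them.\<close>

lemma matroid_variety_subset_imp_refines:
  assumes c: "canon lab" and adm: "admissible k l (lab ` lines)" and c': "canon lab'"
    and sub: "matroid_variety (k * l) (gdep lab) \<subseteq> matroid_variety (k * l) (gdep lab')"
    and LM: "L \<in> lines" "M \<in> lines" "lab' L = lab' M"
  shows "lab L = lab M"
proof (rule ccontr)
  assume "lab L \<noteq> lab M"
  then obtain p q s where pqs: "p \<in> L" "q \<in> L" "s \<in> M" "indep3 lab p q s"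
    using different_blocks_indep3[OF c adm LM(1,2)] by blast
  have P: "p \<in> P" "q \<in> P" "s \<in> P" using pqs LM line_subset_P by blast+
  obtain \<theta> where nz: "det3 (col (phi lab \<theta>) p) (col (phi lab \<theta>) q) (col (phi lab \<theta>) s) \<noteq> 0"
    using indep3_generic[OF pqs(4) P] by blast
  have "L \<in> lab' L" "M \<in> lab' L" using canonD[OF c' LM(1)] LM by auto
  then have "gdep lab' {p, q, s}"
    using block_triple_gdep[OF c' LM(1)] pqs unfolding indep3_def by blast
  then have "det3 (col Y p) (col Y q) (col Y s) = 0" if "realization (k * l) (gdep lab') Y" for Y
    using that P by (intro col_dep_det3_eq_0) (simp add: realization_def P_def)
  moreover have "phi lab \<theta> \<in> matroid_variety (k * l) (gdep lab')"
    using range_phi_closure_realizations[OF c] sub by blast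
  moreover have "(\<lambda>Y. det3 (col Y p) (col Y q) (col Y s)) \<in> polyfun (k * l)"
    by (rule polyfun_det3) (use P in \<open>simp_all add: P_def\<close>)
  ultimately show False
    using matroid_variety_polyfun_vanish[of lab' "\<lambda>Y. det3 (col Y p) (col Y q) (col Y s)" "phi lab \<theta>"] nz
    by blast
qed

text \<open>Dependencies alone do not suffice: if \<open>lab'\<close> consists of single lines, all
  its dependent triples are dependent for \<open>lab\<close> too. A 3 x 4 subgrid of the block
  through L and M separates the varieties, since its obstruction vanishes on the larger one and is
  attained nonzero on the smaller one.\<close>

lemma matroid_variety_subset_imp_coarser:
  assumes c: "canon lab" and adm: "admissible k l (lab ` lines)"
    and c': "canon lab'" and adm': "admissible k l (lab' ` lines)"
    and sub: "matroid_variety (k * l) (gdep lab) \<subseteq> matroid_variety (k * l) (gdep lab')"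
    and LM: "L \<in> lines" "M \<in> lines" "lab L = lab M"
  shows "lab' L = lab' M"
proof (rule ccontr)
  assume ne: "lab' L \<noteq> lab' M"
  then have "L \<noteq> M" by blast
  from big_block_subgrid[OF c adm LM(1,2) this LM(3)] obtain S T A B where ST: "opp S T" and A: "A \<subseteq> lab L \<inter> S" "card A = 3"
    and B: "B \<subseteq> lab L \<inter> T" "card B = 4" and AB: "{L, M} \<subseteq> A \<union> B"
    by (elim exE conjE)
  have fin: "finite A" "finite B" using A(2) B(2) by (auto intro: card_ge_0_finite)
  obtain xs where xs: "bij_betw xs {..<3::nat} A"
    using ex_bij_betw_nat_finite[OF fin(1)] A(2) by (auto simp: atLeast0LessThan)
  obtain js where js: "bij_betw js {..<4::nat} B"
    using ex_bij_betw_nat_finite[OF fin(2)] B(2) by (auto simp: atLeast0LessThan)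
  obtain g where g: "\<And>X J. X \<in> S \<Longrightarrow> J \<in> T \<Longrightarrow> g X J \<in> P \<and> {rl (g X J), cl (g X J)} = {X, J}"
    and ginj: "inj_on (\<lambda>(X, J). g X J) (S \<times> T)"
    using opp_meet[OF ST] by metis
  let ?f = "\<lambda>i j. g (xs i) (js j)"
  have xA: "xs i \<in> A" if "i < 3" for i using xs that by (auto simp: bij_betw_def)
  have jB: "js j \<in> B" if "j < 4" for j using js that by (auto simp: bij_betw_def)
  have xS: "xs i \<in> S" "lab (xs i) = lab L" if "i < 3" for i
    using xA[OF that] A(1) canonD[OF c LM(1)] by blast+
  have jT: "js j \<in> T" "lab (js j) = lab L" if "j < 4" for j
    using jB[OF that] B(1) canonD[OF c LM(1)] by blast+
  have f: "?f i j \<in> P \<and> {rl (?f i j), cl (?f i j)} = {xs i, js j}" if "i < 3" "j < 4" for i j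
    using g[OF xS(1)[OF that(1)] jT(1)[OF that(2)]] .
  have loop: "?f i j \<in> P \<and> lab (rl (?f i j)) = lab (cl (?f i j))" if "i < 3" "j < 4" for i j
    using f[OF that] xS(2)[OF that(1)] jT(2)[OF that(2)] unfolding doubleton_eq_iff by metis
  have "inj_on (\<lambda>(i, j). ?f i j) ({..<3} \<times> {..<4})"
  proof (rule inj_onI)
    fix a b assume a: "a \<in> {..<3::nat} \<times> {..<4::nat}" "b \<in> {..<3::nat} \<times> {..<4::nat}"
      and e: "(\<lambda>(i, j). ?f i j) a = (\<lambda>(i, j). ?f i j) b"
    obtain i j i' j' where ab: "a = (i, j)" "b = (i', j')" by (metis surj_pair)
    have "(xs i, js j) = (xs i', js j')"
      by (rule inj_onD[OF ginj]) (use a e xS jT in \<open>auto simp: ab\<close>)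
    moreover have "inj_on xs {..<3}" "inj_on js {..<4}" using xs js by (simp_all add: bij_betw_def)
    ultimately show "a = b" using a unfolding ab by (auto simp: inj_on_eq_iff)
  qed
  then obtain \<theta> where nz: "obstr (\<lambda>i j. col (phi lab \<theta>) (?f i j)) \<noteq> 0"
    using obstr_attained[of ?f lab] loop by blast
  have "A = xs ` {..<3}" "B = js ` {..<4}" using xs js by (simp_all add: bij_betw_def)
  then have UV: "L \<in> xs ` {..<3} \<union> js ` {..<4}" "M \<in> xs ` {..<3} \<union> js ` {..<4}" using AB by blast+
  have "obstr (\<lambda>i j. col Y (?f i j)) = 0" if "realization (k * l) (gdep lab') Y" for Y
  proof -
    obtain \<eta> where "Y = phi lab' \<eta>" using realization_in_range_phi[OF c' adm' \<open>realization (k * l) (gdep lab') Y\<close>] by blast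
    then show ?thesis using obstr_vanishes[of ?f xs js L M lab' \<eta>] f UV ne by blast
  qed
  moreover have "phi lab \<theta> \<in> matroid_variety (k * l) (gdep lab')"
    using range_phi_closure_realizations[OF c] sub by blast
  moreover have "(\<lambda>Y. obstr (\<lambda>i j. col Y (?f i j))) \<in> polyfun (k * l)"
    by (rule polyfun_obstr) (use f in \<open>simp add: P_def\<close>)
  ultimately show False
    using matroid_variety_polyfun_vanish[of lab' "\<lambda>Y. obstr (\<lambda>i j. col Y (?f i j))" "phi lab \<theta>"] nz
    by blast
qed

lemma matroid_variety_subset_imp_eq:
  assumes c: "canon lab" and adm: "admissible k l (lab ` lines)"
    and c': "canon lab'" and adm': "admissible k l (lab' ` lines)"
    and sub: "matroid_variety (k * l) (gdep lab) \<subseteq> matroid_variety (k * l) (gdep lab')"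
  shows "lab ` lines = lab' ` lines"
proof (rule image_cong)
  fix L assume L: "L \<in> lines"
  have iff: "lab M = lab L \<longleftrightarrow> lab' M = lab' L" if "M \<in> lines" for M
    using matroid_variety_subset_imp_refines[OF c adm c' sub that L]
      matroid_variety_subset_imp_coarser[OF c adm c' adm' sub that L] by (rule iffI[rotated])
  show "lab L = lab' L"
  proof (rule set_eqI)
    fix M show "M \<in> lab L \<longleftrightarrow> M \<in> lab' L"
      unfolding canonD[OF c L] canonD[OF c' L] using iff by (rule conj_cong[OF refl])
  qed
qed simp

end

section \<open>Splitting blocks by deformation\<close>

lemma range_poly_cross:
  assumes "\<And>r. (\<lambda>t. u t r) \<in> range poly" "\<And>r. (\<lambda>t. v t r) \<in> range poly"
  shows "(\<lambda>t. cross (u t) (v t) r) \<in> range poly"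
proof -
  have d: "(\<lambda>t. f t - g t) \<in> range poly" if "f \<in> range poly" "g \<in> range poly" for f g :: "complex \<Rightarrow> complex"
    using range_poly_add[OF that(1) range_poly_mult[OF range_poly_const[of "-1"] that(2)]] by simp
  show ?thesis
    by (cases "r = 0"; cases "r = 1"; cases "r = 2")
      (simp_all add: cross_def d range_poly_mult assms range_poly_const del: image_iff)
qed

lemma multiple_cross_of_perp:
  assumes "vec3 p" "dot w p = 0" "w 0 \<noteq> 0" "d 0 = 0" "dot2 d p = 0" "d 1 \<noteq> 0 \<or> d 2 \<noteq> 0"
  shows "\<exists>a. p = (\<lambda>r. a * cross w d r)"
proof (rule perp_both_imp_multiple_cross[OF assms(1,2)])
  show "dot d p = 0" using assms(4,5) by (simp add: dot_def dot2_def)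
  show "cross w d \<noteq> (\<lambda>_. 0)"
    unfolding cross_eq_0_iff cross_simps using assms(3,4,6) by auto
qed

text \<open>The quarter turn of the plane part of q, scaled by a. It is orthogonal to q, and a is
  free to prescribe one further product, by \<open>dot2_perp2\<close>.\<close>

definition perp2 :: "complex \<Rightarrow> (nat \<Rightarrow> complex) \<Rightarrow> nat \<Rightarrow> complex" where
  "perp2 a q = (\<lambda>r. if r = 1 then - a * q 2 else if r = 2 then a * q 1 else 0)"

lemma dot2_perp2: "dot2 (perp2 a q) p = a * br q p"
  by (simp add: dot2_def perp2_def br_def algebra_simps)

lemma dot2_diff: "dot2 (\<lambda>r. u r - v r) p = dot2 u p - dot2 v p"
  by (simp add: dot2_def algebra_simps)

lemma dot2_nonzero: "dot2 d p \<noteq> 0 \<Longrightarrow> d 1 \<noteq> 0 \<or> d 2 \<noteq> 0"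
  by (auto simp: dot2_def)

definition pair_vec :: "complex \<Rightarrow> complex \<Rightarrow> nat \<Rightarrow> complex" where
  "pair_vec a b = (\<lambda>r. if r = 1 then a else if r = 2 then b else 0)"

lemma pair_vec_simps [simp]: "pair_vec a b 0 = 0" "perp2 a q 0 = 0"
  by (simp_all add: pair_vec_def perp2_def)

context grid
begin

text \<open>Failure of condition (i) without the restriction on the size of the block. Single lines
  count as bad as well; splitting leaves them as they are.\<close>

definition bad :: "nat set set \<Rightarrow> bool" where
  "bad b \<longleftrightarrow> \<not> (3 \<le> card (b \<inter> R) \<and> 3 \<le> card (b \<inter> C) \<and> 4 \<le> max (card (b \<inter> R)) (card (b \<inter> C)))"

text \<open>First-order deformations: moving the normal of each line \<open>L\<close> of the block from \<open>w\<close> to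
  \<open>w + t x\<^sub>L\<close> moves the intersection of a row and a column to a point which for \<open>t \<rightarrow> 0\<close>
  tends to the direction \<open>w \<times> (x\<^sub>c - x\<^sub>r)\<close>.\<close>

definition tilt :: "(nat set \<Rightarrow> nat set set) \<Rightarrow> ((nat set set \<times> nat) + (nat \<times> nat) \<Rightarrow> complex) \<Rightarrow>
    nat set set \<Rightarrow> (nat set \<Rightarrow> nat \<Rightarrow> complex) \<Rightarrow> bool" where
  "tilt lab \<theta> b x \<longleftrightarrow> (\<forall>p\<in>P. lab (rl p) = b \<and> lab (cl p) = b \<longrightarrow>
     (\<exists>a. col (phi lab \<theta>) p = (\<lambda>r. a * cross (W \<theta> b) (\<lambda>r. x (cl p) r - x (rl p) r) r)))"

text \<open>By \<open>eq\<close> the column is orthogonal to the difference d of the two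
  deformations as well as to w. By \<open>neq\<close> d is nonzero, and its coordinate 0 vanishes
  while that of w does not, so w and d are independent and the column is a multiple of w x
  d.\<close>

lemma tiltI:
  assumes "opp S T" and f: "\<forall>X\<in>S. \<forall>J\<in>T. f X J \<in> P \<and> {rl (f X J), cl (f X J)} = {X, J}"
    and surj: "\<forall>p\<in>P. \<exists>X\<in>S. \<exists>J\<in>T. p = f X J"
    and w: "W \<theta> b 0 \<noteq> 0" and x0: "\<And>L. x L 0 = 0" "\<And>L. y L 0 = 0"
    and eq: "\<And>X J. X \<in> S \<Longrightarrow> J \<in> T \<Longrightarrow> lab X = b \<Longrightarrow> lab J = b \<Longrightarrow>
      dot2 (y J) (col (phi lab \<theta>) (f X J)) = dot2 (x X) (col (phi lab \<theta>) (f X J))"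
    and neq: "\<And>X J. X \<in> S \<Longrightarrow> J \<in> T \<Longrightarrow> lab X = b \<Longrightarrow> lab J = b \<Longrightarrow> \<exists>q. dot2 (y J) q \<noteq> dot2 (x X) q"
  shows "tilt lab \<theta> b (\<lambda>L. if L \<in> S then x L else y L)"
proof -
  define z where "z = (\<lambda>L. if L \<in> S then x L else y L)"
  have "tilt lab \<theta> b z"
    unfolding tilt_def
  proof (intro ballI impI)
    fix p assume p: "p \<in> P" "lab (rl p) = b \<and> lab (cl p) = b"
    obtain X J where XJ: "X \<in> S" "J \<in> T" "p = f X J" using surj p(1) by blast
    have "J \<notin> S" using assms(1) XJ(2) R_C_disjoint unfolding opp_def by blast
    then have x: "z X = x X" "z J = y J" using XJ(1) by (simp_all add: z_def)
    have e: "{rl p, cl p} = {X, J}" using f XJ by simp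
    then have or: "(rl p = X \<and> cl p = J) \<or> (rl p = J \<and> cl p = X)" unfolding doubleton_eq_iff by blast
    then have lab: "lab X = b" "lab J = b" using p(2) by auto
    obtain q where q: "dot2 (y J) q \<noteq> dot2 (x X) q" using neq[OF XJ(1,2) lab] by blast
    note e0 = eq[OF XJ(1,2) lab, folded XJ(3)]
    show "\<exists>a. col (phi lab \<theta>) p = (\<lambda>r. a * cross (W \<theta> b) (\<lambda>r. z (cl p) r - z (rl p) r) r)"
    proof (rule multiple_cross_of_perp[where d = "\<lambda>r. z (cl p) r - z (rl p) r"])
      show "vec3 (col (phi lab \<theta>) p)" by (rule vec3_col[OF phi_ambient])
      show "W \<theta> b 0 \<noteq> 0" by (rule w)
      show "dot (W \<theta> b) (col (phi lab \<theta>) p) = 0" using phi_perp[OF p(1)] p(2) by metis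
      show "z (cl p) 0 - z (rl p) 0 = 0" using x0 by (simp add: z_def)
      show "dot2 (\<lambda>r. z (cl p) r - z (rl p) r) (col (phi lab \<theta>) p) = 0"
        unfolding dot2_diff using or x e0 by (elim disjE conjE) simp_all
      have "dot2 (\<lambda>r. z (cl p) r - z (rl p) r) q \<noteq> 0"
        unfolding dot2_diff using or x q by (elim disjE conjE) simp_all
      then show "z (cl p) 1 - z (rl p) 1 \<noteq> 0 \<or> z (cl p) 2 - z (rl p) 2 \<noteq> 0" by (rule dot2_nonzero)
    qed
  qed
  then show ?thesis by (simp add: z_def)
qed

text \<open>The form that \<open>pf_vanish_generic\<close> consumes: finitely many polynomials, each
  nonzero somewhere, whose common nonvanishing guarantees a tilt.\<close>

definition generic_tilt :: "(nat set \<Rightarrow> nat set set) \<Rightarrow> nat set set \<Rightarrow> bool" where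
  "generic_tilt lab b \<longleftrightarrow> (\<exists>D. finite D \<and> D \<subseteq> pf \<and> (\<forall>d\<in>D. \<exists>\<theta>. d \<theta> \<noteq> 0) \<and>
     (\<forall>\<theta>. (\<forall>d\<in>D. d \<theta> \<noteq> 0) \<longrightarrow> (\<exists>x. tilt lab \<theta> b x)))"

lemma generic_tiltI:
  assumes "finite D" "D \<subseteq> polyfun (k * l)" "\<And>d. d \<in> D \<Longrightarrow> \<exists>\<theta>. d (phi lab \<theta>) \<noteq> 0"
    and "\<And>\<theta>. W \<theta> b 0 \<noteq> 0 \<Longrightarrow> \<forall>d\<in>D. d (phi lab \<theta>) \<noteq> 0 \<Longrightarrow> \<exists>x. tilt lab \<theta> b x"
  shows "generic_tilt lab b"
proof -
  let ?D = "insert (\<lambda>\<theta>. W \<theta> b 0) ((\<lambda>d \<theta>. d (phi lab \<theta>)) ` D)"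
  have "?D \<subseteq> pf"
  proof (intro insert_subsetI image_subsetI)
    show "(\<lambda>\<theta>. d (phi lab \<theta>)) \<in> pf" if "d \<in> D" for d
      by (rule polyfun_comp_pf[OF subsetD[OF assms(2) that] phi_pf])
  qed (rule pf_W)
  moreover have "\<exists>\<theta>. W \<theta> b 0 \<noteq> 0" using prescribed_loops by (metis zero_neq_one)
  moreover have "\<forall>d\<in>?D. \<exists>\<theta>. d \<theta> \<noteq> 0"
  proof
    fix e assume "e \<in> ?D"
    then show "\<exists>\<theta>. e \<theta> \<noteq> 0"
    proof (elim insertE imageE)
      show ?thesis if "e = (\<lambda>\<theta>. W \<theta> b 0)"
        unfolding that using \<open>\<exists>\<theta>. W \<theta> b 0 \<noteq> 0\<close> .
      show ?thesis if "e = (\<lambda>\<theta>. d (phi lab \<theta>))" "d \<in> D" for d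
        unfolding that(1) by (rule assms(3)[OF that(2)])
    qed
  qed
  moreover have "\<exists>x. tilt lab \<theta> b x" if nz: "\<forall>d\<in>?D. d \<theta> \<noteq> 0" for \<theta>
  proof -
    from nz have "W \<theta> b 0 \<noteq> 0 \<and> (\<forall>d\<in>D. d (phi lab \<theta>) \<noteq> 0)" by simp
    then show ?thesis by (elim conjE) (rule assms(4))
  qed
  ultimately show ?thesis unfolding generic_tilt_def
    using assms(1) by (intro exI[of _ ?D] conjI) simp_all
qed

text \<open>Fix x = 0 on the first line of S and x = (1, 0) on the second. Each line J of T then has
  two equations for its two unknowns, independent when the bracket of its two points is nonzero.
  With a single line of S, any vector orthogonal to the point serves.\<close>

lemma generic_tilt_two:
  assumes c: "canon lab" and L: "L \<in> lines" and ST: "opp S T" and card: "card (lab L \<inter> S) \<le> 2"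
  shows "generic_tilt lab (lab L)"
proof -
  let ?b = "lab L"
  obtain f where fo: "\<forall>X\<in>S. \<forall>J\<in>T. f X J \<in> P \<and> {rl (f X J), cl (f X J)} = {X, J}"
    and inj: "inj_on (\<lambda>(X, J). f X J) (S \<times> T)" and surj: "\<forall>p\<in>P. \<exists>X\<in>S. \<exists>J\<in>T. p = f X J"
    using opp_meet[OF ST] by (elim exE conjE)
  note f = fo[rule_format]
  have fin: "finite S" "finite T" and lines: "S \<subseteq> lines" "T \<subseteq> lines" and ne: "2 \<le> card S"
    using ST card_R card_C k3 l3 by (auto simp: opp_def)
  \<comment> \<open>If fewer than two lines of S belong to the block, the pair is padded with lines
    outside of it.\<close>
  obtain X1 X2 where X: "X1 \<in> S" "X2 \<in> S" "X1 \<noteq> X2" "lab L \<inter> S \<subseteq> {X1, X2}"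
  proof -
    obtain A where A: "lab L \<inter> S \<subseteq> A" "A \<subseteq> S" "card A = 2"
      using exists_subset_between[OF card ne _ fin(1)] by blast
    obtain X1 X2 where "A = {X1, X2}" "X1 \<noteq> X2" using A(3) by (auto simp: card_2_iff)
    then show ?thesis using that[of X1 X2] A(1,2) by simp
  qed
  have inA: "X = X1 \<or> X = X2" if "X \<in> S" "lab X = ?b" for X
    using X(4) canonD[OF c L, of X] that lines by blast
  let ?B = "lab L \<inter> T"
  have inB: "J \<in> ?B" if "J \<in> T" "lab J = ?b" for J
    using canonD[OF c L, of J] that lines by blast
  show ?thesis
  proof (cases "lab X1 = ?b \<and> lab X2 = ?b")
    case True
    let ?D = "\<Union>J\<in>?B. {\<lambda>Y. br (col Y (f X1 J)) (col Y (f X2 J)), \<lambda>Y. col Y (f X1 J) 1, \<lambda>Y. col Y (f X2 J) 1}"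
    have fP: "f X1 J \<in> {1..k * l}" "f X2 J \<in> {1..k * l}" if "J \<in> T" for J
      using f X(1,2) that unfolding P_def by blast+
    show ?thesis
    proof (rule generic_tiltI[of ?D])
      show "finite ?D" using fin(2) by simp
      show "?D \<subseteq> polyfun (k * l)"
        using fP by (auto intro!: polyfun_br polyfun_col)
      \<comment> \<open>The columns (0, 1, 0) on \<open>X1\<close> and (0, 1, 1) on
        \<open>X2\<close> have bracket 1 and nonzero coordinate 1.\<close>
      obtain s where s: "\<And>X J. X \<in> S \<Longrightarrow> J \<in> T \<Longrightarrow> s (f X J) = (if X = X1 then 0 else 1 :: complex)"
        using inj_on_extend[OF inj, of "\<lambda>X J. if X = X1 then 0 else 1"] by blast
      obtain \<theta> where t: "\<And>p. p \<in> P \<Longrightarrow> lab (rl p) = lab (cl p) \<Longrightarrow>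
          col (phi lab \<theta>) p = (\<lambda>r. if r = 1 then 1 else if r = 2 then s p else 0)"
        using prescribed_loops[of lab s] by blast
      have v: "col (phi lab \<theta>) (f X J) = (\<lambda>r. if r = 1 then 1 else if r = 2 then (if X = X1 then 0 else 1) else 0)"
        if "X = X1 \<or> X = X2" "J \<in> ?B" for X J
      proof -
        have XJ: "X \<in> S" "J \<in> T" "lab X = ?b" "lab J = ?b"
          using that X(1,2) True canonD[OF c L, of J] by auto
        then have "lab (rl (f X J)) = lab (cl (f X J))"
          using f[OF XJ(1,2)] unfolding doubleton_eq_iff by metis
        from t[OF _ this] f[OF XJ(1,2)] show ?thesis unfolding s[OF XJ(1,2)] by blast
      qed
      have "br (col (phi lab \<theta>) (f X1 J)) (col (phi lab \<theta>) (f X2 J)) \<noteq> 0"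
        "col (phi lab \<theta>) (f X1 J) 1 \<noteq> 0" "col (phi lab \<theta>) (f X2 J) 1 \<noteq> 0" if "J \<in> ?B" for J
        unfolding v[OF disjI1[OF refl] that] v[OF disjI2[OF refl] that] br_def using X(3) by auto
      then show "\<exists>\<theta>. d (phi lab \<theta>) \<noteq> 0" if "d \<in> ?D" for d
        using that by (intro exI[of _ \<theta>]) blast
    next
      fix \<theta> assume w: "W \<theta> ?b 0 \<noteq> 0" and nz: "\<forall>d\<in>?D. d (phi lab \<theta>) \<noteq> 0"
      let ?q = "\<lambda>X J. col (phi lab \<theta>) (f X J)"
      have nz: "br (?q X1 J) (?q X2 J) \<noteq> 0" "?q X1 J 1 \<noteq> 0" "?q X2 J 1 \<noteq> 0" if "J \<in> ?B" for J
        using bspec[OF nz, of "\<lambda>Y. br (col Y (f X1 J)) (col Y (f X2 J))"] bspec[OF nz, of "\<lambda>Y. col Y (f X1 J) 1"]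
          bspec[OF nz, of "\<lambda>Y. col Y (f X2 J) 1"] that by blast+
      define x where "x X = (if X = X1 then pair_vec 0 0 else pair_vec 1 0)" for X
      \<comment> \<open>Orthogonal to the point on \<open>X1\<close>, with the scale chosen so that
        the product with the point on \<open>X2\<close> equals its coordinate 1, the value demanded
        by x = (1, 0).\<close>
      define y where "y J = perp2 (?q X2 J 1 / br (?q X1 J) (?q X2 J)) (?q X1 J)" for J
      have y1: "dot2 (y J) (?q X1 J) = 0" for J by (simp add: y_def dot2_perp2) (simp add: br_def)
      have y2: "dot2 (y J) (?q X2 J) = ?q X2 J 1" if "J \<in> ?B" for J
        using nz[OF that] by (simp add: y_def dot2_perp2)
      have x1: "dot2 (x X1) q = 0" "dot2 (x X2) q = q 1" for q
        using X(3) by (simp_all add: x_def dot2_def pair_vec_def)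
      have "tilt lab \<theta> ?b (\<lambda>L. if L \<in> S then x L else y L)"
      proof (rule tiltI[OF ST fo surj w])
        show "x L 0 = 0" "y L 0 = 0" for L by (simp_all add: x_def y_def)
        fix X J assume a: "X \<in> S" "J \<in> T" "lab X = ?b" "lab J = ?b"
        have J: "J \<in> ?B" using inB a by blast
        show "dot2 (y J) (?q X J) = dot2 (x X) (?q X J)"
          using inA[OF a(1,3)] x1 y1 y2[OF J] by auto
        show "\<exists>q. dot2 (y J) q \<noteq> dot2 (x X) q"
          using inA[OF a(1,3)]
        proof
          assume "X = X1"
          then show ?thesis using x1 y2[OF J] nz[OF J] by (intro exI[of _ "?q X2 J"]) simp
        next
          assume "X = X2"
          then show ?thesis using x1 y1[of J] nz[OF J] by (intro exI[of _ "?q X1 J"]) simp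
        qed
      qed
      then show "\<exists>x. tilt lab \<theta> ?b x" by blast
    qed
  next
    case False
    then obtain X0 where X0: "X0 \<in> S" "\<And>X. X \<in> S \<Longrightarrow> lab X = ?b \<Longrightarrow> X = X0"
      using inA X(1,2) by metis
    show ?thesis
    proof (cases "lab X0 = ?b")
      case False
      \<comment> \<open>No line of S is in the block, so no point has both lines in it.\<close>
      then have "tilt lab \<theta> ?b (\<lambda>_ _. 0)" for \<theta>
        using X0(2) ST unfolding tilt_def opp_def by (metis cl_in rl_in)
      then show ?thesis unfolding generic_tilt_def by (intro exI[of _ "{}"]) auto
    next
      case True
      let ?D = "\<Union>J\<in>?B. {\<lambda>Y. col Y (f X0 J) 1}"
      show ?thesis
      proof (rule generic_tiltI[of ?D])
        show "finite ?D" using fin(2) by simp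
        show "?D \<subseteq> polyfun (k * l)"
          using f X0(1) unfolding P_def by (auto intro!: polyfun_col)
        obtain \<theta> where t: "\<And>p. p \<in> P \<Longrightarrow> lab (rl p) = lab (cl p) \<Longrightarrow>
            col (phi lab \<theta>) p = (\<lambda>r. if r = 1 then 1 else if r = 2 then 0 else 0)"
          using prescribed_loops[of lab "\<lambda>_. 0"] by blast
        have v: "col (phi lab \<theta>) (f X0 J) 1 = 1" if "J \<in> ?B" for J
        proof -
          have J: "J \<in> T" "lab J = ?b" using that canonD[OF c L, of J] by auto
          then have "lab (rl (f X0 J)) = lab (cl (f X0 J))"
            using f[OF X0(1) J(1)] True unfolding doubleton_eq_iff by metis
          then show ?thesis using t f[OF X0(1) J(1)] by simp
        qed
        show "\<exists>\<theta>. d (phi lab \<theta>) \<noteq> 0" if "d \<in> ?D" for d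
          using that v by (intro exI[of _ \<theta>]) auto
      next
        fix \<theta> assume w: "W \<theta> ?b 0 \<noteq> 0" and nz: "\<forall>d\<in>?D. d (phi lab \<theta>) \<noteq> 0"
        let ?q = "\<lambda>J. col (phi lab \<theta>) (f X0 J)"
        have "tilt lab \<theta> ?b (\<lambda>L. if L \<in> S then pair_vec 0 0 else perp2 1 (?q L))"
        proof (rule tiltI[OF ST fo surj w])
          fix X J assume a: "X \<in> S" "J \<in> T" "lab X = ?b" "lab J = ?b"
          have X: "X = X0" using X0(2) a by blast
          have "?q J 1 \<noteq> 0" using bspec[OF nz, of "\<lambda>Y. col Y (f X0 J) 1"] inB a by blast
          then show "\<exists>q. dot2 (perp2 1 (?q J)) q \<noteq> dot2 (pair_vec 0 0) q"
            by (intro exI[of _ "pair_vec 0 1"]) (simp add: dot2_def perp2_def pair_vec_def)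
          show "dot2 (perp2 1 (?q J)) (col (phi lab \<theta>) (f X J)) = dot2 (pair_vec 0 0) (col (phi lab \<theta>) (f X J))"
            unfolding X dot2_perp2 by (simp add: dot2_def br_def pair_vec_def)
        qed simp_all
        then show "\<exists>x. tilt lab \<theta> ?b x" by blast
      qed
    qed
  qed
qed

text \<open>With x = 0 on \<open>X0\<close>, the four unknown coordinates on \<open>X1\<close> and
  \<open>X2\<close> face three conditions, one for each column of the block. The minors
  \<open>cof\<close> give a solution that is polynomial in the matrix, and the sample configuration
  shows that it is generically nondegenerate.\<close>

lemma generic_tilt_three:
  assumes c: "canon lab" and L: "L \<in> lines" and card: "card (lab L \<inter> R) = 3" "card (lab L \<inter> C) = 3"
  shows "generic_tilt lab (lab L)"
proof -
  let ?b = "lab L"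
  have ST: "opp R C" by (simp add: opp_def)
  obtain f where fo: "\<forall>X\<in>R. \<forall>J\<in>C. f X J \<in> P \<and> {rl (f X J), cl (f X J)} = {X, J}"
    and inj: "inj_on (\<lambda>(X, J). f X J) (R \<times> C)" and surj: "\<forall>p\<in>P. \<exists>X\<in>R. \<exists>J\<in>C. p = f X J"
    using opp_meet[OF ST] by (elim exE conjE)
  note f = fo[rule_format]
  obtain X0 X1 X2 where X: "?b \<inter> R = {X0, X1, X2}" "X0 \<noteq> X1" "X0 \<noteq> X2" "X1 \<noteq> X2"
    using card(1) by (auto simp: card_Suc_eq numeral_eq_Suc)
  obtain J0 J1 J2 where J: "?b \<inter> C = {J0, J1, J2}" "J0 \<noteq> J1" "J0 \<noteq> J2" "J1 \<noteq> J2"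
    using card(2) by (auto simp: card_Suc_eq numeral_eq_Suc)
  have XR: "X0 \<in> R" "X1 \<in> R" "X2 \<in> R" and JC: "J0 \<in> C" "J1 \<in> C" "J2 \<in> C" using X(1) J(1) by blast+
  have lX: "lab X = ?b" if "X \<in> {X0, X1, X2}" for X using that X(1) canonD[OF c L, of X] by blast
  have lJ: "lab M = ?b" if "M \<in> {J0, J1, J2}" for M using that J(1) canonD[OF c L, of M] by blast
  have inX: "X \<in> {X0, X1, X2}" if "X \<in> R" "lab X = ?b" for X
    using that canonD[OF c L, of X] X(1) by auto
  have inJ: "M \<in> {J0, J1, J2}" if "M \<in> C" "lab M = ?b" for M
    using that canonD[OF c L, of M] J(1) by auto
  define rw where "rw Y M = row4 (col Y (f X0 M)) (col Y (f X1 M)) (col Y (f X2 M))" for Y M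
  \<comment> \<open>Indices 0 and 1 hold the deformation of \<open>X1\<close>, indices 2 and 3 that
    of \<open>X2\<close>.\<close>
  define u where "u Y = cof (rw Y J0) (rw Y J1) (rw Y J2)" for Y
  define x1 where "x1 Y = pair_vec (u Y 0) (u Y 1)" for Y
  define x2 where "x2 Y = pair_vec (u Y 2) (u Y 3)" for Y
  let ?D = "\<Union>M\<in>{J0, J1, J2}. {\<lambda>Y. br (col Y (f X0 M)) (col Y (f X1 M)), \<lambda>Y. dot2 (x1 Y) (col Y (f X1 M)),
     \<lambda>Y. dot2 (x1 Y) (col Y (f X0 M)), \<lambda>Y. dot2 (x2 Y) (col Y (f X0 M))}"
  have fP: "f X M \<in> {1..k * l}" if "X \<in> R" "M \<in> C" for X M
    using f[OF that] by (simp add: P_def)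
  have pu: "(\<lambda>Y. u Y r) \<in> polyfun (k * l)" for r
    unfolding u_def rw_def by (intro polyfun_cof polyfun_row4 fP XR JC)
  have pd: "(\<lambda>Y. dot2 (x1 Y) (col Y p)) \<in> polyfun (k * l)" "(\<lambda>Y. dot2 (x2 Y) (col Y p)) \<in> polyfun (k * l)"
    if "p \<in> {1..k * l}" for p
    unfolding dot2_def x1_def x2_def pair_vec_def using that by (simp_all add: padd pmult pu polyfun_col)
  show ?thesis
  proof (rule generic_tiltI[of ?D])
    show "finite ?D" by simp
    show "?D \<subseteq> polyfun (k * l)"
      using fP XR JC by (auto intro!: polyfun_br pd)
    obtain s where s: "\<And>X M. X \<in> R \<Longrightarrow> M \<in> C \<Longrightarrow> s (f X M) =
        sample (if X = X0 then 0 else if X = X1 then 1 else 2) (if M = J0 then 0 else if M = J1 then 1 else 2)"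
      using inj_on_extend[OF inj, of "\<lambda>X M. sample (if X = X0 then 0 else if X = X1 then 1 else 2)
          (if M = J0 then 0 else if M = J1 then 1 else 2)"] by blast
    obtain \<theta> where t: "\<And>p. p \<in> P \<Longrightarrow> lab (rl p) = lab (cl p) \<Longrightarrow>
        col (phi lab \<theta>) p = (\<lambda>r. if r = 1 then 1 else if r = 2 then s p else 0)"
      using prescribed_loops[of lab s] by blast
    have v: "col (phi lab \<theta>) (f X M) =
        sample_vec (if X = X0 then 0 else if X = X1 then 1 else 2) (if M = J0 then 0 else if M = J1 then 1 else 2)"
      if "X \<in> {X0, X1, X2}" "M \<in> {J0, J1, J2}" for X M
    proof -
      have XM: "X \<in> R" "M \<in> C" using that XR JC by auto
      have "lab (rl (f X M)) = lab (cl (f X M))"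
        using f[OF XM] lX[OF that(1)] lJ[OF that(2)] unfolding doubleton_eq_iff by metis
      from t[OF _ this] f[OF XM] show ?thesis unfolding s[OF XM] sample_vec_def by blast
    qed
    have cols: "col (phi lab \<theta>) (f X0 J0) = sample_vec 0 0" "col (phi lab \<theta>) (f X1 J0) = sample_vec 1 0"
      "col (phi lab \<theta>) (f X2 J0) = sample_vec 2 0" "col (phi lab \<theta>) (f X0 J1) = sample_vec 0 1"
      "col (phi lab \<theta>) (f X1 J1) = sample_vec 1 1" "col (phi lab \<theta>) (f X2 J1) = sample_vec 2 1"
      "col (phi lab \<theta>) (f X0 J2) = sample_vec 0 2" "col (phi lab \<theta>) (f X1 J2) = sample_vec 1 2"
      "col (phi lab \<theta>) (f X2 J2) = sample_vec 2 2"
      using v[of X0] v[of X1] v[of X2] X(2-4) J(2-4) by simp_all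
    have "u (phi lab \<theta>) = (\<lambda>r. if r = 0 then 4 else if r = 2 then -4 else 0)"
      unfolding u_def rw_def cols by (rule sample_cof)
    then have xs: "x1 (phi lab \<theta>) = pair_vec 4 0" "x2 (phi lab \<theta>) = pair_vec (-4) 0"
      by (simp_all add: x1_def x2_def)
    show "\<exists>\<theta>. d (phi lab \<theta>) \<noteq> 0" if "d \<in> ?D" for d
    proof (rule exI[of _ \<theta>])
      show "d (phi lab \<theta>) \<noteq> 0"
        using that by (auto simp: cols xs dot2_def br_def pair_vec_def sample_vec_def sample_def)
    qed
  next
    fix \<theta> assume w: "W \<theta> ?b 0 \<noteq> 0" and nz': "\<forall>d\<in>?D. d (phi lab \<theta>) \<noteq> 0"
    let ?Y = "phi lab \<theta>"
    let ?q = "\<lambda>X M. col ?Y (f X M)"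
    have nz: "br (?q X0 M) (?q X1 M) \<noteq> 0" "dot2 (x1 ?Y) (?q X1 M) \<noteq> 0"
      "dot2 (x1 ?Y) (?q X0 M) \<noteq> 0" "dot2 (x2 ?Y) (?q X0 M) \<noteq> 0" if "M \<in> {J0, J1, J2}" for M
      using bspec[OF nz', of "\<lambda>Y. br (col Y (f X0 M)) (col Y (f X1 M))"]
        bspec[OF nz', of "\<lambda>Y. dot2 (x1 Y) (col Y (f X1 M))"] bspec[OF nz', of "\<lambda>Y. dot2 (x1 Y) (col Y (f X0 M))"]
        bspec[OF nz', of "\<lambda>Y. dot2 (x2 Y) (col Y (f X0 M))"] that by blast+
    \<comment> \<open>The points on \<open>X0\<close> and \<open>X1\<close> already determine y on
      the column M. This relation is the compatibility with its third point, on
      \<open>X2\<close>.\<close>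
    have rel: "br (?q X0 M) (?q X2 M) * dot2 (x1 ?Y) (?q X1 M) = br (?q X0 M) (?q X1 M) * dot2 (x2 ?Y) (?q X2 M)"
      if "M \<in> {J0, J1, J2}" for M
    proof -
      have "dot4 (rw ?Y M) (u ?Y) = 0" using that dot4_cof unfolding u_def by blast
      then show ?thesis unfolding rw_def dot4_row4 by (simp add: x1_def x2_def pair_vec_def dot2_def)
    qed
    define x where "x X = (if X = X0 then pair_vec 0 0 else if X = X1 then x1 ?Y else x2 ?Y)" for X
    define y where "y M = perp2 (dot2 (x1 ?Y) (?q X1 M) / br (?q X0 M) (?q X1 M)) (?q X0 M)" for M
    have x: "dot2 (x X0) q = 0" "x X1 = x1 ?Y" "x X2 = x2 ?Y" for q
      using X(2-4) by (auto simp: x_def dot2_def pair_vec_def)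
    have y0: "dot2 (y M) (?q X0 M) = 0" for M by (simp add: y_def dot2_perp2) (simp add: br_def)
    have y1: "dot2 (y M) (?q X1 M) = dot2 (x1 ?Y) (?q X1 M)" if "M \<in> {J0, J1, J2}" for M
      using nz(1)[OF that] by (simp add: y_def dot2_perp2)
    have y2: "dot2 (y M) (?q X2 M) = dot2 (x2 ?Y) (?q X2 M)" if "M \<in> {J0, J1, J2}" for M
      using nz(1)[OF that] rel[OF that] by (simp add: y_def dot2_perp2 field_simps)
    have "tilt lab \<theta> ?b (\<lambda>L. if L \<in> R then x L else y L)"
    proof (rule tiltI[OF ST fo surj w])
      show "x N 0 = 0" "y N 0 = 0" for N by (simp_all add: x_def y_def x1_def x2_def)
      fix X M assume a: "X \<in> R" "M \<in> C" "lab X = ?b" "lab M = ?b"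
      have M: "M \<in> {J0, J1, J2}" using inJ a by blast
      consider "X = X0" | "X = X1" | "X = X2" using inX[OF a(1,3)] by blast
      note cases = this
      show "dot2 (y M) (?q X M) = dot2 (x X) (?q X M)"
        using cases by cases (use x y0 y1[OF M] y2[OF M] in simp_all)
      show "\<exists>q. dot2 (y M) q \<noteq> dot2 (x X) q"
        using cases
      proof cases
        case 1
        then show ?thesis using x y1[OF M] nz(2)[OF M] by (intro exI[of _ "?q X1 M"]) simp
      next
        case 2
        then show ?thesis using x y0[of M] nz(3)[OF M] by (intro exI[of _ "?q X0 M"]) simp
      next
        case 3
        then show ?thesis using x y0[of M] nz(4)[OF M] by (intro exI[of _ "?q X0 M"]) simp
      qed
    qed
    then show "\<exists>x. tilt lab \<theta> ?b x" by blast
  qed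
qed

lemma bad_generic_tilt:
  assumes "canon lab" "L \<in> lines" "bad (lab L)"
  shows "generic_tilt lab (lab L)"
proof -
  consider "card (lab L \<inter> R) \<le> 2" | "card (lab L \<inter> C) \<le> 2" | "card (lab L \<inter> R) = 3" "card (lab L \<inter> C) = 3"
    using assms(3) unfolding bad_def by linarith
  then show ?thesis
  proof cases
    case 1
    then show ?thesis using generic_tilt_two[OF assms(1,2), of R C] by (simp add: opp_def)
  next
    case 2
    then show ?thesis using generic_tilt_two[OF assms(1,2), of C R] by (simp add: opp_def)
  next
    case 3
    then show ?thesis by (rule generic_tilt_three[OF assms(1,2)])
  qed
qed

end

section \<open>The decomposition\<close>

context grid
begin

definition split :: "(nat set \<Rightarrow> nat set set) \<Rightarrow> nat set \<Rightarrow> nat set set" where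
  "split lab L = (if bad (lab L) then {L} else lab L)"

lemma split_eq_iff:
  assumes c: "canon lab" and L: "L \<in> lines" and M: "M \<in> lines"
  shows "split lab L = split lab M \<longleftrightarrow> L = M \<or> (lab L = lab M \<and> \<not> bad (lab L))"
proof (cases "bad (lab L)"; cases "bad (lab M)")
  assume a: "bad (lab L)" "\<not> bad (lab M)"
  have "L \<noteq> M" "lab L \<noteq> lab M" using a by auto
  moreover have "split lab L \<noteq> split lab M"
  proof
    assume "split lab L = split lab M"
    then have "L \<in> lab M" using a by (auto simp: split_def)
    then show False using canonD[OF c M] calculation(2) by blast
  qed
  ultimately show ?thesis by blast
next
  assume a: "\<not> bad (lab L)" "bad (lab M)"
  have "L \<noteq> M" "lab L \<noteq> lab M" using a by auto
  moreover have "split lab L \<noteq> split lab M"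
  proof
    assume "split lab L = split lab M"
    then have "M \<in> lab L" using a by (auto simp: split_def)
    then show False using canonD[OF c L] calculation(2) by metis
  qed
  ultimately show ?thesis by blast
qed (auto simp: split_def)

lemma canon_split:
  assumes c: "canon lab"
  shows "canon (split lab)"
  unfolding canon_def
proof (intro ballI set_eqI)
  fix L M assume L: "L \<in> lines"
  have "M \<in> split lab L \<longleftrightarrow> M \<in> lines \<and> (M = L \<or> (lab M = lab L \<and> \<not> bad (lab M)))"
    using canonD[OF c L, of M] L by (cases "bad (lab L)") (auto simp: split_def)
  also have "\<dots> \<longleftrightarrow> M \<in> {M \<in> lines. split lab M = split lab L}"
    using split_eq_iff[OF c _ L] by blast
  finally show "M \<in> split lab L \<longleftrightarrow> M \<in> {M \<in> lines. split lab M = split lab L}" .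
qed

text \<open>A surviving block with at least two lines is not bad, hence meets condition (i). If it
  contained all rows or all columns, it would be everything by \<open>full\<close> and the only
  block, so (ii) holds.\<close>

lemma admissible_split:
  assumes c: "canon lab" and full: "\<And>N. N \<in> lines \<Longrightarrow> R \<subseteq> lab N \<or> C \<subseteq> lab N \<Longrightarrow> lab N = lines"
  shows "admissible k l (split lab ` lines)"
  unfolding admissible_def
proof (intro conjI ballI impI)
  show "partition_on (Rset k l \<union> Cset k l) (split lab ` lines)"
    by (rule canon_partition[OF canon_split[OF c]])
  fix B assume "B \<in> split lab ` lines" "2 \<le> card B"
  then obtain L where L: "L \<in> lines" "B = split lab L" by blast
  have nb: "\<not> bad (lab L)" using \<open>2 \<le> card B\<close> L(2) by (auto simp: split_def)
  then have B: "B = lab L" using L(2) by (simp add: split_def)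
  show "3 \<le> card (B \<inter> Rset k l)" "3 \<le> card (B \<inter> Cset k l)"
    "4 \<le> max (card (B \<inter> Rset k l)) (card (B \<inter> Cset k l))"
    using nb unfolding B bad_def R_def C_def by blast+
  have "lab L \<noteq> lines" if "1 < card (split lab ` lines)"
  proof
    assume a: "lab L = lines"
    then have "split lab M = lines" if "M \<in> lines" for M
      using canonD[OF c L(1), of M] that nb by (simp add: split_def)
    then have "split lab ` lines = {lines}" using L(1) by auto
    then show False using that by simp
  qed
  then show "\<not> Rset k l \<subseteq> B" "\<not> Cset k l \<subseteq> B" if "1 < card (split lab ` lines)"
    using that full[OF L(1)] unfolding B R_def C_def by blast+
qed

text \<open>A polynomial curve \<Gamma> passes through the given matrix at t = 0 and lies in the
  parametrized set of the split partition for t \<noteq> 0. Polynomials vanishing on that set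
  therefore vanish at t = 0.\<close>

lemma tilted_in_split_range:
  assumes c: "canon lab" and x: "\<And>b. b \<in> lab ` lines \<Longrightarrow> bad b \<Longrightarrow> tilt lab \<theta> b (x b)"
  shows "phi lab \<theta> \<in> zariski_closure (k * l) (range (phi (split lab)))"
proof -
  \<comment> \<open>Normals of good blocks do not move, so they stay constant on those blocks along
    the curve.\<close>
  define X where "X L = (if bad (lab L) then x (lab L) L else (\<lambda>_. 0))" for L
  have "\<exists>a. bad (lab (rl p)) \<longrightarrow> lab (rl p) = lab (cl p) \<longrightarrow> col (phi lab \<theta>) p =
      (\<lambda>r. a * cross (W \<theta> (lab (rl p))) (\<lambda>r. X (cl p) r - X (rl p) r) r)" if "p \<in> P" for p
  proof (cases "bad (lab (rl p)) \<and> lab (rl p) = lab (cl p)")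
    case True
    have "tilt lab \<theta> (lab (rl p)) (x (lab (rl p)))"
      using x[OF imageI[OF R_lines[OF rl_in]]] True by blast
    then show ?thesis using that True unfolding tilt_def X_def by simp
  qed blast
  then obtain a where a: "\<And>p. p \<in> P \<Longrightarrow> bad (lab (rl p)) \<Longrightarrow> lab (rl p) = lab (cl p) \<Longrightarrow>
      col (phi lab \<theta>) p = (\<lambda>r. a p * cross (W \<theta> (lab (rl p))) (\<lambda>r. X (cl p) r - X (rl p) r) r)"
    by metis
  define w where "w t L = (\<lambda>r. W \<theta> (lab L) r + t * X L r)" for t L
  \<comment> \<open>For a row r and a column c, (w + t x_r) x (w + t x_c) = t (w x (x_c - x_r) + t
    x_r x x_c). The factor t is divided out inside bad blocks, so the value at t = 0 is the tilt
    direction and not zero.\<close>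
  define \<Gamma> where "\<Gamma> t = (\<lambda>r p. if p \<in> P then
      if lab (rl p) \<noteq> lab (cl p) then \<theta> (Inr (p, 3)) * cross (w t (rl p)) (w t (cl p)) r
      else if bad (lab (rl p)) then
        a p * (cross (W \<theta> (lab (rl p))) (\<lambda>r. X (cl p) r - X (rl p) r) r + t * cross (X (rl p)) (X (cl p)) r)
      else phi lab \<theta> r p else 0)" for t :: complex
  have amb: "\<Gamma> t \<in> ambient (k * l)" for t
    using phi_ambient[of lab \<theta>] by (auto simp: \<Gamma>_def ambient_def P_def)
  have \<Gamma>0: "\<Gamma> 0 = phi lab \<theta>"
  proof (intro ext)
    fix r p
    have w0: "w 0 L = W \<theta> (lab L)" for L by (simp add: w_def)
    consider "p \<notin> P" | "p \<in> P" "lab (rl p) \<noteq> lab (cl p)" | "p \<in> P" "lab (rl p) = lab (cl p)" "bad (lab (rl p))"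
      | "p \<in> P" "lab (rl p) = lab (cl p)" "\<not> bad (lab (rl p))" by blast
    then show "\<Gamma> 0 r p = phi lab \<theta> r p"
    proof cases
      case 3
      then show ?thesis using fun_cong[OF a[OF 3(1,3,2)], of r] by (simp add: \<Gamma>_def col_def)
    qed (simp_all add: \<Gamma>_def phi_def w0)
  qed
  have poly: "(\<lambda>t. \<Gamma> t r p) \<in> range poly" for r p
  proof -
    have wp: "(\<lambda>t. w t L r) \<in> range poly" for L r unfolding w_def by (rule range_poly_linear)
    consider "p \<notin> P" | "p \<in> P" "lab (rl p) \<noteq> lab (cl p)" | "p \<in> P" "lab (rl p) = lab (cl p)" "bad (lab (rl p))"
      | "p \<in> P" "lab (rl p) = lab (cl p)" "\<not> bad (lab (rl p))" by blast
    then show ?thesis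
    proof cases
      case 1
      then show ?thesis by (simp only: \<Gamma>_def if_False range_poly_const)
    next
      case 2
      then show ?thesis
        by (simp only: \<Gamma>_def if_True simp_thms) (intro range_poly_mult range_poly_const range_poly_cross wp)
    next
      case 3
      then show ?thesis
        by (simp only: \<Gamma>_def if_True if_False simp_thms) (intro range_poly_mult range_poly_const range_poly_linear)
    next
      case 4
      then show ?thesis by (simp only: \<Gamma>_def if_True if_False simp_thms range_poly_const)
    qed
  qed
  have in_range: "\<Gamma> t \<in> range (phi (split lab))" if t: "t \<noteq> 0" for t
  proof (rule range_phiI[where w = "w t", OF amb])
    fix L M assume LM: "L \<in> lines" "M \<in> lines" "split lab L = split lab M"
    then have "L = M \<or> (lab L = lab M \<and> \<not> bad (lab L))" using split_eq_iff[OF c] by blast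
    then show "w t L = w t M" by (auto simp: w_def X_def)
  next
    fix p assume p: "p \<in> P" "split lab (rl p) = split lab (cl p)"
    then have eq: "lab (rl p) = lab (cl p)" "\<not> bad (lab (rl p))"
      using split_eq_iff[OF c R_lines[OF rl_in] C_lines[OF cl_in[OF p(1)]]] rl_neq_cl by blast+
    have "col (\<Gamma> t) p = col (phi lab \<theta>) p" using p(1) eq by (simp add: \<Gamma>_def col_def)
    also have "\<dots> = cross (w t (rl p)) (\<lambda>r. \<theta> (Inr (p, 3)) * Z \<theta> p r)"
      using p(1) eq by (intro vec3_eqI[OF vec3_col[OF phi_ambient] vec3_cross(1)])
        (simp_all add: col_phi w_def X_def algebra_simps)
    finally show "\<exists>v. col (\<Gamma> t) p = cross (w t (rl p)) v" by blast
  next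
    fix p assume p: "p \<in> P" "split lab (rl p) \<noteq> split lab (cl p)"
    show "\<exists>c. col (\<Gamma> t) p = (\<lambda>r. c * cross (w t (rl p)) (w t (cl p)) r)"
    proof (cases "lab (rl p) = lab (cl p)")
      case False
      then show ?thesis using p(1) by (intro exI[of _ "\<theta> (Inr (p, 3))"]) (simp add: \<Gamma>_def col_def)
    next
      case True
      then have b: "bad (lab (rl p))" using p(2) by (auto simp: split_def)
      have "col (\<Gamma> t) p = (\<lambda>r. a p / t * cross (w t (rl p)) (w t (cl p)) r)"
        by (rule vec3_eqI[OF vec3_col[OF amb] vec3_cross(2)])
          (use p(1) True b t in \<open>simp_all add: \<Gamma>_def col_def w_def field_simps\<close>)
      then show ?thesis by blast
    qed
  qed
  have "g (phi lab \<theta>) = 0" if g: "g \<in> polyfun (k * l)" "\<forall>Y\<in>range (phi (split lab)). g Y = 0" for g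
  proof -
    have "(\<lambda>t. g (\<Gamma> t)) \<in> range poly" by (rule polyfun_comp_poly[OF g(1) poly])
    then obtain Q where Q: "\<And>t. g (\<Gamma> t) = poly Q t" by (auto simp: fun_eq_iff)
    have "poly Q t = 0" if "t \<noteq> 0" for t using g(2) in_range[OF that] Q by metis
    then have "poly Q 0 = 0" by (rule poly_vanish_punctured)
    then show ?thesis using Q[of 0] \<Gamma>0 by simp
  qed
  then show ?thesis using zariski_closure_iff[OF range_phi_ambient] phi_ambient by blast
qed

text \<open>The conditions of all bad blocks are collected, so that generically all of them are
  tilted simultaneously along one curve; density gives the remaining parameters.\<close>

lemma range_phi_split_closure:
  assumes c: "canon lab"
  shows "range (phi lab) \<subseteq> zariski_closure (k * l) (range (phi (split lab)))"
proof -
  let ?B = "{b \<in> lab ` lines. bad b}"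
  have "\<forall>b\<in>?B. \<exists>D. finite D \<and> D \<subseteq> pf \<and> (\<forall>d\<in>D. \<exists>\<theta>. d \<theta> \<noteq> 0) \<and>
     (\<forall>\<theta>. (\<forall>d\<in>D. d \<theta> \<noteq> 0) \<longrightarrow> (\<exists>x. tilt lab \<theta> b x))"
    using bad_generic_tilt[OF c] unfolding generic_tilt_def by auto
  from bchoice[OF this] obtain D where D: "\<forall>b\<in>?B. finite (D b) \<and> D b \<subseteq> pf \<and> (\<forall>d\<in>D b. \<exists>\<theta>. d \<theta> \<noteq> 0) \<and>
     (\<forall>\<theta>. (\<forall>d\<in>D b. d \<theta> \<noteq> 0) \<longrightarrow> (\<exists>x. tilt lab \<theta> b x))" by (elim exE)
  let ?D = "\<Union>b\<in>?B. D b"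
  have "g (phi lab \<theta>) = 0" if g: "g \<in> polyfun (k * l)" "\<forall>Y\<in>range (phi (split lab)). g Y = 0" for g \<theta>
  proof (rule pf_vanish_generic[where f = "\<lambda>\<theta>. g (phi lab \<theta>)" and X = ?D and g = "\<lambda>x. x"])
    show "(\<lambda>\<theta>. g (phi lab \<theta>)) \<in> pf" by (rule polyfun_comp_pf[OF g(1) phi_pf])
    show "finite ?D" using D by (intro finite_UN_I) auto
    show "d \<in> pf" if "d \<in> ?D" for d using D that by blast
    show "\<exists>\<theta>. d \<theta> \<noteq> 0" if "d \<in> ?D" for d using D that by blast
    fix \<theta> assume nz: "\<forall>d\<in>?D. d \<theta> \<noteq> 0"
    have "\<exists>x. tilt lab \<theta> b x" if "b \<in> ?B" for b using D nz that by blast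
    then obtain x where "\<And>b. b \<in> ?B \<Longrightarrow> tilt lab \<theta> b (x b)" by metis
    then have "phi lab \<theta> \<in> zariski_closure (k * l) (range (phi (split lab)))"
      using tilted_in_split_range[OF c, of \<theta> x] by blast
    then show "g (phi lab \<theta>) = 0" using g zariski_closure_iff[OF range_phi_ambient] by blast
  qed
  then show ?thesis using zariski_closure_iff[OF range_phi_ambient] phi_ambient by blast
qed

text \<open>Each point lies on a row and on a column, so the normal of such a block is orthogonal to
  every point and can serve all lines.\<close>

lemma range_phi_merge:
  assumes c: "canon lab" and N: "N \<in> lines" "R \<subseteq> lab N \<or> C \<subseteq> lab N"
  shows "range (phi lab) \<subseteq> range (phi (\<lambda>_. lines))"
proof (rule image_subsetI)
  fix \<theta>
  show "phi lab \<theta> \<in> range (phi (\<lambda>_. lines))"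
  proof (rule range_phiI[where w = "\<lambda>_. W \<theta> (lab N)", OF phi_ambient refl])
    fix p assume p: "p \<in> P"
    have "lab N = lab (rl p) \<or> lab N = lab (cl p)"
      using N(2) canonD[OF c N(1)] rl_in cl_in[OF p] by blast
    then obtain a v where "col (phi lab \<theta>) p = (\<lambda>r. a * cross (W \<theta> (lab N)) v r)"
      using col_phi_multiple[OF p] by blast
    also have "\<dots> = cross (W \<theta> (lab N)) (\<lambda>r. a * v r)"
      by (rule vec3_eqI[OF vec3_cross(2) vec3_cross(1)]) (simp_all add: algebra_simps)
    finally show "\<exists>v. col (phi lab \<theta>) p = cross (W \<theta> (lab N)) v" by blast
  qed simp_all
qed

lemma V_Delta_subset_union:
  assumes "Y \<in> V_Delta k l"
  shows "\<exists>lab. canon lab \<and> admissible k l (lab ` lines) \<and> Y \<in> matroid_variety (k * l) (gdep lab)"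
proof -
  \<comment> \<open>Merging comes before splitting, so that \<open>admissible_split\<close> applies.
    For k = l = 3 the merged block is itself bad and is split into single lines afterwards.\<close>
  have "\<exists>lab. canon lab \<and> Y \<in> range (phi lab) \<and>
      (\<forall>N\<in>lines. R \<subseteq> lab N \<or> C \<subseteq> lab N \<longrightarrow> lab N = lines)"
  proof -
    obtain lab where lab: "canon lab" "Y \<in> range (phi lab)" using V_Delta_cover[OF assms] by blast
    show ?thesis
    proof (cases "\<exists>N\<in>lines. R \<subseteq> lab N \<or> C \<subseteq> lab N")
      case True
      then have "Y \<in> range (phi (\<lambda>_. lines))" using range_phi_merge[OF lab(1)] lab(2) by blast
      moreover have "canon (\<lambda>_. lines)" by (simp add: canon_def)
      ultimately show ?thesis by (intro exI[of _ "\<lambda>_. lines"]) simp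
    next
      case False
      then show ?thesis using lab by blast
    qed
  qed
  then obtain lab where lab: "canon lab" "Y \<in> range (phi lab)"
    "\<forall>N\<in>lines. R \<subseteq> lab N \<or> C \<subseteq> lab N \<longrightarrow> lab N = lines" by blast
  have adm: "admissible k l (split lab ` lines)" using admissible_split[OF lab(1)] lab(3) by blast
  have "Y \<in> zariski_closure (k * l) (range (phi (split lab)))"
    using range_phi_split_closure[OF lab(1)] lab(2) by blast
  then have "Y \<in> matroid_variety (k * l) (gdep (split lab))"
    using matroid_variety_eq[OF canon_split[OF lab(1)] adm] by simp
  then show ?thesis using canon_split[OF lab(1)] adm by blast
qed

lemma admissible_canon:
  assumes "admissible k l Q"
  obtains lab where "canon lab" "Q = lab ` lines"
proof -
  have "partition_on (Rset k l \<union> Cset k l) Q" using assms by (simp add: admissible_def)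
  from partition_canon[OF this] show ?thesis using that by (elim exE conjE)
qed

end

theorem theorem5p8:
  fixes k l :: nat
  assumes "3 \<le> k" and "3 \<le> l"
  shows "V_Delta k l = (\<Union>Q\<in>{Q. admissible k l Q}. matroid_variety (k*l) (G_dep k l Q))
     \<and> (\<forall>Q. admissible k l Q \<longrightarrow> zariski_irreducible (k*l) (matroid_variety (k*l) (G_dep k l Q)))
     \<and> (\<forall>Q Q'. admissible k l Q \<and> admissible k l Q' \<and> Q \<noteq> Q' \<longrightarrow>
          \<not> matroid_variety (k*l) (G_dep k l Q) \<subseteq> matroid_variety (k*l) (G_dep k l Q'))"
proof -
  interpret grid k l by unfold_locales (rule assms)+
  show ?thesis
  proof (intro conjI allI impI subset_antisym subsetI notI)
    fix Y assume "Y \<in> V_Delta k l"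
    then show "Y \<in> (\<Union>Q\<in>{Q. admissible k l Q}. matroid_variety (k*l) (G_dep k l Q))"
      using V_Delta_subset_union by blast
  next
    fix Y assume "Y \<in> (\<Union>Q\<in>{Q. admissible k l Q}. matroid_variety (k*l) (G_dep k l Q))"
    then obtain Q where Q: "admissible k l Q" "Y \<in> matroid_variety (k*l) (G_dep k l Q)" by blast
    obtain lab where "canon lab" "Q = lab ` lines" using admissible_canon[OF Q(1)] .
    then show "Y \<in> V_Delta k l" using matroid_variety_subset_V_Delta Q(2) by blast
  next
    fix Q assume Q: "admissible k l Q"
    obtain lab where "canon lab" "Q = lab ` lines" using admissible_canon[OF Q] .
    then show "zariski_irreducible (k*l) (matroid_variety (k*l) (G_dep k l Q))"
      using irreducible_matroid_variety Q by blast
  next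
    fix Q Q'
    assume Q: "admissible k l Q \<and> admissible k l Q' \<and> Q \<noteq> Q'"
      and sub: "matroid_variety (k*l) (G_dep k l Q) \<subseteq> matroid_variety (k*l) (G_dep k l Q')"
    obtain lab where lab: "canon lab" "Q = lab ` lines" using admissible_canon Q by blast
    obtain lab' where lab': "canon lab'" "Q' = lab' ` lines" using admissible_canon Q by blast
    show False
      using matroid_variety_subset_imp_eq[OF lab(1) _ lab'(1)] Q sub lab(2) lab'(2) by blast
  qed
qed

end
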